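(* Let $(M,\mathcal{F}_0)$ and $(N,\mathcal{F}_1)$ be closed oriented manifolds with Riemannian foliations. If $f:(M,\mathcal{F}_0)\to(N,\mathcal{F}_1)$ is a foliated homotopy equivalence and $\omega$ is a leafwise closed $1$-form on $(N,\mathcal{F}_1)$, then $$H_{\omega}^{k}(N,d_{\mathcal{F}_{1}})\cong H_{f^{*}\omega}^{k}(M,d_{\mathcal{F}_{0}})\quad\text{for all }k.$$
   Context: All manifolds, foliations, maps, functions and forms are smooth. A foliation is Riemannian if the manifold admits a bundle-like metric, i.e. a Riemannian metric such that a geodesic orthogonal to the leaf at one point is orthogonal to every leaf it meets. For a foliated manifold $(M,\mathcal{F})$ with leafwise tangent bundle $T\mathcal{F}$, the leafwise $k$-forms are $\Omega^{0,k}(M,\mathcal{F})=\Gamma(\Lambda^kT^*\mathcal{F})$, and $d_{\mathcal{F}}:\Omega^{0,k}(M,\mathcal{F})\to\Omega^{0,k+1}(M,\mathcal{F})$ is the exterior derivative along the leaves. A leafwise closed $1$-form is $\omega\in\Omega^{0,1}(M,\mathcal{F})$ with $d_{\mathcal{F}}\omega=0$. The operator $d^{\omega}_{\mathcal{F}}=d_{\mathcal{F}}+\omega\wedge$ squares to zero, and the leafwise Morse-Novikov cohomology is $$H^{k}_{\omega}(M,d_{\mathcal{F}})=\frac{\ker(d_{\mathcal{F}}^{\omega}:\Omega^{0,k}\to\Omega^{0,k+1})}{\mathrm{im}(d_{\mathcal{F}}^{\omega}:\Omega^{0,k-1}\to\Omega^{0,k})}.$$ A foliated map $f:(M,\mathcal{F}_0)\to(N,\mathcal{F}_1)$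 is a smooth map sending leaves into leaves; it induces the pullback $f^*$ of leafwise forms, $(f^*\alpha)_x(X_1,\dots,X_k)=\alpha_{f(x)}(df_xX_1,\dots,df_xX_k)$ for $X_i\in T_x\mathcal{F}_0$. Two foliated maps $f_0,f_1:(M,\mathcal{F}_0)\to(N,\mathcal{F}_1)$ are foliated (leafwise) homotopic if there is a smooth map $F:M\times[0,1]\to N$ with $F|_{M\times\{0\}}=f_0$, $F|_{M\times\{1\}}=f_1$, such that each $F_t=F|_{M\times\{t\}}$ maps leaves of $\mathcal{F}_0$ into leaves of $\mathcal{F}_1$, and for every $x\in M$ and all $t_1,t_2\in[0,1]$ the points $F_{t_1}(x),F_{t_2}(x)$ lie in the same leaf of $\mathcal{F}_1$. A foliated map $f:(M,\mathcal{F}_0)\to(N,\mathcal{F}_1)$ is a foliated homotopy equivalence if there is a foliated map $g:(N,\mathcal{F}_1)\to(M,\mathcal{F}_0)$ such that $f\circ g$ is foliated homotopic to the identity of $N$ and $g\circ f$ is foliated homotopic to the identity of $M$. *)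

theory Defs
  imports "HOL-Analysis.Analysis"
begin

section \<open>Smooth maps between finite-dimensional vector spaces\<close>

text \<open>
  Model spaces are finite-dimensional normed spaces rather than instances of the library's class
  of Euclidean spaces, because the latter have positive dimension: leaves of dimension 0 and
  foliations of codimension 0 have to be covered.
\<close>

definition finite_dim :: "'e::real_normed_vector itself \<Rightarrow> bool" where
  "finite_dim _ \<longleftrightarrow> (\<exists>B::'e set. finite B \<and> span B = UNIV)"

text \<open>On an open subset of a finite-dimensional space this is the usual class \<open>C\<^sup>k\<close>:
  all iterated directional derivatives up to order \<open>k\<close> exist and are continuous.\<close>

primrec Ck_on :: "nat \<Rightarrow> ('e::real_normed_vector \<Rightarrow> 'f::real_normed_vector) \<Rightarrow> 'e set \<Rightarrow> bool" where
  "Ck_on 0 f W \<longleftrightarrow> continuous_on W f"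
| "Ck_on (Suc k) f W \<longleftrightarrow>
     (\<forall>x\<in>W. f differentiable (at x)) \<and> (\<forall>v. Ck_on k (\<lambda>x. frechet_derivative f (at x) v) W)"

text \<open>Smoothness on an arbitrary subset means existence of local smooth extensions. For open
  subsets this is ordinary smoothness; non-open subsets occur only for homotopies, whose
  time parameter ranges over the closed unit interval.\<close>

definition smooth_on :: "'e::real_normed_vector set \<Rightarrow> ('e \<Rightarrow> 'f::real_normed_vector) \<Rightarrow> bool" where
  "smooth_on S f \<longleftrightarrow>
     (\<forall>x\<in>S. \<exists>W g. open W \<and> x \<in> W \<and> (\<forall>k. Ck_on k g W) \<and> (\<forall>y\<in>S \<inter> W. g y = f y))"

text \<open>Leibniz formula for the determinant of an endomorphism with respect to some basis.\<close>

definition lin_det :: "('e::real_normed_vector \<Rightarrow> 'e) \<Rightarrow> real" where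
  "lin_det L = (let B = extend_basis {} in
     \<Sum>\<sigma> | \<sigma> permutes B. of_int (sign \<sigma>) * (\<Prod>b\<in>B. representation B (L b) (\<sigma> b)))"


section \<open>Manifolds\<close>

text \<open>A chart is a pair of its domain and a map whose values outside the domain are irrelevant.
  The underlying set of a manifold is the whole type \<open>'a\<close>.\<close>

type_synonym ('a, 'e) chart = "'a set \<times> ('a \<Rightarrow> 'e)"

definition inv_chart :: "('a, 'e) chart \<Rightarrow> 'e \<Rightarrow> 'a" where
  "inv_chart c = inv_into (fst c) (snd c)"

definition is_chart :: "('a::topological_space, 'e::real_normed_vector) chart \<Rightarrow> bool" where
  "is_chart c \<longleftrightarrow> open (fst c) \<and> open (snd c ` fst c) \<and>
     homeomorphism (fst c) (snd c ` fst c) (snd c) (inv_chart c)"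

definition overlap :: "('a, 'e) chart \<Rightarrow> ('a, 'e) chart \<Rightarrow> 'e set" where
  "overlap c d = snd c ` (fst c \<inter> fst d)"

definition transition :: "('a, 'e) chart \<Rightarrow> ('a, 'e) chart \<Rightarrow> 'e \<Rightarrow> 'e" where
  "transition c d = snd d \<circ> inv_chart c"

text \<open>The Hausdorff property and second countability of a manifold are expressed by the sort
  of \<open>'a\<close>.\<close>

definition smooth_atlas ::
  "('a::{t2_space,second_countable_topology}, 'e::real_normed_vector) chart set \<Rightarrow> bool" where
  "smooth_atlas A \<longleftrightarrow> finite_dim TYPE('e) \<and> (\<forall>c\<in>A. is_chart c) \<and> (\<Union>c\<in>A. fst c) = UNIV \<and>
     (\<forall>c\<in>A. \<forall>d\<in>A. smooth_on (overlap c d) (transition c d))"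

text \<open>An orientation of the manifold with atlas \<open>A\<close>, given by an oriented atlas \<open>Q\<close>
  of the same smooth structure.\<close>

definition orientation ::
  "('a::{t2_space,second_countable_topology}, 'e::real_normed_vector) chart set \<Rightarrow>
   ('a, 'e) chart set \<Rightarrow> bool" where
  "orientation A Q \<longleftrightarrow> smooth_atlas Q \<and> smooth_atlas (A \<union> Q) \<and>
     (\<forall>c\<in>Q. \<forall>d\<in>Q. \<forall>u\<in>overlap c d. lin_det (frechet_derivative (transition c d) (at u)) > 0)"

definition smooth_map ::
  "('a::topological_space, 'e::real_normed_vector) chart set \<Rightarrow>
   ('b::topological_space, 'f::real_normed_vector) chart set \<Rightarrow> ('a \<Rightarrow> 'b) \<Rightarrow> bool" where
  "smooth_map A A' f \<longleftrightarrow> continuous_on UNIV f \<and>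
     (\<forall>c\<in>A. \<forall>d\<in>A'. smooth_on (snd c ` (fst c \<inter> f -` fst d)) (snd d \<circ> f \<circ> inv_chart c))"

text \<open>A tangent vector at \<open>x\<close> is represented by the family of its coordinate vectors in all
  charts of the atlas around \<open>x\<close> (and 0 at all other charts).\<close>

type_synonym ('a, 'e) tvec = "('a, 'e) chart \<Rightarrow> 'e"

definition tangent_space ::
  "('a, 'e::real_normed_vector) chart set \<Rightarrow> 'a \<Rightarrow> ('a, 'e) tvec set" where
  "tangent_space A x = {X.
     (\<forall>c. \<not> (c \<in> A \<and> x \<in> fst c) \<longrightarrow> X c = 0) \<and>
     (\<forall>c\<in>A. \<forall>d\<in>A. x \<in> fst c \<and> x \<in> fst d \<longrightarrow>
        X d = frechet_derivative (transition c d) (at (snd c x)) (X c))}"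

definition tvec_of ::
  "('a, 'e::real_normed_vector) chart set \<Rightarrow> ('a, 'e) chart \<Rightarrow> 'a \<Rightarrow> 'e \<Rightarrow> ('a, 'e) tvec" where
  "tvec_of A c x v = (\<lambda>d. if d \<in> A \<and> x \<in> fst d
     then frechet_derivative (transition c d) (at (snd c x)) v else 0)"

definition chart_at :: "('a, 'e) chart set \<Rightarrow> 'a \<Rightarrow> ('a, 'e) chart" where
  "chart_at A x = (SOME c. c \<in> A \<and> x \<in> fst c)"

text \<open>The differential of \<open>f\<close> at \<open>x\<close>; on tangent vectors it does not depend on the
  choice of the chart around \<open>x\<close>.\<close>

definition differential ::
  "('a, 'e::real_normed_vector) chart set \<Rightarrow> ('b, 'f::real_normed_vector) chart set \<Rightarrow>
   ('a \<Rightarrow> 'b) \<Rightarrow> 'a \<Rightarrow> ('a, 'e) tvec \<Rightarrow> ('b, 'f) tvec" where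
  "differential A A' f x X = (\<lambda>d. if d \<in> A' \<and> f x \<in> fst d
     then let c = chart_at A x
          in frechet_derivative (snd d \<circ> f \<circ> inv_chart c) (at (snd c x)) (X c)
     else 0)"


section \<open>Foliations\<close>

text \<open>A foliation is given by a foliated atlas: charts take values in \<open>'p \<times> 'q\<close>, with
  leafwise coordinates in \<open>'p\<close> and transverse coordinates in \<open>'q\<close>, and transitions are
  locally of the form \<open>(y, z) \<mapsto> (h(y, z), g(z))\<close>.\<close>

definition foliated_atlas ::
  "('a::{t2_space,second_countable_topology},
    'p::real_normed_vector \<times> 'q::real_normed_vector) chart set \<Rightarrow> bool" where
  "foliated_atlas A \<longleftrightarrow> smooth_atlas A \<and>
     (\<forall>c\<in>A. \<forall>d\<in>A. \<forall>u\<in>overlap c d.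
        \<exists>V g. open V \<and> u \<in> V \<and> V \<subseteq> overlap c d \<and> (\<forall>w\<in>V. snd (transition c d w) = g (snd w)))"

text \<open>Plaques are the connected components of the slices of constant transverse coordinate;
  leaves are the classes of points connected by chains of plaques.\<close>

definition same_plaque ::
  "('a, 'p::real_normed_vector \<times> 'q::real_normed_vector) chart set \<Rightarrow> 'a \<Rightarrow> 'a \<Rightarrow> bool" where
  "same_plaque A x y \<longleftrightarrow> (\<exists>c\<in>A. x \<in> fst c \<and> y \<in> fst c \<and>
     connected_component {u \<in> snd c ` fst c. snd u = snd (snd c x)} (snd c x) (snd c y))"

definition leaf ::
  "('a, 'p::real_normed_vector \<times> 'q::real_normed_vector) chart set \<Rightarrow> 'a \<Rightarrow> 'a set" where
  "leaf A x = {y. (same_plaque A)\<^sup>*\<^sup>* x y}"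

definition leaf_tangent_space ::
  "('a, 'p::real_normed_vector \<times> 'q::real_normed_vector) chart set \<Rightarrow> 'a \<Rightarrow>
   ('a, 'p \<times> 'q) tvec set" where
  "leaf_tangent_space A x = {X \<in> tangent_space A x. \<forall>c\<in>A. x \<in> fst c \<longrightarrow> snd (X c) = 0}"


subsection \<open>Riemannian foliations\<close>

definition metric_in_chart ::
  "('a, 'e::real_normed_vector) chart set \<Rightarrow>
   ('a \<Rightarrow> ('a, 'e) tvec \<Rightarrow> ('a, 'e) tvec \<Rightarrow> real) \<Rightarrow> ('a, 'e) chart \<Rightarrow> 'e \<Rightarrow> 'e \<Rightarrow> 'e \<Rightarrow> real" where
  "metric_in_chart A g c u v w =
     g (inv_chart c u) (tvec_of A c (inv_chart c u) v) (tvec_of A c (inv_chart c u) w)"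

definition riemannian_metric ::
  "('a, 'e::real_normed_vector) chart set \<Rightarrow>
   ('a \<Rightarrow> ('a, 'e) tvec \<Rightarrow> ('a, 'e) tvec \<Rightarrow> real) \<Rightarrow> bool" where
  "riemannian_metric A g \<longleftrightarrow>
     (\<forall>x. \<forall>X\<in>tangent_space A x. \<forall>Y\<in>tangent_space A x. \<forall>Z\<in>tangent_space A x. \<forall>r s.
        g x X Y = g x Y X \<and>
        g x (\<lambda>c. r *\<^sub>R X c + s *\<^sub>R Y c) Z = r * g x X Z + s * g x Y Z) \<and>
     (\<forall>x. \<forall>X\<in>tangent_space A x. X \<noteq> (\<lambda>c. 0) \<longrightarrow> g x X X > 0) \<and>
     (\<forall>c\<in>A. \<forall>v w. smooth_on (snd c ` fst c) (\<lambda>u. metric_in_chart A g c u v w))"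

definition velocity ::
  "('a, 'e::real_normed_vector) chart set \<Rightarrow> (real \<Rightarrow> 'a) \<Rightarrow> real \<Rightarrow> ('a, 'e) tvec" where
  "velocity A \<gamma> t = (\<lambda>c. if c \<in> A \<and> \<gamma> t \<in> fst c
     then vector_derivative (snd c \<circ> \<gamma>) (at t) else 0)"

text \<open>The last clause is the geodesic equation of the Levi-Civita connection in a chart, with
  the upper index lowered and contracted with a vector \<open>w\<close>: if \<open>u\<close> is the
  coordinate curve, then
  \<open>g(u'', w) + (D\<^bsub>u'\<^esub> g)(u', w) - 1/2 (D\<^bsub>w\<^esub> g)(u', u') = 0\<close>.\<close>

definition geodesic_on ::
  "('a::topological_space, 'e::real_normed_vector) chart set \<Rightarrow>
   ('a \<Rightarrow> ('a, 'e) tvec \<Rightarrow> ('a, 'e) tvec \<Rightarrow> real) \<Rightarrow> real set \<Rightarrow> (real \<Rightarrow> 'a) \<Rightarrow> bool" where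
  "geodesic_on A g I \<gamma> \<longleftrightarrow> open I \<and> is_interval I \<and> continuous_on I \<gamma> \<and>
     (\<forall>c\<in>A. smooth_on {t \<in> I. \<gamma> t \<in> fst c} (snd c \<circ> \<gamma>)) \<and>
     (\<forall>c\<in>A. \<forall>t\<in>I. \<gamma> t \<in> fst c \<longrightarrow>
       (let u = snd c \<circ> \<gamma>;
            u' = (\<lambda>s. vector_derivative u (at s));
            u'' = (\<lambda>s. vector_derivative u' (at s));
            G = metric_in_chart A g c
        in \<forall>w. G (u t) (u'' t) w
               + frechet_derivative (\<lambda>z. G z (u' t) w) (at (u t)) (u' t)
               - 1/2 * frechet_derivative (\<lambda>z. G z (u' t) (u' t)) (at (u t)) w = 0))"

definition orthogonal_to_leaf ::
  "('a, 'p::real_normed_vector \<times> 'q::real_normed_vector) chart set \<Rightarrow>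
   ('a \<Rightarrow> ('a, 'p \<times> 'q) tvec \<Rightarrow> ('a, 'p \<times> 'q) tvec \<Rightarrow> real) \<Rightarrow> (real \<Rightarrow> 'a) \<Rightarrow> real \<Rightarrow> bool" where
  "orthogonal_to_leaf A g \<gamma> t \<longleftrightarrow>
     (\<forall>Y\<in>leaf_tangent_space A (\<gamma> t). g (\<gamma> t) (velocity A \<gamma> t) Y = 0)"

definition bundle_like ::
  "('a::topological_space, 'p::real_normed_vector \<times> 'q::real_normed_vector) chart set \<Rightarrow>
   ('a \<Rightarrow> ('a, 'p \<times> 'q) tvec \<Rightarrow> ('a, 'p \<times> 'q) tvec \<Rightarrow> real) \<Rightarrow> bool" where
  "bundle_like A g \<longleftrightarrow> riemannian_metric A g \<and>
     (\<forall>I \<gamma>. geodesic_on A g I \<gamma> \<longrightarrow>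
        (\<exists>t\<in>I. orthogonal_to_leaf A g \<gamma> t) \<longrightarrow> (\<forall>t\<in>I. orthogonal_to_leaf A g \<gamma> t))"

definition riemannian_foliation ::
  "('a::{t2_space,second_countable_topology},
    'p::real_normed_vector \<times> 'q::real_normed_vector) chart set \<Rightarrow> bool" where
  "riemannian_foliation A \<longleftrightarrow> foliated_atlas A \<and> (\<exists>g. bundle_like A g)"


subsection \<open>Foliated maps and foliated homotopies\<close>

definition foliated_map ::
  "('a::topological_space, 'p::real_normed_vector \<times> 'q::real_normed_vector) chart set \<Rightarrow>
   ('b::topological_space, 'r::real_normed_vector \<times> 's::real_normed_vector) chart set \<Rightarrow>
   ('a \<Rightarrow> 'b) \<Rightarrow> bool" where
  "foliated_map A A' f \<longleftrightarrow> smooth_map A A' f \<and> (\<forall>x. f ` leaf A x \<subseteq> leaf A' (f x))"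

definition foliated_homotopic ::
  "('a::topological_space, 'p::real_normed_vector \<times> 'q::real_normed_vector) chart set \<Rightarrow>
   ('b::topological_space, 'r::real_normed_vector \<times> 's::real_normed_vector) chart set \<Rightarrow>
   ('a \<Rightarrow> 'b) \<Rightarrow> ('a \<Rightarrow> 'b) \<Rightarrow> bool" where
  "foliated_homotopic A A' f0 f1 \<longleftrightarrow> foliated_map A A' f0 \<and> foliated_map A A' f1 \<and>
     (\<exists>F :: 'a \<times> real \<Rightarrow> 'b.
        continuous_on (UNIV \<times> {0..1}) F \<and>
        (\<forall>c\<in>A. \<forall>d\<in>A'. smooth_on
           {(u, t). u \<in> snd c ` fst c \<and> t \<in> {0..1} \<and> F (inv_chart c u, t) \<in> fst d}
           (\<lambda>(u, t). snd d (F (inv_chart c u, t)))) \<and>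
        (\<forall>x. F (x, 0) = f0 x \<and> F (x, 1) = f1 x) \<and>
        (\<forall>t\<in>{0..1}. \<forall>x. (\<lambda>y. F (y, t)) ` leaf A x \<subseteq> leaf A' (F (x, t))) \<and>
        (\<forall>x. \<forall>t1\<in>{0..1}. \<forall>t2\<in>{0..1}. F (x, t2) \<in> leaf A' (F (x, t1))))"

definition foliated_homotopy_equivalence ::
  "('a::topological_space, 'p::real_normed_vector \<times> 'q::real_normed_vector) chart set \<Rightarrow>
   ('b::topological_space, 'r::real_normed_vector \<times> 's::real_normed_vector) chart set \<Rightarrow>
   ('a \<Rightarrow> 'b) \<Rightarrow> bool" where
  "foliated_homotopy_equivalence A A' f \<longleftrightarrow> foliated_map A A' f \<and>
     (\<exists>g. foliated_map A' A g \<and>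
        foliated_homotopic A' A' (f \<circ> g) id \<and> foliated_homotopic A A (g \<circ> f) id)"


section \<open>Leafwise forms and leafwise Morse-Novikov cohomology\<close>

text \<open>Forms take the list of their arguments. They are normalized to vanish on lists of the wrong
  length or with entries not tangent to the leaf, so that equality of forms is equality of
  functions.\<close>

type_synonym ('a, 'e) form = "'a \<Rightarrow> ('a, 'e) tvec list \<Rightarrow> real"

definition del_nth :: "nat \<Rightarrow> 'x list \<Rightarrow> 'x list" where
  "del_nth i xs = take i xs @ drop (Suc i) xs"

definition leaf_form_at ::
  "('a, 'p::real_normed_vector \<times> 'q::real_normed_vector) chart set \<Rightarrow> nat \<Rightarrow> 'a \<Rightarrow>
   (('a, 'p \<times> 'q) tvec list \<Rightarrow> real) \<Rightarrow> bool" where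
  "leaf_form_at A k x a \<longleftrightarrow>
     (\<forall>Xs. \<not> (length Xs = k \<and> set Xs \<subseteq> leaf_tangent_space A x) \<longrightarrow> a Xs = 0) \<and>
     (\<forall>Xs. length Xs = k \<and> set Xs \<subseteq> leaf_tangent_space A x \<longrightarrow>
        (\<forall>i<k. \<forall>Y\<in>leaf_tangent_space A x. \<forall>Z\<in>leaf_tangent_space A x. \<forall>r s.
           a (Xs[i := (\<lambda>c. r *\<^sub>R Y c + s *\<^sub>R Z c)]) = r * a (Xs[i := Y]) + s * a (Xs[i := Z])) \<and>
        (\<forall>j<k. \<forall>i<j. Xs ! i = Xs ! j \<longrightarrow> a Xs = 0))"

text \<open>The function \<open>u \<mapsto> \<alpha>(v\<^sub>1, \<dots>, v\<^sub>k)\<close> in the chart \<open>c\<close>, where the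
  \<open>v\<^sub>i\<close> are constant coordinate vector fields along the leaves.\<close>

definition form_in_chart ::
  "('a, 'p::real_normed_vector \<times> 'q::real_normed_vector) chart set \<Rightarrow> ('a, 'p \<times> 'q) form \<Rightarrow>
   ('a, 'p \<times> 'q) chart \<Rightarrow> 'p list \<Rightarrow> 'p \<times> 'q \<Rightarrow> real" where
  "form_in_chart A \<alpha> c vs u =
     \<alpha> (inv_chart c u) (map (\<lambda>v. tvec_of A c (inv_chart c u) (v, 0)) vs)"

definition leaf_forms ::
  "('a, 'p::real_normed_vector \<times> 'q::real_normed_vector) chart set \<Rightarrow> nat \<Rightarrow>
   ('a, 'p \<times> 'q) form set" where
  "leaf_forms A k = {\<alpha>. (\<forall>x. leaf_form_at A k x (\<alpha> x)) \<and>
     (\<forall>c\<in>A. \<forall>vs. length vs = k \<longrightarrow> smooth_on (snd c ` fst c) (form_in_chart A \<alpha> c vs))}"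

text \<open>The leafwise exterior derivative in a foliated chart is
  \<open>(d\<alpha>)(v\<^sub>0, \<dots>, v\<^sub>k) = \<Sum>\<^sub>i (-1)\<^sup>i \<partial>\<^bsub>v\<^sub>i\<^esub> (\<alpha>(\<dots>, v\<^sub>i omitted, \<dots>))\<close>
  for constant leafwise vectors; it does not depend on the choice of the chart.\<close>

definition leaf_d ::
  "('a, 'p::real_normed_vector \<times> 'q::real_normed_vector) chart set \<Rightarrow> ('a, 'p \<times> 'q) form \<Rightarrow>
   ('a, 'p \<times> 'q) form" where
  "leaf_d A \<alpha> = (\<lambda>x Xs. if set Xs \<subseteq> leaf_tangent_space A x
     then let c = chart_at A x; vs = map (\<lambda>X. fst (X c)) Xs
          in \<Sum>i<length Xs. (- 1) ^ i *
               frechet_derivative (form_in_chart A \<alpha> c (del_nth i vs)) (at (snd c x)) (vs ! i, 0)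
     else 0)"

definition wedge1 :: "('a, 'e) form \<Rightarrow> ('a, 'e) form \<Rightarrow> ('a, 'e) form" where
  "wedge1 \<omega> \<alpha> = (\<lambda>x Xs. \<Sum>i<length Xs. (- 1) ^ i * \<omega> x [Xs ! i] * \<alpha> x (del_nth i Xs))"

definition lincomb :: "real \<Rightarrow> ('a, 'e) form \<Rightarrow> real \<Rightarrow> ('a, 'e) form \<Rightarrow> ('a, 'e) form" where
  "lincomb r \<alpha> s \<beta> = (\<lambda>x Xs. r * \<alpha> x Xs + s * \<beta> x Xs)"

definition zero_form :: "('a, 'e) form" where
  "zero_form = (\<lambda>x Xs. 0)"

definition twisted_d ::
  "('a, 'p::real_normed_vector \<times> 'q::real_normed_vector) chart set \<Rightarrow> ('a, 'p \<times> 'q) form \<Rightarrow>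
   ('a, 'p \<times> 'q) form \<Rightarrow> ('a, 'p \<times> 'q) form" where
  "twisted_d A \<omega> \<alpha> = lincomb 1 (leaf_d A \<alpha>) 1 (wedge1 \<omega> \<alpha>)"

definition leafwise_closed_1form ::
  "('a, 'p::real_normed_vector \<times> 'q::real_normed_vector) chart set \<Rightarrow> ('a, 'p \<times> 'q) form \<Rightarrow> bool"
  where "leafwise_closed_1form A \<omega> \<longleftrightarrow> \<omega> \<in> leaf_forms A 1 \<and> leaf_d A \<omega> = zero_form"

definition pullback ::
  "('a, 'p::real_normed_vector \<times> 'q::real_normed_vector) chart set \<Rightarrow>
   ('b, 'r::real_normed_vector \<times> 's::real_normed_vector) chart set \<Rightarrow>
   ('a \<Rightarrow> 'b) \<Rightarrow> ('b, 'r \<times> 's) form \<Rightarrow> ('a, 'p \<times> 'q) form" where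
  "pullback A A' f \<alpha> = (\<lambda>x Xs. if set Xs \<subseteq> leaf_tangent_space A x
     then \<alpha> (f x) (map (differential A A' f x) Xs) else 0)"

definition cocycles ::
  "('a, 'p::real_normed_vector \<times> 'q::real_normed_vector) chart set \<Rightarrow> ('a, 'p \<times> 'q) form \<Rightarrow> nat \<Rightarrow>
   ('a, 'p \<times> 'q) form set" where
  "cocycles A \<omega> k = {\<alpha> \<in> leaf_forms A k. twisted_d A \<omega> \<alpha> = zero_form}"

definition coboundaries ::
  "('a, 'p::real_normed_vector \<times> 'q::real_normed_vector) chart set \<Rightarrow> ('a, 'p \<times> 'q) form \<Rightarrow> nat \<Rightarrow>
   ('a, 'p \<times> 'q) form set" where
  "coboundaries A \<omega> k =
     (case k of 0 \<Rightarrow> {zero_form} | Suc j \<Rightarrow> twisted_d A \<omega> ` leaf_forms A j)"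

definition cohomologous ::
  "('a, 'p::real_normed_vector \<times> 'q::real_normed_vector) chart set \<Rightarrow> ('a, 'p \<times> 'q) form \<Rightarrow> nat \<Rightarrow>
   (('a, 'p \<times> 'q) form \<times> ('a, 'p \<times> 'q) form) set" where
  "cohomologous A \<omega> k = {(\<alpha>, \<beta>). \<alpha> \<in> cocycles A \<omega> k \<and> \<beta> \<in> cocycles A \<omega> k \<and>
     lincomb 1 \<alpha> (- 1) \<beta> \<in> coboundaries A \<omega> k}"

text \<open>A real vector space on an explicit carrier, with the operation
  \<open>(r, x, s, y) \<mapsto> r x + s y\<close>.\<close>

record 'v real_space =
  vectors :: "'v set"
  comb :: "real \<Rightarrow> 'v \<Rightarrow> real \<Rightarrow> 'v \<Rightarrow> 'v"

definition cohomology ::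
  "('a, 'p::real_normed_vector \<times> 'q::real_normed_vector) chart set \<Rightarrow> ('a, 'p \<times> 'q) form \<Rightarrow> nat \<Rightarrow>
   ('a, 'p \<times> 'q) form set real_space" where
  "cohomology A \<omega> k =
     \<lparr>vectors = cocycles A \<omega> k // cohomologous A \<omega> k,
      comb = (\<lambda>r S s T. \<Union>\<alpha>\<in>S. \<Union>\<beta>\<in>T. cohomologous A \<omega> k `` {lincomb r \<alpha> s \<beta>})\<rparr>"

definition isomorphic :: "'v real_space \<Rightarrow> 'w real_space \<Rightarrow> bool" where
  "isomorphic V W \<longleftrightarrow> (\<exists>\<Phi>. bij_betw \<Phi> (vectors V) (vectors W) \<and>
     (\<forall>x\<in>vectors V. \<forall>y\<in>vectors V. \<forall>r s. \<Phi> (comb V r x s y) = comb W r (\<Phi> x) s (\<Phi> y)))"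

end

theory Submission
  imports Defs
begin

text \<open>
  A foliated homotopy from \<open>f \<circ> g\<close> to the identity is a map of the product \<open>N \<times> \<real>\<close>, foliated by
  the products of the leaves with \<open>\<real>\<close>. Let \<open>\<Omega>\<close> be the pullback of \<open>\<omega>\<close> to this product and \<open>\<beta>\<close> that
  of a cocycle \<open>\<alpha>\<close>. With \<open>H(x, t) = \<integral>\<^sub>0\<^sup>t \<Omega>(\<partial>\<^sub>s) ds\<close> the form \<open>\<Omega> - dH\<close> has no \<open>dt\<close> component and does
  not depend on \<open>t\<close>, and \<open>e\<^sup>H \<beta>\<close> is a cocycle for it, so that Stokes' formula for the integral over
  \<open>[0, 1]\<close> yields \<open>(f \<circ> g)\<^sup>* \<omega> = \<omega> + dh\<close> and \<open>e\<^sup>h (f \<circ> g)\<^sup>* \<alpha> \<sim> \<alpha>\<close> for \<open>h = H(\<cdot>, 1)\<close>. As multiplication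
  by \<open>e\<^sup>h\<close> is an isomorphism from the cohomology twisted by \<open>\<omega> + dh\<close> to that twisted by \<open>\<omega>\<close>, the maps
  \<open>f\<^sup>*\<close> and, symmetrically, \<open>g\<^sup>*\<close> are injective in cohomology; injectivity of \<open>g\<^sup>*\<close> shows that the class
  of any \<open>f\<^sup>* \<omega>\<close>-cocycle \<open>\<eta>\<close> is the image of that of \<open>e\<^sup>h g\<^sup>* \<eta>\<close> under \<open>f\<^sup>*\<close>.

  Foliated maps are only assumed to map leaves into leaves as sets. Their differentials preserve the
  tangent spaces of the leaves because a leaf meets a chart in countably many plaques, so that a
  curve inside a leaf has locally constant transverse coordinates.
\<close>

section \<open>Calculus in finite-dimensional normed spaces\<close>

text \<open>The requirement that all \<open>F_t(x)\<close> with \<open>x\<close> fixed lie in one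
  leaf makes the time direction leafwise. With the leaves of the product taken as leaf times line,
  the homotopy therefore pulls leafwise forms back, and the leafwise derivative upstairs contains
  the derivative in time. The whole line replaces the unit interval because manifolds here have no
  boundary.

  Subtracting \<open>dH\<close> freezes \<open>\<Omega>\<close> for two reasons. On the time field
  the two agree by construction. On a lifted vector \<open>X\<close>, closedness says that the time
  derivative of \<open>\<Omega>(X)\<close> is the \<open>X\<close>-derivative of the time component,
  and integrating the latter gives \<open>dH(X)\<close>. A twist that still depended on time could
  not be pulled out of the fibre integral, so Stokes' formula would not give the twisted
  differential of a fixed form.

  The function \<open>h\<close> has to be found before the cocycle: for surjectivity the formula for
  \<open>h\<close> is applied to a cocycle that is itself built from \<open>h\<close>.

  Since the model spaces come without a distinguished basis, calculus is reduced to real functions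
  by expanding in a basis with bounded coordinate functionals.\<close>

lemma closed_span_of_coordinate_bound:
  fixes B :: "'e::real_normed_vector set"
  assumes B: "finite B"
    and C: "\<And>c b. b \<in> B \<Longrightarrow> \<bar>c b\<bar> \<le> C * norm (\<Sum>b\<in>B. c b *\<^sub>R b)"
  shows "closed (span B)"
  unfolding closed_sequential_limits
proof (intro allI impI, elim conjE)
  fix y l assume y: "\<forall>n. y n \<in> span B" and l: "y \<longlonglongrightarrow> l"
  have "\<exists>c. y n = (\<Sum>b\<in>B. c b *\<^sub>R b)" for n
    using y[rule_format, of n] unfolding span_finite[OF B] by auto
  then obtain c where c: "\<And>n. y n = (\<Sum>b\<in>B. c n b *\<^sub>R b)" by metis
  have "Cauchy (\<lambda>n. c n b)" if b: "b \<in> B" for b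
  proof (rule metric_CauchyI)
    fix e :: real assume e: "0 < e"
    have "Cauchy y" using l by (rule LIMSEQ_imp_Cauchy)
    \<comment> \<open>\<open>C\<close> may be zero or negative, hence the denominator
      \<open>\<bar>C\<bar> + 1\<close>.\<close>
    then obtain M where M: "\<And>m n. m \<ge> M \<Longrightarrow> n \<ge> M \<Longrightarrow> dist (y m) (y n) < e / (\<bar>C\<bar> + 1)"
      using metric_CauchyD[of y "e / (\<bar>C\<bar> + 1)"] e by auto
    have "dist (c m b) (c n b) < e" if mn: "m \<ge> M" "n \<ge> M" for m n
    proof -
      have "\<bar>c m b - c n b\<bar> \<le> C * norm (\<Sum>b\<in>B. (c m b - c n b) *\<^sub>R b)"
        using C[OF b, of "\<lambda>b. c m b - c n b"] .
      also have "(\<Sum>b\<in>B. (c m b - c n b) *\<^sub>R b) = y m - y n"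
        by (simp add: c scaleR_left_diff_distrib sum_subtractf)
      also have "C * norm (y m - y n) \<le> (\<bar>C\<bar> + 1) * norm (y m - y n)"
        by (rule mult_right_mono) auto
      also have "\<dots> < e"
        using M[OF mn] by (simp add: dist_norm field_simps)
      finally show ?thesis by (simp add: dist_real_def)
    qed
    then show "\<exists>M. \<forall>m\<ge>M. \<forall>n\<ge>M. dist (c m b) (c n b) < e" by blast
  qed
  then have "\<forall>b\<in>B. \<exists>a. (\<lambda>n. c n b) \<longlonglongrightarrow> a"
    using Cauchy_convergent_iff convergent_def by blast
  then obtain a where a: "\<And>b. b \<in> B \<Longrightarrow> (\<lambda>n. c n b) \<longlonglongrightarrow> a b" by metis
  have "y \<longlonglongrightarrow> (\<Sum>b\<in>B. a b *\<^sub>R b)"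
    unfolding c[abs_def] by (intro tendsto_intros a)
  then have "l = (\<Sum>b\<in>B. a b *\<^sub>R b)" using l LIMSEQ_unique by blast
  then show "l \<in> span B" by (simp add: span_base span_scale span_sum)
qed

text \<open>Induction on the basis. The bound for \<open>B\<close> makes \<open>span B\<close>
  closed, so a further independent vector \<open>a\<close> has positive distance
  \<open>\<delta>\<close> from it; this distance controls the coefficient of \<open>a\<close>, and
  the triangle inequality then controls the others.\<close>

lemma coordinate_bound:
  fixes B :: "'e::real_normed_vector set"
  assumes "finite B" "independent B"
  shows "\<exists>C. \<forall>c. \<forall>b\<in>B. \<bar>c b\<bar> \<le> C * norm (\<Sum>b\<in>B. c b *\<^sub>R b)"
  using assms
proof (induction B rule: finite_induct)
  case (insert a B)
  then have ind: "independent B" "a \<notin> span B"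
    using insert.prems insert.hyps by (simp_all add: independent_insert)
  obtain C where C: "\<And>c b. b \<in> B \<Longrightarrow> \<bar>c b\<bar> \<le> C * norm (\<Sum>b\<in>B. c b *\<^sub>R b)"
    using insert.IH[OF ind(1)] by blast
  define \<delta> where "\<delta> = infdist a (span B)"
  have ne: "span B \<noteq> {}" using span_zero by blast
  have \<delta>: "\<delta> > 0"
    using in_closed_iff_infdist_zero[OF closed_span_of_coordinate_bound[OF insert.hyps(1) C] ne]
      ind(2) infdist_nonneg[of a "span B"] unfolding \<delta>_def by (metis less_eq_real_def)
  \<comment> \<open>The first summand bounds the coefficient of \<open>a\<close>. The second bounds
    the others: removing the multiple of \<open>a\<close> from \<open>x\<close> increases the norm
    at most by the factor \<open>1 + norm a / \<delta>\<close>.\<close>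
  define K where "K = 1 / \<delta> + \<bar>C\<bar> * (1 + norm a / \<delta>)"
  have "\<bar>c b\<bar> \<le> K * norm (\<Sum>b\<in>insert a B. c b *\<^sub>R b)" if b: "b \<in> insert a B" for c b
  proof -
    define y where "y = (\<Sum>b\<in>B. c b *\<^sub>R b)"
    define x where "x = c a *\<^sub>R a + y"
    have x: "(\<Sum>b\<in>insert a B. c b *\<^sub>R b) = x"
      using insert.hyps by (simp add: x_def y_def)
    have y: "y \<in> span B" unfolding y_def by (simp add: span_base span_scale span_sum)
    have ca: "\<bar>c a\<bar> * \<delta> \<le> norm x"
    proof (cases "c a = 0")
      case False
      have "\<delta> \<le> dist a (- (1 / c a) *\<^sub>R y)"
        unfolding \<delta>_def by (intro infdist_le span_scale y)
      then have "\<bar>c a\<bar> * \<delta> \<le> \<bar>c a\<bar> * norm (a + (1 / c a) *\<^sub>R y)"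
        by (intro mult_left_mono) (auto simp: dist_norm)
      also have "\<dots> = norm (c a *\<^sub>R (a + (1 / c a) *\<^sub>R y))" by simp
      also have "c a *\<^sub>R (a + (1 / c a) *\<^sub>R y) = x"
        using False by (simp add: x_def scaleR_add_right)
      finally show ?thesis .
    qed simp
    then have ca': "\<bar>c a\<bar> \<le> (1 / \<delta>) * norm x" using \<delta> by (simp add: field_simps)
    have K: "(1 / \<delta>) * norm x \<le> K * norm x" "\<bar>C\<bar> * (1 + norm a / \<delta>) * norm x \<le> K * norm x"
      unfolding K_def using \<delta> by (intro mult_right_mono; simp)+
    show ?thesis
    proof (cases "b = a")
      case True then show ?thesis using ca' K x by simp
    next
      case False
      then have "\<bar>c b\<bar> \<le> C * norm y" using C b y_def by auto
      also have "\<dots> \<le> \<bar>C\<bar> * norm y" by (intro mult_right_mono) auto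
      also have "norm y \<le> norm x + \<bar>c a\<bar> * norm a"
        using norm_triangle_ineq4[of x "c a *\<^sub>R a"] by (simp add: x_def)
      also have "\<dots> \<le> norm x + (1 / \<delta>) * norm x * norm a"
        using ca' by (intro add_left_mono mult_right_mono) auto
      also have "\<dots> = (1 + norm a / \<delta>) * norm x" by (simp add: field_simps)
      finally show ?thesis using K x by (simp add: mult_left_mono mult.assoc)
    qed
  qed
  then show ?case by blast
qed simp

text \<open>The source of all later coordinate expansions. The functionals are bounded for every
  index, also outside \<open>B\<close>, so that no membership condition has to be carried
  along.\<close>

lemma finite_dim_dual_basis:
  assumes "finite_dim TYPE('e::real_normed_vector)"
  obtains B :: "'e::real_normed_vector set" and \<phi> :: "'e \<Rightarrow> 'e \<Rightarrow> real"
  where "finite B" "\<And>b. bounded_linear (\<phi> b)" "\<And>x. (\<Sum>b\<in>B. \<phi> b x *\<^sub>R b) = x"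
proof -
  obtain B0 :: "'e set" where B0: "finite B0" "span B0 = UNIV"
    using assms unfolding finite_dim_def by blast
  obtain B :: "'e set" where B: "B \<subseteq> B0" "independent B" "B0 \<subseteq> span B"
    using maximal_independent_subset[of B0] by blast
  have fin: "finite B" using B B0 finite_subset by blast
  have sp: "span B = UNIV"
    using B B0 span_mono[OF B(3)] by (simp add: span_span top.extremum_unique)
  obtain C where C: "\<And>c b. b \<in> B \<Longrightarrow> \<bar>c b\<bar> \<le> C * norm (\<Sum>b\<in>B. c b *\<^sub>R b)"
    using coordinate_bound[OF fin B(2)] by blast
  let ?r = "\<lambda>b x. if b \<in> B then representation B x b else 0"
  have sum: "(\<Sum>b\<in>B. ?r b x *\<^sub>R b) = x" for x
    using sum_representation_eq[OF B(2) _ fin subset_refl, of x] sp by simp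
  have "bounded_linear (?r b)" for b
  proof (cases "b \<in> B")
    case True
    show ?thesis
    proof (rule bounded_linear_intro[where K = C])
      show "?r b (x + y) = ?r b x + ?r b y" for x y
        using representation_add[OF B(2), of y x] sp True by simp
      show "?r b (s *\<^sub>R x) = s *\<^sub>R ?r b x" for s x
        using representation_scale[OF B(2), of x s] sp True by simp
      show "norm (?r b x) \<le> norm x * C" for x
        using C[OF True, of "\<lambda>b. ?r b x"] unfolding sum by (simp add: mult.commute)
    qed
  qed simp
  with fin sum show ?thesis using that[of B ?r] by blast
qed

lemma finite_dim_linear_bounded:
  fixes L :: "'e::real_normed_vector \<Rightarrow> 'f::real_normed_vector"
  assumes "finite_dim TYPE('e)" "linear L"
  shows "bounded_linear L"
proof -
  obtain B :: "'e set" and \<phi> where B: "finite B" "\<And>b. bounded_linear (\<phi> b)"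
    "\<And>x. (\<Sum>b\<in>B. \<phi> b x *\<^sub>R b) = x"
    using finite_dim_dual_basis[OF assms(1)] by metis
  have "L x = (\<Sum>b\<in>B. \<phi> b x *\<^sub>R L b)" for x
  proof -
    have "L x = L (\<Sum>b\<in>B. \<phi> b x *\<^sub>R b)" by (simp add: B(3))
    then show ?thesis using assms(2) by (simp add: linear_sum linear_scale)
  qed
  then have L: "L = (\<lambda>x. \<Sum>b\<in>B. \<phi> b x *\<^sub>R L b)" by (rule ext)
  have "bounded_linear (\<lambda>x. \<Sum>b\<in>B. \<phi> b x *\<^sub>R L b)"
    by (intro bounded_linear_sum bounded_linear_compose[OF bounded_linear_scaleR_left B(2)])
  then show ?thesis by (subst L)
qed

lemma finite_dim_linear_surj:
  fixes L :: "'e::real_normed_vector \<Rightarrow> 'f::real_normed_vector"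
  assumes "finite_dim TYPE('e)" "linear L" "surj L"
  shows "finite_dim TYPE('f)"
proof -
  obtain B :: "'e set" where "finite B" "span B = UNIV"
    using assms(1) unfolding finite_dim_def by blast
  then have "finite (L ` B)" "span (L ` B) = UNIV"
    using linear_span_image[OF assms(2), of B] assms(3) by auto
  then show ?thesis unfolding finite_dim_def by blast
qed

lemma finite_dim_fst:
  "finite_dim TYPE('e::real_normed_vector \<times> 'f::real_normed_vector) \<Longrightarrow> finite_dim TYPE('e)"
  by (rule finite_dim_linear_surj[OF _ linear_fst]) auto

lemma finite_dim_snd:
  "finite_dim TYPE('e::real_normed_vector \<times> 'f::real_normed_vector) \<Longrightarrow> finite_dim TYPE('f)"
  by (rule finite_dim_linear_surj[OF _ linear_snd]) auto

lemma finite_dim_prod: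
  assumes "finite_dim TYPE('e::real_normed_vector)" "finite_dim TYPE('f::real_normed_vector)"
  shows "finite_dim TYPE('e \<times> 'f)"
proof -
  obtain B :: "'e set" and C :: "'f set" where B: "finite B" "span B = UNIV"
    and C: "finite C" "span C = UNIV"
    using assms unfolding finite_dim_def by blast
  let ?S = "(\<lambda>x. (x, 0)) ` B \<union> (\<lambda>y. (0, y)) ` C"
  have 1: "linear (\<lambda>x::'e. (x, 0::'f))" "linear (\<lambda>y::'f. (0::'e, y))"
    by (auto intro!: linearI)
  have "(x, y) \<in> span ?S" for x y
  proof -
    have "(x, 0) \<in> span ?S"
      using linear_span_image[OF 1(1), of B] B(2) span_mono[of "(\<lambda>x. (x, 0)) ` B" ?S] by auto
    moreover have "(0, y) \<in> span ?S"
      using linear_span_image[OF 1(2), of C] C(2) span_mono[of "(\<lambda>y. (0, y)) ` C" ?S] by auto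
    ultimately have "(x, 0) + (0, y) \<in> span ?S" by (rule span_add)
    then show ?thesis by simp
  qed
  then have "span ?S = UNIV" by auto
  moreover have "finite ?S" using B C by auto
  ultimately show ?thesis unfolding finite_dim_def by blast
qed

lemma finite_dim_real: "finite_dim TYPE(real)"
  unfolding finite_dim_def by (intro exI[of _ "{1}"]) (auto simp: span_singleton)


subsection \<open>Smooth functions\<close>

abbreviation fd :: "('e::real_normed_vector \<Rightarrow> 'f::real_normed_vector) \<Rightarrow> 'e \<Rightarrow> 'e \<Rightarrow> 'f" where
  "fd f x \<equiv> frechet_derivative f (at x)"

lemma fd_eq: "(f has_derivative f') (at x) \<Longrightarrow> fd f x = f'"
  using frechet_derivative_at by metis

lemma has_derivative_fd: "f differentiable (at x) \<Longrightarrow> (f has_derivative fd f x) (at x)"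
  using frechet_derivative_works by blast

lemma linear_fd: "f differentiable (at x) \<Longrightarrow> linear (fd f x)"
  using has_derivative_fd has_derivative_linear by blast

lemma fd_transform:
  assumes "f differentiable (at x)" "open W" "x \<in> W" "\<And>y. y \<in> W \<Longrightarrow> f y = g y"
  shows "fd f x = fd g x" "g differentiable (at x)"
  using frechet_derivative_transform_within_open[of f x W g] assms
    has_derivative_transform_within_open[of f _ x UNIV W g]
  by (auto simp: differentiable_def)

text \<open>If one function has no derivative at \<open>x\<close>, neither has the other, and both
  sides are the same choice from an empty predicate. Coordinate expressions can thus be exchanged
  before their smoothness is discussed.\<close>

lemma fd_cong:
  assumes "open W" "x \<in> W" "\<And>y. y \<in> W \<Longrightarrow> f y = g y"
  shows "fd f x = fd g x"
proof (cases "f differentiable (at x)")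
  case True then show ?thesis using fd_transform assms by blast
next
  case False
  then have *: "\<not> (f has_derivative L) (at x)" "\<not> (g has_derivative L) (at x)" for L
    using fd_transform(2)[of g x W f] assms by (auto simp: differentiable_def)
  then show ?thesis unfolding frechet_derivative_def by simp
qed

lemma fd_compose:
  assumes "f differentiable (at x)" "g differentiable (at (f x))"
  shows "fd (\<lambda>y. g (f y)) x v = fd g (f x) (fd f x v)"
  using fun_cong[OF frechet_derivative_compose[OF assms], of v] unfolding comp_def .

lemma Ck_on_cong:
  assumes "open W" "\<And>x. x \<in> W \<Longrightarrow> f x = g x" "Ck_on k f W"
  shows "Ck_on k g W"
  using assms(2,3)
proof (induction k arbitrary: f g)
  case 0 then show ?case by (simp cong: continuous_on_cong)
next
  case (Suc k)
  have "Ck_on k (\<lambda>x. fd g x v) W" for v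
    by (rule Suc.IH[of "\<lambda>x. fd f x v"])
      (use Suc.prems fd_transform(1)[OF _ assms(1), of f _ g] in auto)
  then show ?case using Suc.prems fd_transform(2)[OF _ assms(1), of f _ g] by auto
qed

lemma Ck_on_subset: "Ck_on k f W \<Longrightarrow> V \<subseteq> W \<Longrightarrow> Ck_on k f V"
  by (induction k arbitrary: f) (auto intro: continuous_on_subset)

lemma Ck_on_SucD: "Ck_on (Suc k) f W \<Longrightarrow> Ck_on k f W"
proof (induction k arbitrary: f)
  case 0
  then show ?case
    by (auto intro!: continuous_at_imp_continuous_on differentiable_imp_continuous_within)
next
  case (Suc k)
  then show ?case by (metis Ck_on.simps(2))
qed

lemma Ck_on_const: "Ck_on k (\<lambda>x. c) W"
  by (induction k arbitrary: c) auto

lemma Ck_on_bounded_linear_compose: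
  assumes L: "bounded_linear L" and W: "open W" and f: "Ck_on k f W"
  shows "Ck_on k (\<lambda>x. L (f x)) W"
  using f
proof (induction k arbitrary: f)
  case 0
  then show ?case using L bounded_linear.continuous_on by auto
next
  case (Suc k)
  have *: "((\<lambda>x. L (f x)) has_derivative (\<lambda>v. L (fd f x v))) (at x)" if "x \<in> W" for x
    using Suc.prems that
    by (intro bounded_linear.has_derivative[OF L] has_derivative_fd) auto
  have "Ck_on k (\<lambda>x. fd (\<lambda>x. L (f x)) x v) W" for v
    by (rule Ck_on_cong[OF W _ Suc.IH[of "\<lambda>x. fd f x v"]]) (use Suc.prems fd_eq[OF *] in auto)
  then show ?case using * by (auto simp: differentiable_def)
qed

lemma Ck_on_ident: "Ck_on k (\<lambda>x. x) W"
  by (cases k) (auto simp: Ck_on_const continuous_on_id)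

lemma Ck_on_add:
  assumes W: "open W" and "Ck_on k f W" "Ck_on k g W"
  shows "Ck_on k (\<lambda>x. f x + g x) W"
  using assms(2,3)
proof (induction k arbitrary: f g)
  case 0
  then show ?case by (auto intro: continuous_on_add)
next
  case (Suc k)
  have *: "((\<lambda>x. f x + g x) has_derivative (\<lambda>v. fd f x v + fd g x v)) (at x)" if "x \<in> W" for x
    using Suc.prems that by (intro has_derivative_add has_derivative_fd) auto
  have "Ck_on k (\<lambda>x. fd (\<lambda>x. f x + g x) x v) W" for v
    by (rule Ck_on_cong[OF W _ Suc.IH[of "\<lambda>x. fd f x v" "\<lambda>x. fd g x v"]])
      (use Suc.prems fd_eq[OF *] in auto)
  then show ?case using * by (auto simp: differentiable_def)
qed

lemma Ck_on_bilinear: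
  assumes p: "bounded_bilinear p" and W: "open W" and "Ck_on k f W" "Ck_on k g W"
  shows "Ck_on k (\<lambda>x. p (f x) (g x)) W"
  using assms(3,4)
proof (induction k arbitrary: f g)
  case 0
  then show ?case using bounded_bilinear.continuous_on[OF p] by auto
next
  case (Suc k)
  have *: "((\<lambda>x. p (f x) (g x)) has_derivative (\<lambda>v. p (f x) (fd g x v) + p (fd f x v) (g x))) (at x)"
    if "x \<in> W" for x
    using Suc.prems that
    by (intro bounded_bilinear.FDERIV[OF p] has_derivative_fd) auto
  have "Ck_on k (\<lambda>x. p (f x) (fd g x v) + p (fd f x v) (g x)) W" for v
    by (intro Ck_on_add W Suc.IH) (use Suc.prems Ck_on_SucD in auto)
  then have "Ck_on k (\<lambda>x. fd (\<lambda>x. p (f x) (g x)) x v) W" for v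
    by (rule Ck_on_cong[OF W, rotated]) (use fd_eq[OF *] in auto)
  then show ?case using * by (auto simp: differentiable_def)
qed

lemma Ck_on_sum:
  assumes "open W" "\<And>i. i \<in> I \<Longrightarrow> Ck_on k (f i) W"
  shows "Ck_on k (\<lambda>x. \<Sum>i\<in>I. f i x) W"
  using assms(2)
  by (induction I rule: infinite_finite_induct) (auto intro: Ck_on_const Ck_on_add assms(1))

text \<open>\<open>Ck_on\<close> speaks of derivatives in fixed directions, whereas the chain rule
  differentiates \<open>g\<close> in the direction \<open>fd f x v\<close>, which moves with
  \<open>x\<close>. Expanding this direction in a basis of the middle space leaves fixed directions
  with coefficients of the right class.\<close>

lemma Ck_on_compose:
  fixes f :: "'e::real_normed_vector \<Rightarrow> 'f::real_normed_vector"
  assumes fin: "finite_dim TYPE('f)" and W: "open W" and f: "Ck_on k f W" "f ` W \<subseteq> V"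
    and g: "Ck_on k g V"
  shows "Ck_on k (\<lambda>x. g (f x)) W"
  using f(1) g
proof (induction k arbitrary: g)
  case 0
  then show ?case using f(2) continuous_on_compose2 by auto
next
  case (Suc k)
  obtain B :: "'f set" and \<phi> where B: "finite B" "\<And>b. bounded_linear (\<phi> b)"
    "\<And>x. (\<Sum>b\<in>B. \<phi> b x *\<^sub>R b) = x"
    using finite_dim_dual_basis[OF fin] by metis
  have dg: "g differentiable (at (f x))" if "x \<in> W" for x
    using Suc.prems that f(2) by auto
  have *: "((\<lambda>x. g (f x)) has_derivative (\<lambda>v. fd g (f x) (fd f x v))) (at x)" if "x \<in> W" for x
    using Suc.prems that dg
    by (intro has_derivative_compose[of f _ x UNIV g] has_derivative_fd) auto
  have **: "fd (\<lambda>x. g (f x)) x v = (\<Sum>b\<in>B. \<phi> b (fd f x v) *\<^sub>R fd g (f x) b)" if "x \<in> W" for x v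
  proof -
    have "fd (\<lambda>x. g (f x)) x v = fd g (f x) (\<Sum>b\<in>B. \<phi> b (fd f x v) *\<^sub>R b)"
      using fd_eq[OF *[OF that]] B(3) by simp
    also have "\<dots> = (\<Sum>b\<in>B. \<phi> b (fd f x v) *\<^sub>R fd g (f x) b)"
      using linear_fd[OF dg[OF that]] by (simp add: linear_sum linear_scale)
    finally show ?thesis .
  qed
  have "Ck_on k (\<lambda>x. \<Sum>b\<in>B. \<phi> b (fd f x v) *\<^sub>R fd g (f x) b) W" for v
    by (intro Ck_on_sum W Ck_on_bilinear[OF bounded_bilinear_scaleR]
        Ck_on_bounded_linear_compose[OF B(2)] Suc.IH)
      (use Suc.prems Ck_on_SucD in auto)
  then have "Ck_on k (\<lambda>x. fd (\<lambda>x. g (f x)) x v) W" for v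
    by (rule Ck_on_cong[OF W, rotated]) (use ** in auto)
  then show ?case using * by (auto simp: differentiable_def)
qed

lemma Ck_on_local:
  assumes "\<And>x. x \<in> S \<Longrightarrow> \<exists>W. open W \<and> x \<in> W \<and> Ck_on k f (S \<inter> W)" "open S"
  shows "Ck_on k f S"
  using assms(1)
proof (induction k arbitrary: f)
  case 0
  show ?case unfolding Ck_on.simps
  proof (intro continuous_at_imp_continuous_on ballI)
    fix x assume "x \<in> S"
    then obtain W where "open W" "x \<in> W" "continuous_on (S \<inter> W) f" using 0 by auto
    then show "isCont f x"
      using \<open>x \<in> S\<close> assms(2) continuous_on_eq_continuous_at[of "S \<inter> W" f] by auto
  qed
next
  case (Suc k)
  have "Ck_on k (\<lambda>x. fd f x v) S" for v
    by (rule Suc.IH) (metis Ck_on.simps(2) Suc.prems)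
  moreover have "f differentiable (at x)" if x: "x \<in> S" for x
    using Suc.prems[OF x] x by auto
  ultimately show ?case by auto
qed

text \<open>On an open set a local extension coincides with the function near each point, so it has
  the same iterated derivatives there.\<close>

lemma smooth_on_open:
  assumes "open W"
  shows "smooth_on W f \<longleftrightarrow> (\<forall>k. Ck_on k f W)"
proof
  assume f: "smooth_on W f"
  show "\<forall>k. Ck_on k f W"
  proof
    fix k
    show "Ck_on k f W"
    proof (rule Ck_on_local[OF _ assms])
      fix x assume "x \<in> W"
      then obtain V g where V: "open V" "x \<in> V" "Ck_on k g V" "\<forall>y\<in>W \<inter> V. g y = f y"
        using f unfolding smooth_on_def by blast
      then have "Ck_on k f (W \<inter> V)"
        by (intro Ck_on_cong[of "W \<inter> V" g f]) (auto intro: Ck_on_subset assms)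
      with V show "\<exists>V. open V \<and> x \<in> V \<and> Ck_on k f (W \<inter> V)" by blast
    qed
  qed
next
  assume "\<forall>k. Ck_on k f W"
  then show "smooth_on W f" unfolding smooth_on_def using assms by blast
qed

lemma smooth_on_local:
  assumes "\<And>x. x \<in> S \<Longrightarrow> \<exists>W. open W \<and> x \<in> W \<and> smooth_on (S \<inter> W) f"
  shows "smooth_on S f"
  unfolding smooth_on_def
proof
  fix x assume x: "x \<in> S"
  then obtain W where W: "open W" "x \<in> W" "smooth_on (S \<inter> W) f" using assms by blast
  then obtain V g where V: "open V" "x \<in> V" "\<forall>k. Ck_on k g V" "\<forall>y\<in>S \<inter> W \<inter> V. g y = f y"
    using x unfolding smooth_on_def by blast
  have "open (W \<inter> V)" "x \<in> W \<inter> V" "\<forall>k. Ck_on k g (W \<inter> V)" "\<forall>y\<in>S \<inter> (W \<inter> V). g y = f y"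
    using W V Ck_on_subset[of _ g V "W \<inter> V"] by auto
  then show "\<exists>W g. open W \<and> x \<in> W \<and> (\<forall>k. Ck_on k g W) \<and> (\<forall>y\<in>S \<inter> W. g y = f y)" by blast
qed

lemma smooth_on_subset:
  assumes "smooth_on S f" "T \<subseteq> S"
  shows "smooth_on T f"
  unfolding smooth_on_def
proof
  fix x assume "x \<in> T"
  then have "x \<in> S" using assms(2) by (rule subsetD[rotated])
  with assms(1) have "\<exists>W g. open W \<and> x \<in> W \<and> (\<forall>k. Ck_on k g W) \<and> (\<forall>y\<in>S \<inter> W. g y = f y)"
    unfolding smooth_on_def by (rule bspec)
  then obtain W g where W: "open W" "x \<in> W" "\<forall>k. Ck_on k g W" "\<forall>y\<in>S \<inter> W. g y = f y"
    by (elim exE conjE)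
  have "\<forall>y\<in>T \<inter> W. g y = f y" using W(4) assms(2) by blast
  with W show "\<exists>W g. open W \<and> x \<in> W \<and> (\<forall>k. Ck_on k g W) \<and> (\<forall>y\<in>T \<inter> W. g y = f y)"
    by (intro exI[of _ W] exI[of _ g] conjI)
qed

lemma smooth_on_cong:
  assumes "smooth_on S f" "\<And>x. x \<in> S \<Longrightarrow> f x = g x"
  shows "smooth_on S g"
  using assms unfolding smooth_on_def by simp

lemma smooth_on_const: "smooth_on S (\<lambda>x. c)"
  unfolding smooth_on_def using Ck_on_const by blast

lemma smooth_on_bounded_linear_compose:
  assumes "bounded_linear L" "open W" "smooth_on W f"
  shows "smooth_on W (\<lambda>x. L (f x))"
  using assms Ck_on_bounded_linear_compose by (metis smooth_on_open)

lemma smooth_on_ident: "smooth_on S (\<lambda>x. x)"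
  unfolding smooth_on_def using Ck_on_ident by blast

lemma smooth_on_bounded_linear:
  "bounded_linear L \<Longrightarrow> smooth_on S L"
  using smooth_on_bounded_linear_compose[of L UNIV "\<lambda>x. x"] smooth_on_ident
    smooth_on_subset[of UNIV L S] by auto

lemma smooth_on_add:
  assumes "open W" "smooth_on W f" "smooth_on W g"
  shows "smooth_on W (\<lambda>x. f x + g x)"
  using assms by (simp add: smooth_on_open Ck_on_add)

lemma smooth_on_mult:
  fixes f g :: "_ \<Rightarrow> real"
  assumes "open W" "smooth_on W f" "smooth_on W g"
  shows "smooth_on W (\<lambda>x. f x * g x)"
  using assms by (simp add: smooth_on_open Ck_on_bilinear[OF bounded_bilinear_mult])

lemma smooth_on_sum:
  assumes "open W" "\<And>i. i \<in> I \<Longrightarrow> smooth_on W (f i)"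
  shows "smooth_on W (\<lambda>x. \<Sum>i\<in>I. f i x)"
  using assms by (simp add: smooth_on_open Ck_on_sum)

lemma smooth_on_Pair:
  assumes "open W" "smooth_on W f" "smooth_on W g"
  shows "smooth_on W (\<lambda>x. (f x, g x))"
proof -
  have "smooth_on W (\<lambda>x. (f x, 0) + (0, g x))"
    by (intro smooth_on_add assms
        smooth_on_bounded_linear_compose[where L = "\<lambda>a. (a, 0)"]
        smooth_on_bounded_linear_compose[where L = "\<lambda>b. (0, b)"]
        bounded_linear_Pair bounded_linear_ident bounded_linear_zero)
  then show ?thesis by simp
qed

lemma smooth_on_fst: "open W \<Longrightarrow> smooth_on W f \<Longrightarrow> smooth_on W (\<lambda>x. fst (f x))"
  using smooth_on_bounded_linear_compose bounded_linear_fst by blast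

lemma smooth_on_snd: "open W \<Longrightarrow> smooth_on W f \<Longrightarrow> smooth_on W (\<lambda>x. snd (f x))"
  using smooth_on_bounded_linear_compose bounded_linear_snd by blast

lemma smooth_on_continuous: "open W \<Longrightarrow> smooth_on W f \<Longrightarrow> continuous_on W f"
  using smooth_on_open Ck_on.simps(1) by blast

text \<open>\<open>S\<close> may fail to be open, which is the situation of a homotopy over the
  closed unit interval. Near \<open>f x\<close> the map \<open>g\<close> is replaced by a smooth
  extension; as \<open>f\<close> sends \<open>W\<close> into \<open>S\<close>, the composite does
  not notice the replacement.\<close>

lemma smooth_on_compose:
  fixes f :: "'e::real_normed_vector \<Rightarrow> 'f::real_normed_vector"
  assumes fin: "finite_dim TYPE('f)" and W: "open W" and f: "smooth_on W f" "\<And>x. x \<in> W \<Longrightarrow> f x \<in> S"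
    and g: "smooth_on S g"
  shows "smooth_on W (\<lambda>x. g (f x))"
proof (rule smooth_on_local)
  fix x assume x: "x \<in> W"
  obtain V g' where V: "open V" "f x \<in> V" "\<forall>k. Ck_on k g' V" "\<forall>y\<in>S \<inter> V. g' y = g y"
    using g f(2)[OF x] unfolding smooth_on_def by blast
  define U where "U = W \<inter> f -` V"
  have U: "open U" "x \<in> U" "U \<subseteq> W"
    using smooth_on_continuous[OF W f(1)] W V(1,2) x
    by (auto simp: U_def continuous_on_open_vimage Int_commute)
  have "Ck_on k f U" for k
    using f(1) smooth_on_open[OF W] Ck_on_subset[OF _ U(3)] by blast
  then have "Ck_on k (\<lambda>x. g' (f x)) U" for k
    by (rule Ck_on_compose[OF fin U(1), of k f V]) (use V in \<open>auto simp: U_def\<close>)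
  then have "smooth_on U (\<lambda>x. g' (f x))" using smooth_on_open[OF U(1)] by blast
  then have "smooth_on U (\<lambda>x. g (f x))"
    by (rule smooth_on_cong) (use V(4) f(2) in \<open>auto simp: U_def\<close>)
  then have "smooth_on (W \<inter> U) (\<lambda>x. g (f x))" using U(3) by (simp add: Int_absorb1)
  then show "\<exists>U. open U \<and> x \<in> U \<and> smooth_on (W \<inter> U) (\<lambda>x. g (f x))" using U by blast
qed

lemma smooth_on_differentiable:
  assumes "open W" "smooth_on W f" "x \<in> W"
  shows "f differentiable (at x)"
  using assms smooth_on_open[OF assms(1)] Ck_on.simps(2)[of 0 f W] by blast

lemma smooth_on_fd:
  assumes "open W" "smooth_on W f"
  shows "smooth_on W (\<lambda>x. fd f x v)"
  using assms smooth_on_open[OF assms(1)] Ck_on.simps(2)[of _ f W] by blast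

text \<open>Bootstrapping for functions that satisfy a differential equation, such as the
  exponential: a derivative expressed through the function itself has whatever class the function
  already has.\<close>

lemma smooth_on_SucI:
  assumes W: "open W" and d: "\<And>x. x \<in> W \<Longrightarrow> f differentiable (at x)"
    and f: "\<And>k v. Ck_on k f W \<Longrightarrow> Ck_on k (\<lambda>x. fd f x v) W"
  shows "smooth_on W f"
  unfolding smooth_on_open[OF W]
proof
  fix k show "Ck_on k f W"
  proof (induction k)
    case 0
    then show ?case
      using d by (auto intro!: continuous_at_imp_continuous_on differentiable_imp_continuous_within)
  qed (use d f in auto)
qed

lemma smooth_on_exp: "smooth_on S (exp :: real \<Rightarrow> real)"
proof (rule smooth_on_subset[OF smooth_on_SucI[of UNIV]])
  have *: "(exp has_derivative (\<lambda>v. exp x * v)) (at x)" for x :: real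
    using DERIV_exp[of x] unfolding has_field_derivative_def .
  show "exp differentiable (at x)" for x :: real using * differentiableI by blast
  show "Ck_on k (\<lambda>x. fd exp x v) UNIV" if "Ck_on k (exp :: real \<Rightarrow> real) UNIV" for k and v :: real
    unfolding fd_eq[OF *]
    by (intro Ck_on_bilinear[OF bounded_bilinear_mult] Ck_on_const) (use that in auto)
qed auto

lemma smooth_on_cos: "smooth_on S (cos :: real \<Rightarrow> real)"
proof -
  have c: "(cos has_derivative (\<lambda>v. - sin x * v)) (at x)" for x :: real
    using DERIV_cos[of x] unfolding has_field_derivative_def .
  have s: "(sin has_derivative (\<lambda>v. cos x * v)) (at x)" for x :: real
    using DERIV_sin[of x] unfolding has_field_derivative_def .
  \<comment> \<open>A joint induction, since cosine and sine are each other's derivatives up to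
    sign.\<close>
  have "Ck_on k (cos :: real \<Rightarrow> real) UNIV \<and> Ck_on k (sin :: real \<Rightarrow> real) UNIV" for k
  proof (induction k)
    case (Suc k)
    have "Ck_on k (\<lambda>x. - sin x * v) UNIV" "Ck_on k (\<lambda>x. cos x * v) UNIV" for v :: real
      by (intro Ck_on_bilinear[OF bounded_bilinear_mult] Ck_on_const
          Ck_on_bounded_linear_compose[of uminus]; use Suc in \<open>simp add: bounded_linear_minus bounded_linear_ident\<close>)+
    moreover have "cos differentiable (at x)" "sin differentiable (at x)" for x :: real
      using c s unfolding differentiable_def by blast+
    ultimately show ?case by (simp add: fd_eq[OF c] fd_eq[OF s])
  qed (auto intro: continuous_intros)
  then have "smooth_on UNIV (cos :: real \<Rightarrow> real)" using smooth_on_open by blast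
  then show ?thesis using smooth_on_subset by blast
qed

subsection \<open>Symmetry of second derivatives\<close>

lemma has_derivative_line:
  assumes "f differentiable (at (a + s *\<^sub>R v))"
  shows "((\<lambda>s. f (a + s *\<^sub>R v)) has_vector_derivative fd f (a + s *\<^sub>R v) v) (at s)"
proof -
  have "((\<lambda>s. a + s *\<^sub>R v) has_derivative (\<lambda>h. h *\<^sub>R v)) (at s)"
    by (auto intro!: derivative_eq_intros)
  from has_derivative_compose[OF this, of f "fd f (a + s *\<^sub>R v)"]
  have "((\<lambda>s. f (a + s *\<^sub>R v)) has_derivative (\<lambda>h. fd f (a + s *\<^sub>R v) (h *\<^sub>R v))) (at s)"
    using has_derivative_fd[OF assms] by auto
  then show ?thesis
    unfolding has_vector_derivative_def using linear_fd[OF assms] by (simp add: linear_scale)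
qed

lemma mvt_line:
  fixes f :: "'e::real_normed_vector \<Rightarrow> real"
  assumes "0 < s" "\<And>r. 0 \<le> r \<Longrightarrow> r \<le> s \<Longrightarrow> f differentiable (at (a + r *\<^sub>R v))"
  shows "\<exists>r. 0 < r \<and> r < s \<and> f (a + s *\<^sub>R v) - f a = s * fd f (a + r *\<^sub>R v) v"
proof -
  have "\<exists>r>0. r < s \<and> f (a + s *\<^sub>R v) - f (a + 0 *\<^sub>R v) = (s - 0) * fd f (a + r *\<^sub>R v) v"
    by (rule MVT2[OF assms(1)])
      (use has_derivative_line[OF assms(2)] in \<open>auto simp: has_real_derivative_iff_has_vector_derivative\<close>)
  then show ?thesis by auto
qed

text \<open>The mean value theorem is used twice: along \<open>v\<close> for the increment of
  \<open>f\<close> by \<open>s *\<^sub>R w\<close>, then along \<open>w\<close> for the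
  \<open>v\<close>-derivative of \<open>f\<close>. The left side is symmetric in \<open>v\<close>
  and \<open>w\<close>, the right side is a mixed derivative in one particular order.\<close>

lemma second_difference:
  fixes f :: "'e::real_normed_vector \<Rightarrow> real"
  assumes s: "0 < s" and W: "open W" "smooth_on W f"
    and in_W: "\<And>p q. 0 \<le> p \<Longrightarrow> p \<le> s \<Longrightarrow> 0 \<le> q \<Longrightarrow> q \<le> s \<Longrightarrow> x + p *\<^sub>R v + q *\<^sub>R w \<in> W"
  shows "\<exists>p q. 0 < p \<and> p < s \<and> 0 < q \<and> q < s \<and>
    f (x + s *\<^sub>R v + s *\<^sub>R w) - f (x + s *\<^sub>R v) - f (x + s *\<^sub>R w) + f x
      = s * s * fd (\<lambda>y. fd f y v) (x + p *\<^sub>R v + q *\<^sub>R w) w"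
proof -
  define g where "g = (\<lambda>y. f (y + s *\<^sub>R w) - f y)"
  have dg: "(g has_derivative (\<lambda>h. fd f (x + p *\<^sub>R v + s *\<^sub>R w) h - fd f (x + p *\<^sub>R v) h)) (at (x + p *\<^sub>R v))"
    if p: "0 \<le> p" "p \<le> s" for p
  proof -
    have 1: "((\<lambda>y. y + s *\<^sub>R w) has_derivative (\<lambda>h. h)) (at (x + p *\<^sub>R v))"
      by (auto intro!: derivative_eq_intros)
    show ?thesis
      unfolding g_def
      by (intro has_derivative_diff has_derivative_compose[OF 1] has_derivative_fd smooth_on_differentiable[OF W])
        (use in_W[OF p, of s] in_W[OF p, of 0] s in auto)
  qed
  obtain p where p: "0 < p" "p < s" "g (x + s *\<^sub>R v) - g x = s * fd g (x + p *\<^sub>R v) v"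
    using mvt_line[OF s, of g x v] dg differentiableI by blast
  have W': "smooth_on W (\<lambda>y. fd f y v)" using smooth_on_fd[OF W] .
  obtain q where q: "0 < q" "q < s"
    "fd f (x + p *\<^sub>R v + s *\<^sub>R w) v - fd f (x + p *\<^sub>R v) v
      = s * fd (\<lambda>y. fd f y v) (x + p *\<^sub>R v + q *\<^sub>R w) w"
    using mvt_line[OF s, of "\<lambda>y. fd f y v" "x + p *\<^sub>R v" w]
      smooth_on_differentiable[OF W(1) W'] in_W[of p] p by auto
  have "fd g (x + p *\<^sub>R v) v = fd f (x + p *\<^sub>R v + s *\<^sub>R w) v - fd f (x + p *\<^sub>R v) v"
    using fd_eq[OF dg[of p]] p by auto
  then have "g (x + s *\<^sub>R v) - g x = s * s * fd (\<lambda>y. fd f y v) (x + p *\<^sub>R v + q *\<^sub>R w) w"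
    using p(3) q(3) by simp
  moreover have "g (x + s *\<^sub>R v) - g x
      = f (x + s *\<^sub>R v + s *\<^sub>R w) - f (x + s *\<^sub>R v) - f (x + s *\<^sub>R w) + f x"
    by (simp add: g_def)
  ultimately show ?thesis using p(1,2) q(1,2) by metis
qed

text \<open>The same second difference equals both mixed derivatives, each at some point of a small
  parallelogram at \<open>x\<close>. By continuity these values are close to those at
  \<open>x\<close>, which is impossible if the latter differ.\<close>

lemma fd_fd_commute_real:
  fixes f :: "'e::real_normed_vector \<Rightarrow> real"
  assumes W: "open W" "smooth_on W f" and x: "x \<in> W"
  shows "fd (\<lambda>y. fd f y v) x w = fd (\<lambda>y. fd f y w) x v"
proof (rule ccontr)
  let ?P = "\<lambda>y. fd (\<lambda>y. fd f y v) y w" and ?Q = "\<lambda>y. fd (\<lambda>y. fd f y w) y v"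
  assume ne: "?P x \<noteq> ?Q x"
  have "continuous_on W ?P" "continuous_on W ?Q"
    by (intro smooth_on_continuous smooth_on_fd W)+
  then have PQ: "isCont ?P x" "isCont ?Q x" using W(1) x continuous_on_eq_continuous_at by blast+
  define e where "e = dist (?P x) (?Q x) / 2"
  have e: "e > 0" using ne by (simp add: e_def)
  obtain d1 where d1: "d1 > 0" "\<And>y. dist y x < d1 \<Longrightarrow> dist (?P y) (?P x) < e"
    using PQ(1) e unfolding continuous_at_eps_delta by blast
  obtain d2 where d2: "d2 > 0" "\<And>y. dist y x < d2 \<Longrightarrow> dist (?Q y) (?Q x) < e"
    using PQ(2) e unfolding continuous_at_eps_delta by blast
  obtain d3 where d3: "d3 > 0" "ball x d3 \<subseteq> W" using W(1) x openE by blast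
  define d where "d = min d1 (min d2 d3)"
  \<comment> \<open>The parallelogram with sides \<open>s *\<^sub>R v\<close> and
    \<open>s *\<^sub>R w\<close> then stays within distance \<open>d / 2\<close> of
    \<open>x\<close>; the summand 1 keeps the denominator positive when both vectors vanish.\<close>
  define s where "s = d / (2 * (norm v + norm w + 1))"
  have pos: "0 < norm v + norm w + 1" by (smt (verit) norm_ge_zero)
  have s: "s > 0" unfolding s_def using d1 d2 d3 pos by (simp add: d_def)
  have near: "dist (x + p *\<^sub>R v + q *\<^sub>R w) x < d" if "0 \<le> p" "p \<le> s" "0 \<le> q" "q \<le> s" for p q
  proof -
    have "dist (x + p *\<^sub>R v + q *\<^sub>R w) x \<le> p * norm v + q * norm w"
      using norm_triangle_ineq[of "p *\<^sub>R v" "q *\<^sub>R w"] that by (simp add: dist_norm)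
    also have "\<dots> \<le> s * norm v + s * norm w"
      using that by (intro add_mono mult_right_mono) auto
    also have "\<dots> \<le> s * (norm v + norm w + 1)" using s by (simp add: algebra_simps)
    also have "\<dots> = d / 2" unfolding s_def using pos by (simp add: field_simps)
    also have "\<dots> < d" using s pos by (simp add: s_def zero_less_divide_iff)
    finally show ?thesis .
  qed
  have in_W: "x + p *\<^sub>R v + q *\<^sub>R w \<in> W" if "0 \<le> p" "p \<le> s" "0 \<le> q" "q \<le> s" for p q
    using near[OF that] d3 by (auto simp: d_def dist_commute)
  have in_W': "x + p *\<^sub>R w + q *\<^sub>R v \<in> W" if "0 \<le> p" "p \<le> s" "0 \<le> q" "q \<le> s" for p q
    using in_W[of q p] that by (simp add: algebra_simps)
  obtain p q where pq: "0 < p" "p < s" "0 < q" "q < s"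
    "f (x + s *\<^sub>R v + s *\<^sub>R w) - f (x + s *\<^sub>R v) - f (x + s *\<^sub>R w) + f x
      = s * s * ?P (x + p *\<^sub>R v + q *\<^sub>R w)"
    using second_difference[OF s W in_W] by blast
  obtain p' q' where pq': "0 < p'" "p' < s" "0 < q'" "q' < s"
    "f (x + s *\<^sub>R w + s *\<^sub>R v) - f (x + s *\<^sub>R w) - f (x + s *\<^sub>R v) + f x
      = s * s * ?Q (x + p' *\<^sub>R w + q' *\<^sub>R v)"
    using second_difference[OF s W in_W'] by blast
  have "s * s * ?P (x + p *\<^sub>R v + q *\<^sub>R w) = s * s * ?Q (x + p' *\<^sub>R w + q' *\<^sub>R v)"
    using pq(5) pq'(5) by (simp add: algebra_simps)
  then have eq: "?P (x + p *\<^sub>R v + q *\<^sub>R w) = ?Q (x + p' *\<^sub>R w + q' *\<^sub>R v)"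
    using s by auto
  have 1: "dist (?P (x + p *\<^sub>R v + q *\<^sub>R w)) (?P x) < dist (?P x) (?Q x) / 2"
    unfolding e_def[symmetric] using near[of p q] pq by (intro d1) (auto simp: d_def)
  have 2: "dist (?Q (x + p' *\<^sub>R w + q' *\<^sub>R v)) (?Q x) < dist (?P x) (?Q x) / 2"
    unfolding e_def[symmetric] using near[of q' p'] pq' by (intro d2) (auto simp: d_def algebra_simps)
  show False using dist_triangle_half_r[OF 1[unfolded eq] 2] by simp
qed

lemma fd_bounded_linear_compose:
  assumes "bounded_linear L" "f differentiable (at x)"
  shows "fd (\<lambda>x. L (f x)) x v = L (fd f x v)"
  using fd_eq[OF bounded_linear.has_derivative[OF assms(1) has_derivative_fd[OF assms(2)]]] by simp

lemma fd_fd_commute: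
  fixes f :: "'e::real_normed_vector \<Rightarrow> 'f::real_normed_vector"
  assumes fin: "finite_dim TYPE('f)" and W: "open W" "smooth_on W f" and x: "x \<in> W"
  shows "fd (\<lambda>y. fd f y v) x w = fd (\<lambda>y. fd f y w) x v"
proof -
  obtain B :: "'f set" and \<phi> where B: "finite B" "\<And>b. bounded_linear (\<phi> b)"
    "\<And>x. (\<Sum>b\<in>B. \<phi> b x *\<^sub>R b) = x"
    using finite_dim_dual_basis[OF fin] by metis
  have 1: "\<phi> b (fd (\<lambda>y. fd f y v) x w) = fd (\<lambda>y. fd (\<lambda>z. \<phi> b (f z)) y v) x w" for b v w
  proof -
    have "fd (\<lambda>y. fd (\<lambda>z. \<phi> b (f z)) y v) x w = fd (\<lambda>y. \<phi> b (fd f y v)) x w"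
      using fd_cong[OF W(1) x, of "\<lambda>y. fd (\<lambda>z. \<phi> b (f z)) y v" "\<lambda>y. \<phi> b (fd f y v)"]
        fd_bounded_linear_compose[OF B(2) smooth_on_differentiable[OF W]] by simp
    also have "\<dots> = \<phi> b (fd (\<lambda>y. fd f y v) x w)"
      by (intro fd_bounded_linear_compose B smooth_on_differentiable[OF W(1) _ x] smooth_on_fd W)
    finally show ?thesis by simp
  qed
  have "\<phi> b (fd (\<lambda>y. fd f y v) x w) = \<phi> b (fd (\<lambda>y. fd f y w) x v)" for b
    unfolding 1 by (rule fd_fd_commute_real[OF W(1) _ x])
      (rule smooth_on_bounded_linear_compose[OF B(2) W])
  then have "(\<Sum>b\<in>B. \<phi> b (fd (\<lambda>y. fd f y v) x w) *\<^sub>R b) = (\<Sum>b\<in>B. \<phi> b (fd (\<lambda>y. fd f y w) x v) *\<^sub>R b)"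
    by simp
  then show ?thesis by (simp only: B(3))
qed

subsection \<open>Integrals depending on a parameter\<close>

text \<open>By the mean value theorem \<open>f y - f x\<close> is \<open>f' z (y - x)\<close> for
  some \<open>z\<close> on the segment. Comparing \<open>f' z\<close> with \<open>f' x\<close> only
  requires their values on the finitely many basis vectors, and these are close by
  continuity.\<close>

lemma has_derivative_of_continuous_directional:
  fixes f :: "'e::real_normed_vector \<Rightarrow> real"
  assumes fin: "finite_dim TYPE('e)" and W: "open W" "x \<in> W"
    and line: "\<And>y v. y \<in> W \<Longrightarrow> ((\<lambda>s. f (y + s *\<^sub>R v)) has_real_derivative f' y v) (at 0)"
    and cont: "\<And>v. continuous_on W (\<lambda>y. f' y v)"
    and lin: "\<And>y. y \<in> W \<Longrightarrow> linear (f' y)"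
  shows "(f has_derivative f' x) (at x)"
  unfolding has_derivative_at_alt
proof (intro conjI allI impI)
  show "bounded_linear (f' x)" using finite_dim_linear_bounded[OF fin lin[OF W(2)]] .
  fix e :: real assume e: "0 < e"
  obtain B :: "'e set" and \<phi> where B: "finite B" "\<And>b. bounded_linear (\<phi> b)"
    "\<And>x. (\<Sum>b\<in>B. \<phi> b x *\<^sub>R b) = x"
    using finite_dim_dual_basis[OF fin] by metis
  obtain K where K: "\<And>b x. \<bar>\<phi> b x\<bar> \<le> norm x * K b" "\<And>b. 0 < K b"
    using bounded_linear.pos_bounded[OF B(2)] by (metis real_norm_def)
  \<comment> \<open>Chosen so that the basis terms, each at most \<open>norm h * K b * c\<close>,
    add up to at most \<open>e * norm h\<close>; the summand 1 covers an empty basis.\<close>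
  define c where "c = e / ((\<Sum>b\<in>B. K b) + 1)"
  have SK: "0 \<le> (\<Sum>b\<in>B. K b)" using K(2) by (simp add: sum_nonneg less_imp_le)
  have c: "c > 0" unfolding c_def using e SK by simp
  have "\<forall>\<^sub>F y in nhds x. \<forall>b\<in>B. dist (f' y b) (f' x b) < c"
  proof (intro eventually_ball_finite ballI B(1))
    fix b
    have "isCont (\<lambda>y. f' y b) x"
      using cont[of b] W by (simp add: continuous_on_eq_continuous_at)
    then have "((\<lambda>y. f' y b) \<longlongrightarrow> f' x b) (nhds x)"
      unfolding isCont_def using tendsto_at_iff_tendsto_nhds[of "\<lambda>y. f' y b" x] by simp
    then show "\<forall>\<^sub>F y in nhds x. dist (f' y b) (f' x b) < c"
      using c by (rule tendstoD)
  qed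
  moreover have "\<forall>\<^sub>F y in nhds x. y \<in> W" using W eventually_nhds_in_open by blast
  ultimately have "\<forall>\<^sub>F y in nhds x. y \<in> W \<and> (\<forall>b\<in>B. dist (f' y b) (f' x b) < c)"
    by eventually_elim auto
  then obtain d where d: "d > 0"
    "\<And>y. dist y x < d \<Longrightarrow> y \<in> W \<and> (\<forall>b\<in>B. dist (f' y b) (f' x b) < c)"
    unfolding eventually_nhds_metric by blast
  have "norm (f y - f x - f' x (y - x)) \<le> e * norm (y - x)" if y: "norm (y - x) < d" for y
  proof -
    define h where "h = y - x"
    have near: "dist (x + r *\<^sub>R h) x < d" if "0 \<le> r" "r \<le> 1" for r
      using y that mult_left_le_one_le[of "norm h" r] by (simp add: dist_norm h_def)
    have "\<exists>r>0. r < 1 \<and> f (x + 1 *\<^sub>R h) - f (x + 0 *\<^sub>R h) = (1 - 0) * f' (x + r *\<^sub>R h) h"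
    proof (rule MVT2)
      fix r :: real assume r: "0 \<le> r" "r \<le> 1"
      have "((\<lambda>s. f (x + r *\<^sub>R h + s *\<^sub>R h)) has_real_derivative f' (x + r *\<^sub>R h) h) (at 0)"
        using line d(2) near[OF r] by blast
      then have "((\<lambda>s. f (x + (r + s) *\<^sub>R h)) has_real_derivative f' (x + r *\<^sub>R h) h) (at 0)"
        by (simp add: algebra_simps)
      then show "((\<lambda>s. f (x + s *\<^sub>R h)) has_real_derivative f' (x + r *\<^sub>R h) h) (at r)"
        using DERIV_shift[of "\<lambda>s. f (x + s *\<^sub>R h)" _ 0 r] by (simp add: add.commute)
    qed auto
    then obtain r where r: "0 < r" "r < 1" "f y - f x = f' (x + r *\<^sub>R h) h"
      by (auto simp: h_def)
    define z where "z = x + r *\<^sub>R h"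
    have z: "z \<in> W" "\<And>b. b \<in> B \<Longrightarrow> \<bar>f' z b - f' x b\<bar> < c"
      using d(2)[OF near[of r]] r by (auto simp: z_def dist_real_def)
    have exp: "L h = (\<Sum>b\<in>B. \<phi> b h * L b)" if L: "linear L" for L :: "'e \<Rightarrow> real"
    proof -
      have "L h = L (\<Sum>b\<in>B. \<phi> b h *\<^sub>R b)" by (simp only: B(3))
      then show ?thesis using L by (simp add: linear_sum linear_scale)
    qed
    have "f y - f x - f' x (y - x) = (\<Sum>b\<in>B. \<phi> b h * (f' z b - f' x b))"
      using exp[OF lin[OF W(2)]] exp[OF lin[OF z(1)]] r(3)
      by (simp add: h_def[symmetric] z_def[symmetric] sum_subtractf right_diff_distrib)
    also have "\<bar>\<dots>\<bar> \<le> (\<Sum>b\<in>B. (norm h * K b) * c)"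
      using z(2) K by (intro order_trans[OF sum_abs] sum_mono) (auto simp: abs_mult less_imp_le intro!: mult_mono)
    also have "\<dots> = norm h * (c * (\<Sum>b\<in>B. K b))"
      by (simp add: sum_distrib_left sum_distrib_right algebra_simps)
    also have "\<dots> \<le> norm h * e"
      using e SK by (intro mult_left_mono) (auto simp: c_def field_simps)
    finally show ?thesis by (simp add: h_def mult.commute)
  qed
  then show "\<exists>d>0. \<forall>y. norm (y - x) < d \<longrightarrow> norm (f y - f x - f' x (y - x)) \<le> e * norm (y - x)"
    using d(1) by blast
qed

lemma continuous_on_parameter:
  assumes "open W" "smooth_on (W \<times> UNIV) g" "u \<in> W"
  shows "continuous_on S (\<lambda>t. g (u, t))"
proof -
  have "continuous_on (W \<times> UNIV) g"
    using assms by (intro smooth_on_continuous) (simp_all add: open_Times)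
  moreover have "continuous_on S (\<lambda>t. (u, t))" by (intro continuous_intros)
  moreover have "(\<lambda>t. (u, t)) ` S \<subseteq> W \<times> UNIV" using assms(3) by auto
  ultimately show ?thesis by (rule continuous_on_compose2)
qed

lemma integrable_parameter:
  fixes g :: "'e::real_normed_vector \<times> real \<Rightarrow> real"
  assumes "open W" "smooth_on (W \<times> UNIV) g" "u \<in> W"
  shows "(\<lambda>t. g (u, t)) integrable_on {0..1}"
  using continuous_on_parameter[OF assms, of "{0..1}"] by (rule integrable_continuous_real)

text \<open>Along a line the parameter is a real number, and the Leibniz rule for integrals gives
  the directional derivatives. They are linear and continuous, so they assemble to a Frechet
  derivative.\<close>

lemma has_derivative_parametric_integral:
  fixes g :: "'e::real_normed_vector \<times> real \<Rightarrow> real"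
  assumes fin: "finite_dim TYPE('e)" and W: "open W" and g: "smooth_on (W \<times> UNIV) g"
    and u: "u \<in> W"
  shows "((\<lambda>u. integral {0..1} (\<lambda>t. g (u, t))) has_derivative
    (\<lambda>v. integral {0..1} (\<lambda>t. fd g (u, t) (v, 0)))) (at u)"
proof -
  have WU: "open (W \<times> (UNIV :: real set))" using W by (simp add: open_Times)
  have diff: "g differentiable (at (u, t))" if "u \<in> W" for u t
    using smooth_on_differentiable[OF WU g] that by auto
  have dg: "smooth_on (W \<times> UNIV) (\<lambda>p. fd g p w)" for w by (rule smooth_on_fd[OF WU g])
  show ?thesis
  proof (rule has_derivative_of_continuous_directional[OF fin W u, where
        f' = "\<lambda>u v. integral {0..1} (\<lambda>t. fd g (u, t) (v, 0))"])
    show "linear (\<lambda>v. integral {0..1} (\<lambda>t. fd g (u, t) (v, 0)))" if "u \<in> W" for u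
    proof (rule linearI)
      fix v w
      have "fd g (u, t) (v + w, 0) = fd g (u, t) (v, 0) + fd g (u, t) (w, 0)" for t
        using linear_add[OF linear_fd[OF diff[OF that]], of t "(v, 0)" "(w, 0)"] by simp
      then show "integral {0..1} (\<lambda>t. fd g (u, t) (v + w, 0))
        = integral {0..1} (\<lambda>t. fd g (u, t) (v, 0)) + integral {0..1} (\<lambda>t. fd g (u, t) (w, 0))"
        using integral_add[OF integrable_parameter[OF W dg that] integrable_parameter[OF W dg that]]
        by simp
    next
      fix r v
      have "fd g (u, t) (r *\<^sub>R v, 0) = r *\<^sub>R fd g (u, t) (v, 0)" for t
        using linear_scale[OF linear_fd[OF diff[OF that]], of t r "(v, 0)"] by simp
      then show "integral {0..1} (\<lambda>t. fd g (u, t) (r *\<^sub>R v, 0))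
        = r *\<^sub>R integral {0..1} (\<lambda>t. fd g (u, t) (v, 0))" by simp
    qed
    show "continuous_on W (\<lambda>u. integral {0..1} (\<lambda>t. fd g (u, t) (v, 0)))" for v
      using integral_continuous_on_param[of W 0 "1::real" "\<lambda>u t. fd g (u, t) (v, 0)"]
        continuous_on_subset[OF smooth_on_continuous[OF WU dg], of "W \<times> {0..1}"]
      by (auto simp: case_prod_beta)
  next
    fix y v assume y: "y \<in> W"
    have "open ((\<lambda>s. y + s *\<^sub>R v) -` W)"
      by (intro open_vimage W continuous_intros)
    then obtain d where d: "d > 0" "ball 0 d \<subseteq> (\<lambda>s. y + s *\<^sub>R v) -` W"
      using y openE[of "(\<lambda>s. y + s *\<^sub>R v) -` W" 0] by auto
    have "((\<lambda>s. integral (cbox 0 1) (\<lambda>t. g (y + s *\<^sub>R v, t))) has_real_derivative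
        integral (cbox 0 1) (\<lambda>t. fd g (y + 0 *\<^sub>R v, t) (v, 0))) (at 0 within ball 0 d)"
    proof (rule leibniz_rule_field_derivative[where f = "\<lambda>s t. g (y + s *\<^sub>R v, t)" and
          fx = "\<lambda>s t. fd g (y + s *\<^sub>R v, t) (v, 0)"])
      fix s t :: real assume s: "s \<in> ball 0 d"
      then have in_W: "y + s *\<^sub>R v \<in> W" using d by auto
      have "((\<lambda>s. g ((y, t) + s *\<^sub>R (v, 0))) has_vector_derivative fd g ((y, t) + s *\<^sub>R (v, 0)) (v, 0)) (at s)"
        by (rule has_derivative_line) (use diff[OF in_W] in simp)
      then show "((\<lambda>s. g (y + s *\<^sub>R v, t)) has_real_derivative fd g (y + s *\<^sub>R v, t) (v, 0)) (at s within ball 0 d)"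
        by (auto simp: has_real_derivative_iff_has_vector_derivative intro: has_vector_derivative_at_within)
      show "(\<lambda>t. g (y + s *\<^sub>R v, t)) integrable_on cbox 0 1"
        using integrable_parameter[OF W g in_W] by simp
    next
      show "continuous_on (ball 0 d \<times> cbox 0 1) (\<lambda>(s, t). fd g (y + s *\<^sub>R v, t) (v, 0))"
        unfolding case_prod_beta
        by (rule continuous_on_compose2[OF smooth_on_continuous[OF WU dg]])
          (use d in \<open>auto intro!: continuous_intros\<close>)
    qed (use d in auto)
    moreover have "at 0 within ball 0 d = at (0::real)"
      by (rule at_within_open) (use d(1) in auto)
    ultimately show "((\<lambda>s. integral {0..1} (\<lambda>t. g (y + s *\<^sub>R v, t))) has_real_derivative
        integral {0..1} (\<lambda>t. fd g (y, t) (v, 0))) (at 0)"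
      by (simp only: cbox_interval scaleR_zero_left add_0_right)
  qed
qed

text \<open>A directional derivative is again an integral of this kind with a smooth integrand,
  which is why the induction on the order is over all \<open>g\<close> at once.\<close>

lemma smooth_on_parametric_integral:
  fixes g :: "'e::real_normed_vector \<times> real \<Rightarrow> real"
  assumes fin: "finite_dim TYPE('e)" and W: "open W" and g: "smooth_on (W \<times> UNIV) g"
  shows "smooth_on W (\<lambda>u. integral {0..1} (\<lambda>t. g (u, t)))"
proof -
  have "Ck_on k (\<lambda>u. integral {0..1} (\<lambda>t. g (u, t))) W" for k
    using g
  proof (induction k arbitrary: g)
    case 0
    show ?case unfolding Ck_on.simps
      using has_derivative_parametric_integral[OF fin W 0]
      by (auto intro!: continuous_at_imp_continuous_on has_derivative_continuous)
  next
    case (Suc k)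
    note * = has_derivative_parametric_integral[OF fin W Suc.prems]
    have "smooth_on (W \<times> UNIV) (\<lambda>p. fd g p w)" for w
      using W Suc.prems by (intro smooth_on_fd) (auto simp: open_Times)
    then have "Ck_on k (\<lambda>u. integral {0..1} (\<lambda>t. fd g (u, t) (v, 0))) W" for v
      by (rule Suc.IH)
    then have "Ck_on k (\<lambda>u. fd (\<lambda>u. integral {0..1} (\<lambda>t. g (u, t))) u v) W" for v
      by (rule Ck_on_cong[OF W, rotated]) (simp add: fd_eq[OF *])
    then show ?case using * by (auto simp: differentiable_def)
  qed
  then show ?thesis using smooth_on_open[OF W] by blast
qed

subsection \<open>Multilinear functions of lists of vectors\<close>

definition multilinear :: "nat \<Rightarrow> ('v::real_vector list \<Rightarrow> real) \<Rightarrow> bool" where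
  "multilinear k a \<longleftrightarrow> (\<forall>xs zs. length xs + length zs + 1 = k \<longrightarrow> linear (\<lambda>y. a (xs @ y # zs)))"

definition alternating :: "nat \<Rightarrow> ('v list \<Rightarrow> real) \<Rightarrow> bool" where
  "alternating k a \<longleftrightarrow>
     (\<forall>xs y ys zs. length xs + length ys + length zs + 2 = k \<longrightarrow> a (xs @ y # ys @ y # zs) = 0)"

lemma multilinearD:
  "multilinear k a \<Longrightarrow> length xs + length zs + 1 = k \<Longrightarrow> linear (\<lambda>y. a (xs @ y # zs))"
  unfolding multilinear_def by blast

lemma multilinear_Cons: "multilinear (Suc k) a \<Longrightarrow> multilinear k (\<lambda>vs. a (b # vs))"
  unfolding multilinear_def[of k]
  by (intro allI impI) (use multilinearD[where xs = "b # xs" for xs] in fastforce)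

lemma multilinear_expand_Cons:
  assumes "multilinear (Suc k) a" "length zs = k" "(\<Sum>b\<in>B. c b *\<^sub>R b) = y"
  shows "a (y # zs) = (\<Sum>b\<in>B. c b * a (b # zs))"
proof -
  have lin: "linear (\<lambda>y. a (y # zs))" using multilinearD[OF assms(1), of "[]" zs] assms(2) by simp
  have "a ((\<Sum>b\<in>B. c b *\<^sub>R b) # zs) = (\<Sum>b\<in>B. c b * a (b # zs))"
    using linear_sum[OF lin, of "\<lambda>b. c b *\<^sub>R b" B] linear_scale[OF lin] by simp
  then show ?thesis by (simp only: assms(3))
qed

text \<open>Polarization: expand the vanishing value at \<open>x + y\<close> in both adjacent
  places.\<close>

lemma alternating_swap:
  assumes m: "multilinear k a" and alt: "alternating k a"
    and l: "length xs + length zs + 2 = k"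
  shows "a (xs @ x # y # zs) = - a (xs @ y # x # zs)"
proof -
  have 0: "a (xs @ w # w # zs) = 0" for w
    using alt[unfolded alternating_def, rule_format, of xs "[]" zs w] l by simp
  have 1: "a (xs @ (x + y) # w # zs) = a (xs @ x # w # zs) + a (xs @ y # w # zs)" for w
    using linear_add[OF multilinearD[OF m, of xs "w # zs"]] l by simp
  have 2: "a (xs @ w # (x + y) # zs) = a (xs @ w # x # zs) + a (xs @ w # y # zs)" for w
    using linear_add[OF multilinearD[OF m, of "xs @ [w]" zs]] l by simp
  show ?thesis using 0[of "x + y"] 0[of x] 0[of y] by (simp add: 1 2)
qed

lemma alternating_move:
  assumes m: "multilinear k a" and alt: "alternating k a"
    and l: "length xs + length ys + length zs + 1 = k"
  shows "a (xs @ ys @ y # zs) = (-1) ^ length ys * a (xs @ y # ys @ zs)"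
  using l
proof (induction ys arbitrary: xs)
  case (Cons w ys)
  have "a (xs @ (w # ys) @ y # zs) = a ((xs @ [w]) @ ys @ y # zs)" by simp
  also have "\<dots> = (-1) ^ length ys * a ((xs @ [w]) @ y # ys @ zs)"
    using Cons.prems by (intro Cons.IH) simp
  also have "a ((xs @ [w]) @ y # ys @ zs) = - a (xs @ y # w # ys @ zs)"
    using alternating_swap[OF m alt, of xs "ys @ zs" w y] Cons.prems by simp
  finally show ?case by simp
qed simp

text \<open>Each argument moving with \<open>x\<close> is expanded in a fixed basis, one after the
  other. What remains are values on constant lists, multiplied by smooth coefficients.\<close>

lemma smooth_on_multilinear:
  fixes B :: "'r::real_normed_vector list \<Rightarrow> 'e::real_normed_vector \<Rightarrow> real"
  assumes fin: "finite_dim TYPE('r)" and W: "open W"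
    and "\<And>vs. length vs = length ws \<Longrightarrow> smooth_on W (B vs)"
    and "\<And>x. x \<in> W \<Longrightarrow> multilinear (length ws) (\<lambda>vs. B vs x)"
    and "\<And>w. w \<in> set ws \<Longrightarrow> smooth_on W w"
  shows "smooth_on W (\<lambda>x. B (map (\<lambda>w. w x) ws) x)"
  using assms(3-5)
proof (induction ws arbitrary: B)
  case (Cons w ws)
  obtain E :: "'r set" and \<phi> where E: "finite E" "\<And>b. bounded_linear (\<phi> b)"
    "\<And>x. (\<Sum>b\<in>E. \<phi> b x *\<^sub>R b) = x"
    using finite_dim_dual_basis[OF fin] by metis
  have "smooth_on W (\<lambda>x. \<Sum>b\<in>E. \<phi> b (w x) * B (b # map (\<lambda>w. w x) ws) x)"
    by (intro smooth_on_sum smooth_on_mult W smooth_on_bounded_linear_compose[OF E(2)]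
        Cons.IH[of "\<lambda>vs. B (_ # vs)"] multilinear_Cons)
      (use Cons.prems in auto)
  then show ?case
    by (rule smooth_on_cong)
      (use multilinear_expand_Cons[OF Cons.prems(2)[unfolded length_Cons] _ E(3)] in simp)
qed simp

text \<open>The product rule for a form evaluated on moving vectors: one term for the coefficients
  of the form and one for each argument. Expanding the first argument in a basis reduces it to the
  product rule for real functions.\<close>

lemma has_derivative_multilinear:
  fixes B :: "'r::real_normed_vector list \<Rightarrow> 'e::real_normed_vector \<Rightarrow> real"
  assumes fin: "finite_dim TYPE('r)" and W: "open W" "x \<in> W"
    and "\<And>vs. length vs = length ws \<Longrightarrow> B vs differentiable (at x)"
    and "\<And>x. x \<in> W \<Longrightarrow> multilinear (length ws) (\<lambda>vs. B vs x)"
    and "\<And>w. w \<in> set ws \<Longrightarrow> w differentiable (at x)"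
  shows "((\<lambda>y. B (map (\<lambda>w. w y) ws) y) has_derivative
    (\<lambda>h. fd (B (map (\<lambda>w. w x) ws)) x h +
      (\<Sum>j<length ws. B ((map (\<lambda>w. w x) ws)[j := fd (ws ! j) x h]) x))) (at x)"
  using assms(4-6)
proof (induction ws arbitrary: B)
  case Nil
  then show ?case using has_derivative_fd by simp
next
  case (Cons w ws)
  obtain E :: "'r set" and \<phi> where E: "finite E" "\<And>b. bounded_linear (\<phi> b)"
    "\<And>x. (\<Sum>b\<in>E. \<phi> b x *\<^sub>R b) = x"
    using finite_dim_dual_basis[OF fin] by metis
  let ?m = "\<lambda>y. map (\<lambda>w. w y) ws"
  let ?D = "\<lambda>b h. fd (B (b # ?m x)) x h + (\<Sum>j<length ws. B (b # (?m x)[j := fd (ws ! j) x h]) x)"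
  have ml: "multilinear (Suc (length ws)) (\<lambda>vs. B vs y)" if "y \<in> W" for y
    using Cons.prems(2)[OF that] by simp
  note expand = multilinear_expand_Cons[OF ml _ E(3)]
  have IH: "((\<lambda>y. B (b # ?m y) y) has_derivative ?D b) (at x)" for b
    by (rule Cons.IH[of "\<lambda>vs. B (b # vs)"]) (use Cons.prems in \<open>auto intro: multilinear_Cons\<close>)
  have w: "((\<lambda>y. \<phi> b (w y)) has_derivative (\<lambda>h. \<phi> b (fd w x h))) (at x)" for b
    by (intro bounded_linear.has_derivative[OF E(2)] has_derivative_fd Cons.prems) simp
  have "((\<lambda>y. \<Sum>b\<in>E. \<phi> b (w y) * B (b # ?m y) y) has_derivative
    (\<lambda>h. \<Sum>b\<in>E. \<phi> b (w x) * ?D b h + \<phi> b (fd w x h) * B (b # ?m x) x)) (at x)"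
    by (intro has_derivative_sum has_derivative_mult w IH)
  then have 1: "((\<lambda>y. B (w y # ?m y) y) has_derivative
    (\<lambda>h. \<Sum>b\<in>E. \<phi> b (w x) * ?D b h + \<phi> b (fd w x h) * B (b # ?m x) x)) (at x)"
    by (rule has_derivative_transform_within_open[OF _ W]) (simp add: expand)
  \<comment> \<open>The derivative with the first argument frozen at \<open>w x\<close>; the terms
    in which the coefficients \<open>\<phi> b (w y)\<close> are differentiated are collected
    separately.\<close>
  have fdB: "fd (B (w x # ?m x)) x h = (\<Sum>b\<in>E. \<phi> b (w x) * fd (B (b # ?m x)) x h)" for h
  proof -
    have "((\<lambda>y. \<Sum>b\<in>E. \<phi> b (w x) * B (b # ?m x) y) has_derivative
      (\<lambda>h. \<Sum>b\<in>E. \<phi> b (w x) * fd (B (b # ?m x)) x h)) (at x)"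
      by (intro has_derivative_sum has_derivative_mult_right has_derivative_fd Cons.prems) simp
    then have "(B (w x # ?m x) has_derivative
      (\<lambda>h. \<Sum>b\<in>E. \<phi> b (w x) * fd (B (b # ?m x)) x h)) (at x)"
      by (rule has_derivative_transform_within_open[OF _ W]) (simp add: expand)
    then show ?thesis by (simp add: fd_eq)
  qed
  have 2: "(\<Sum>b\<in>E. \<phi> b (w x) * ?D b h + \<phi> b (fd w x h) * B (b # ?m x) x)
    = fd (B (w x # ?m x)) x h + (B (fd w x h # ?m x) x
        + (\<Sum>j<length ws. B (w x # (?m x)[j := fd (ws ! j) x h]) x))" for h
  proof -
    have "(\<Sum>j<length ws. B (w x # (?m x)[j := fd (ws ! j) x h]) x)
      = (\<Sum>b\<in>E. \<phi> b (w x) * (\<Sum>j<length ws. B (b # (?m x)[j := fd (ws ! j) x h]) x))"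
    proof -
      have "(\<Sum>j<length ws. B (w x # (?m x)[j := fd (ws ! j) x h]) x)
        = (\<Sum>j<length ws. \<Sum>b\<in>E. \<phi> b (w x) * B (b # (?m x)[j := fd (ws ! j) x h]) x)"
        using W(2) by (simp add: expand)
      also have "\<dots> = (\<Sum>b\<in>E. \<Sum>j<length ws. \<phi> b (w x) * B (b # (?m x)[j := fd (ws ! j) x h]) x)"
        by (rule sum.swap)
      finally show ?thesis by (simp add: sum_distrib_left)
    qed
    moreover have "B (fd w x h # ?m x) x = (\<Sum>b\<in>E. \<phi> b (fd w x h) * B (b # ?m x) x)"
      using W(2) by (simp add: expand)
    ultimately show ?thesis
      by (simp add: fdB distrib_left sum.distrib)
  qed
  have 3: "(\<Sum>j<length (w # ws). B ((map (\<lambda>w. w x) (w # ws))[j := fd ((w # ws) ! j) x h]) x)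
    = B (fd w x h # ?m x) x + (\<Sum>j<length ws. B (w x # (?m x)[j := fd (ws ! j) x h]) x)" for h
    by (simp only: length_Cons sum.lessThan_Suc_shift) simp
  show ?case using 1 unfolding 2 3 by simp
qed

subsection \<open>The exterior derivative in coordinates\<close>

lemma length_del_nth: "i < length xs \<Longrightarrow> length (del_nth i xs) = length xs - 1"
  by (simp add: del_nth_def)

lemma del_nth_map: "del_nth i (map f xs) = map f (del_nth i xs)"
  by (simp add: del_nth_def take_map drop_map)

lemma del_nth_Cons_0: "del_nth 0 (x # xs) = xs"
  by (simp add: del_nth_def)

lemma del_nth_Cons_Suc: "del_nth (Suc i) (x # xs) = x # del_nth i xs"
  by (simp add: del_nth_def)

lemma set_del_nth: "set (del_nth i xs) \<subseteq> set xs"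
  unfolding del_nth_def using set_take_subset set_drop_subset by fastforce

text \<open>Deleting entry \<open>i\<close> shifts the later ones, so place \<open>j\<close> of the
  shorter list is place \<open>Suc j\<close> of \<open>ws\<close>. This lemma and the next decompose
  the lists of a cancelling pair into the same pieces, with \<open>s\<close> behind or in front of
  the middle piece.\<close>

lemma del_nth_update_ge:
  assumes "i \<le> j" "Suc j < length ws"
  shows "(del_nth i ws)[j := s] = take i ws @ drop (Suc i) (take (Suc j) ws) @ s # drop (Suc (Suc j)) ws"
  using assms by (intro nth_equalityI)
    (auto simp: del_nth_def nth_append nth_list_update nth_Cons' min_def)

lemma del_nth_update_less:
  assumes "i \<le> j" "Suc j < length ws"
  shows "(del_nth (Suc j) ws)[i := s] = take i ws @ s # drop (Suc i) (take (Suc j) ws) @ drop (Suc (Suc j)) ws"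
  using assms by (intro nth_equalityI)
    (auto simp: del_nth_def nth_append nth_list_update nth_Cons' min_def)

lemma nth_del_nth:
  assumes "j < length ws - 1"
  shows "del_nth i ws ! j = (if j < i then ws ! j else ws ! Suc j)"
  using assms by (auto simp: del_nth_def nth_append min_def)

text \<open>The terms with \<open>i \<le> j\<close> cancel those with \<open>j < i\<close>: moving the symmetric entry from
  place \<open>j\<close> to place \<open>i\<close> costs \<open>j - i\<close> transpositions.\<close>

lemma alternating_symmetric_sum:
  assumes m: "multilinear k a" and alt: "alternating k a" and sym: "\<And>x y. S x y = S y x"
    and l: "length vs = Suc k" "length ws = Suc k"
  shows "(\<Sum>i<Suc k. (-1) ^ i * (\<Sum>j<k. a ((del_nth i ws)[j := S (vs ! i) (del_nth i vs ! j)]))) = 0"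
proof -
  define t where "t = (\<lambda>(i, j). (-1) ^ i * a ((del_nth i ws)[j := S (vs ! i) (del_nth i vs ! j)]))"
  have t: "t (Suc j, i) = - t (i, j)" if "i \<le> j" "j < k" for i j
  proof -
    define ys where "ys = drop (Suc i) (take (Suc j) ws)"
    have lys: "length ys = j - i" using that l by (simp add: ys_def)
    let ?s = "S (vs ! i) (vs ! Suc j)"
    have nth: "del_nth i vs ! j = vs ! Suc j" "del_nth (Suc j) vs ! i = vs ! i"
      using that l by (auto simp: nth_del_nth)
    have "a (take i ws @ ys @ ?s # drop (Suc (Suc j)) ws)
      = (-1) ^ (j - i) * a (take i ws @ ?s # ys @ drop (Suc (Suc j)) ws)"
      using alternating_move[OF m alt, of "take i ws" ys "drop (Suc (Suc j)) ws"] that l lys by simp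
    moreover have "(-1 :: real) ^ i * (-1) ^ (j - i) = (-1) ^ j"
      using that by (simp flip: power_add)
    ultimately have "(-1) ^ i * a (take i ws @ ys @ ?s # drop (Suc (Suc j)) ws)
      = (-1) ^ j * a (take i ws @ ?s # ys @ drop (Suc (Suc j)) ws)"
      by (metis mult.assoc)
    then show ?thesis
      using that l unfolding t_def
      by (simp add: nth del_nth_update_ge del_nth_update_less ys_def sym[of "vs ! Suc j"])
  qed
  let ?A = "{(i, j). i \<le> j \<and> j < k}" and ?B = "{(i, j). j < i \<and> i < Suc k}"
  have fin: "finite ?A" "finite ?B"
    by (rule finite_subset[of _ "{..<Suc k} \<times> {..<Suc k}"]; auto)+
  have "(\<Sum>i<Suc k. (-1) ^ i * (\<Sum>j<k. a ((del_nth i ws)[j := S (vs ! i) (del_nth i vs ! j)])))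
    = sum t ({..<Suc k} \<times> {..<k})"
    by (simp add: t_def sum.cartesian_product[symmetric] sum_distrib_left del: sum.lessThan_Suc)
  also have "{..<Suc k} \<times> {..<k} = ?A \<union> ?B" by auto
  also have "sum t (?A \<union> ?B) = sum t ?A + sum t ?B"
    by (rule sum.union_disjoint[OF fin]) auto
  also have "sum t ?B = (\<Sum>(i, j)\<in>?A. t (Suc j, i))"
    by (rule sum.reindex_bij_witness[of _ "\<lambda>(i, j). (Suc j, i)" "\<lambda>(i, j). (j, i - 1)"]) auto
  also have "\<dots> = (\<Sum>p\<in>?A. - t p)"
    by (rule sum.cong) (auto simp: t)
  finally show ?thesis by (simp add: sum_negf)
qed

text \<open>The coordinate formula of \<open>leaf_d\<close> for a family of functions on a model
  space. Separating it from manifolds turns naturality into a statement of calculus on open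
  sets.\<close>

definition coord_d ::
  "('p::real_normed_vector list \<Rightarrow> 'p \<times> 'q::real_normed_vector \<Rightarrow> real) \<Rightarrow> 'p list \<Rightarrow> 'p \<times> 'q \<Rightarrow> real" where
  "coord_d B vs u = (\<Sum>i<length vs. (- 1) ^ i * fd (B (del_nth i vs)) u (vs ! i, 0))"

text \<open>Differentiating the pulled back form yields the derivative of \<open>B\<close> plus
  terms in which an argument \<open>fst (fd \<phi> y (v, 0))\<close> is differentiated. The latter
  contain second derivatives \<open>S\<close> of \<open>\<phi>\<close>, which are symmetric, and
  cancel by \<open>alternating_symmetric_sum\<close>. The assumption \<open>tan\<close> keeps the
  direction in which \<open>B\<close> is differentiated leafwise.\<close>

lemma coord_d_pullback:
  fixes \<phi> :: "'p::real_normed_vector \<times> 'q::real_normed_vector \<Rightarrow> 'r::real_normed_vector \<times> 's::real_normed_vector"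
  assumes fin: "finite_dim TYPE('r \<times> 's)"
    and W: "open W" "u \<in> W" and \<phi>: "smooth_on W \<phi>" "\<And>y. y \<in> W \<Longrightarrow> \<phi> y \<in> V" and V: "open V"
    and B: "\<And>vs. length vs = k \<Longrightarrow> smooth_on V (B vs)"
    and ml: "\<And>y. y \<in> V \<Longrightarrow> multilinear k (\<lambda>vs. B vs y)"
    and alt: "alternating k (\<lambda>vs. B vs (\<phi> u))"
    and tan: "\<And>v. snd (fd \<phi> u (v, 0)) = 0"
    and l: "length vs = Suc k"
    and C: "\<And>y vs. y \<in> W \<Longrightarrow> length vs = k \<Longrightarrow> C vs y = B (map (\<lambda>v. fst (fd \<phi> y (v, 0))) vs) (\<phi> y)"
  shows "coord_d C vs u = coord_d B (map (\<lambda>v. fst (fd \<phi> u (v, 0))) vs) (\<phi> u)"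
proof -
  note finr = finite_dim_fst[OF fin]
  define S where "S = (\<lambda>x y. fst (fd (\<lambda>z. fd \<phi> z (y, 0)) u (x, 0)))"
  let ?L = "\<lambda>v. fst (fd \<phi> u (v, 0))"
  have sym: "S x y = S y x" for x y
    unfolding S_def using fd_fd_commute[OF fin W(1) \<phi>(1) W(2)] by metis
  have smw: "smooth_on W (\<lambda>y. fst (fd \<phi> y (v, 0)))" for v
    by (intro smooth_on_fst smooth_on_fd W \<phi>)
  have fdw: "fd (\<lambda>y. fst (fd \<phi> y (v, 0))) u (x, 0) = S x v" for x v
    unfolding S_def
    by (rule fd_bounded_linear_compose[OF bounded_linear_fst])
      (rule smooth_on_differentiable[OF W(1) smooth_on_fd[OF W(1) \<phi>(1)] W(2)])
  have main: "fd (C ds) u (x, 0) = fd (B (map ?L ds)) (\<phi> u) (?L x, 0)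
      + (\<Sum>j<k. B ((map ?L ds)[j := S x (ds ! j)]) (\<phi> u))" if ds: "length ds = k" for ds x
  proof -
    let ?ws = "map (\<lambda>v y. fst (fd \<phi> y (v, 0))) ds"
    have "((\<lambda>y. B (map (\<lambda>w. w y) ?ws) (\<phi> y)) has_derivative
      (\<lambda>h. fd (\<lambda>y. B (map (\<lambda>w. w u) ?ws) (\<phi> y)) u h +
        (\<Sum>j<length ?ws. B ((map (\<lambda>w. w u) ?ws)[j := fd (?ws ! j) u h]) (\<phi> u)))) (at u)"
    proof (rule has_derivative_multilinear[OF finr W, where B = "\<lambda>vs y. B vs (\<phi> y)"])
      show "(\<lambda>y. B vs (\<phi> y)) differentiable (at u)" if "length vs = length ?ws" for vs
        by (rule smooth_on_differentiable[OF W(1) smooth_on_compose[OF fin W(1) \<phi> B] W(2)])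
          (use that ds in auto)
      show "multilinear (length ?ws) (\<lambda>vs. B vs (\<phi> y))" if "y \<in> W" for y
        using ml[OF \<phi>(2)[OF that]] ds by simp
      show "w differentiable (at u)" if "w \<in> set ?ws" for w
        using that smooth_on_differentiable[OF W(1) smw W(2)] by auto
    qed
    then have "fd (\<lambda>y. B (map (\<lambda>v. fst (fd \<phi> y (v, 0))) ds) (\<phi> y)) u (x, 0)
      = fd (\<lambda>y. B (map ?L ds) (\<phi> y)) u (x, 0) + (\<Sum>j<k. B ((map ?L ds)[j := S x (ds ! j)]) (\<phi> u))"
      using ds by (simp add: fd_eq o_def fdw)
    moreover have "fd (C ds) u = fd (\<lambda>y. B (map (\<lambda>v. fst (fd \<phi> y (v, 0))) ds) (\<phi> y)) u"
      by (rule fd_cong[OF W]) (use C ds in auto)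
    moreover have "fd (\<lambda>y. B (map ?L ds) (\<phi> y)) u (x, 0) = fd (B (map ?L ds)) (\<phi> u) (fd \<phi> u (x, 0))"
    proof -
      have "B (map ?L ds) differentiable (at (\<phi> u))"
        using smooth_on_differentiable[OF V B \<phi>(2)[OF W(2)], of "map ?L ds"] ds by simp
      then show ?thesis
        using smooth_on_differentiable[OF W(1) \<phi>(1) W(2)] by (simp add: fd_compose)
    qed
    moreover have "fd \<phi> u (x, 0) = (?L x, 0)" using tan[of x] by (simp add: prod_eq_iff)
    ultimately show ?thesis by simp
  qed
  have "coord_d C vs u = (\<Sum>i<Suc k. (-1) ^ i * fd (B (map ?L (del_nth i vs))) (\<phi> u) (?L (vs ! i), 0)
      + (-1) ^ i * (\<Sum>j<k. B ((del_nth i (map ?L vs))[j := S (vs ! i) (del_nth i vs ! j)]) (\<phi> u)))"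
    unfolding coord_d_def l
    by (rule sum.cong) (simp_all add: main length_del_nth l distrib_left del_nth_map)
  also have "\<dots> = coord_d B (map ?L vs) (\<phi> u)"
  proof -
    have "(\<Sum>i<Suc k. (-1) ^ i * (\<Sum>j<k. B ((del_nth i (map ?L vs))[j := S (vs ! i) (del_nth i vs ! j)]) (\<phi> u))) = 0"
      using l by (intro alternating_symmetric_sum[OF ml[OF \<phi>(2)[OF W(2)]] alt sym]) simp_all
    moreover have "coord_d B (map ?L vs) (\<phi> u)
      = (\<Sum>i<Suc k. (-1) ^ i * fd (B (map ?L (del_nth i vs))) (\<phi> u) (?L (vs ! i), 0))"
      unfolding coord_d_def by (rule sum.cong) (simp_all add: l del_nth_map)
    ultimately show ?thesis unfolding sum.distrib by linarith
  qed
  finally show ?thesis .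
qed

section \<open>Charts, tangent vectors and differentials\<close>

lemma smooth_atlas_chart:
  assumes "smooth_atlas A" "c \<in> A"
  shows "open (fst c)" "open (snd c ` fst c)" "continuous_on (fst c) (snd c)"
    "continuous_on (snd c ` fst c) (inv_chart c)"
    "x \<in> fst c \<Longrightarrow> inv_chart c (snd c x) = x"
    "u \<in> snd c ` fst c \<Longrightarrow> snd c (inv_chart c u) = u"
    "u \<in> snd c ` fst c \<Longrightarrow> inv_chart c u \<in> fst c"
  using assms unfolding smooth_atlas_def is_chart_def homeomorphism_def by auto

lemma smooth_atlas_finite_dim:
  fixes A :: "('a::{t2_space,second_countable_topology}, 'e::real_normed_vector) chart set"
  shows "smooth_atlas A \<Longrightarrow> finite_dim TYPE('e)"
  unfolding smooth_atlas_def by blast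

lemma chart_image_mem:
  assumes "smooth_atlas A" "c \<in> A"
  shows "u \<in> snd c ` (fst c \<inter> V) \<longleftrightarrow> u \<in> snd c ` fst c \<and> inv_chart c u \<in> V"
  using smooth_atlas_chart(5-7)[OF assms] by (auto 0 3 intro!: rev_image_eqI)

lemma chart_image_open:
  assumes "smooth_atlas A" "c \<in> A" "open V"
  shows "open (snd c ` (fst c \<inter> V))"
proof -
  have "snd c ` (fst c \<inter> V) = snd c ` fst c \<inter> inv_chart c -` V"
    using chart_image_mem[OF assms(1,2)] by blast
  then show ?thesis
    using smooth_atlas_chart(2,4)[OF assms(1,2)] assms(3) by (simp add: continuous_on_open_vimage Int_commute)
qed

lemma smooth_atlas_covers:
  assumes "smooth_atlas A"
  obtains c where "c \<in> A" "x \<in> fst c"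
  using assms unfolding smooth_atlas_def by (metis UN_iff UNIV_I)

lemma chart_at:
  assumes "smooth_atlas A"
  shows "chart_at A x \<in> A" "x \<in> fst (chart_at A x)"
  using smooth_atlas_covers[OF assms, of x] someI[of "\<lambda>c. c \<in> A \<and> x \<in> fst c"]
  unfolding chart_at_def by metis+

abbreviation coord_map :: "('a, 'e) chart \<Rightarrow> ('b, 'f) chart \<Rightarrow> ('a \<Rightarrow> 'b) \<Rightarrow> 'e \<Rightarrow> 'f" where
  "coord_map c d f \<equiv> snd d \<circ> f \<circ> inv_chart c"

abbreviation coord_dom :: "('a, 'e) chart \<Rightarrow> ('b, 'f) chart \<Rightarrow> ('a \<Rightarrow> 'b) \<Rightarrow> 'e set" where
  "coord_dom c d f \<equiv> snd c ` (fst c \<inter> f -` fst d)"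

lemma transition_eq_coord_map: "transition c d = coord_map c d id"
  by (simp add: transition_def)

lemma smooth_map_id: "smooth_atlas A \<Longrightarrow> smooth_map A A id"
  unfolding smooth_map_def smooth_atlas_def overlap_def transition_def
  by (auto intro: continuous_on_id)

lemma coord_dom_open:
  assumes "smooth_atlas A" "smooth_atlas A'" "smooth_map A A' f" "c \<in> A" "d \<in> A'"
  shows "open (coord_dom c d f)"
  using assms
  by (intro chart_image_open[OF assms(1,4)])
    (auto simp: smooth_map_def smooth_atlas_chart(1)[OF assms(2,5)] intro!: continuous_open_vimage
      continuous_on_interior)

lemma coord_dom_mem:
  assumes "smooth_atlas A" "c \<in> A" "x \<in> fst c" "f x \<in> fst d"
  shows "snd c x \<in> coord_dom c d f" "coord_map c d f (snd c x) = snd d (f x)"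
  using assms smooth_atlas_chart(5)[OF assms(1-3)] by auto

lemma coord_map_smooth:
  assumes "smooth_map A A' f" "c \<in> A" "d \<in> A'"
  shows "smooth_on (coord_dom c d f) (coord_map c d f)"
  using assms unfolding smooth_map_def by blast

lemma coord_map_differentiable:
  assumes "smooth_atlas A" "smooth_atlas A'" "smooth_map A A' f" "c \<in> A" "d \<in> A'"
    "x \<in> fst c" "f x \<in> fst d"
  shows "coord_map c d f differentiable (at (snd c x))"
  by (rule smooth_on_differentiable[OF coord_dom_open[OF assms(1-5)] coord_map_smooth[OF assms(3-5)]
        coord_dom_mem(1)[where x = x]]) (use assms in auto)

text \<open>With one of the maps equal to the identity this also yields the cocycle rule for
  transitions and the independence of \<open>differential\<close> from the chosen charts.\<close>

lemma coord_map_chain: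
  assumes A: "smooth_atlas A" "smooth_atlas A'" "smooth_atlas A''"
    and f: "smooth_map A A' f" and g: "smooth_map A' A'' g"
    and c: "c \<in> A" "x \<in> fst c" and d: "d \<in> A'" "f x \<in> fst d" and e: "e \<in> A''" "g (f x) \<in> fst e"
  shows "fd (coord_map c e (g \<circ> f)) (snd c x) v
    = fd (coord_map d e g) (snd d (f x)) (fd (coord_map c d f) (snd c x) v)"
proof -
  have "fd (coord_map c e (g \<circ> f)) (snd c x) = fd (\<lambda>u. coord_map d e g (coord_map c d f u)) (snd c x)"
  proof (rule fd_cong[OF coord_dom_open[OF A(1,2) f c(1) d(1)]])
    show "snd c x \<in> coord_dom c d f" using c d by auto
    show "coord_map c e (g \<circ> f) u = coord_map d e g (coord_map c d f u)" if "u \<in> coord_dom c d f" for u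
      using that smooth_atlas_chart(5)[OF A(2) d(1)] chart_image_mem[OF A(1) c(1)] by auto
  qed
  moreover have "coord_map d e g differentiable (at (coord_map c d f (snd c x)))"
    using coord_map_differentiable[OF A(2,3) g d(1) e(1) d(2) e(2)]
      coord_dom_mem(2)[where f = f, OF A(1) c d(2)] by simp
  ultimately show ?thesis
    using coord_map_differentiable[OF A(1,2) f c(1) d(1) c(2) d(2)]
      coord_dom_mem(2)[where f = f, OF A(1) c d(2)] by (simp only: fd_compose)
qed

lemma fd_transition_chain:
  assumes "smooth_atlas A" "c \<in> A" "x \<in> fst c" "d \<in> A" "x \<in> fst d" "e \<in> A" "x \<in> fst e"
  shows "fd (transition c e) (snd c x) v = fd (transition d e) (snd d x) (fd (transition c d) (snd c x) v)"
  using coord_map_chain[OF assms(1,1,1) smooth_map_id smooth_map_id, of c x d e v] assms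
  by (simp add: transition_eq_coord_map)

lemma transition_differentiable:
  assumes "smooth_atlas A" "c \<in> A" "x \<in> fst c" "d \<in> A" "x \<in> fst d"
  shows "transition c d differentiable (at (snd c x))"
  using coord_map_differentiable[OF assms(1,1) smooth_map_id, of c d x] assms
  by (simp add: transition_eq_coord_map)

lemma fd_transition_self:
  assumes "smooth_atlas A" "c \<in> A" "x \<in> fst c"
  shows "fd (transition c c) (snd c x) v = v"
proof -
  have "fd (transition c c) (snd c x) = fd (\<lambda>u. u) (snd c x)"
    by (rule fd_cong[OF smooth_atlas_chart(2)[OF assms(1,2)]])
      (use assms smooth_atlas_chart(6)[OF assms(1,2)] in \<open>auto simp: transition_def\<close>)
  then show ?thesis by (simp add: fd_eq[OF has_derivative_ident])
qed

lemma tvec_of_chart: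
  assumes "smooth_atlas A" "c \<in> A" "x \<in> fst c"
  shows "tvec_of A c x v c = v"
  using fd_transition_self[OF assms] assms by (simp add: tvec_of_def)

lemma tangent_spaceI:
  assumes "\<And>c. \<not> (c \<in> A \<and> x \<in> fst c) \<Longrightarrow> X c = 0"
    and "\<And>c d. c \<in> A \<Longrightarrow> x \<in> fst c \<Longrightarrow> d \<in> A \<Longrightarrow> x \<in> fst d \<Longrightarrow>
      X d = fd (transition c d) (snd c x) (X c)"
  shows "X \<in> tangent_space A x"
  unfolding tangent_space_def
  by (intro CollectI conjI allI ballI impI; (elim conjE)?) (rule assms; assumption)+

lemma tangent_space_transition:
  assumes "X \<in> tangent_space A x" "c \<in> A" "x \<in> fst c" "d \<in> A" "x \<in> fst d"
  shows "X d = fd (transition c d) (snd c x) (X c)"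
  using assms unfolding tangent_space_def by blast

lemma tangent_space_outside:
  assumes "X \<in> tangent_space A x" "\<not> (c \<in> A \<and> x \<in> fst c)"
  shows "X c = 0"
  using assms unfolding tangent_space_def by blast

lemma tvec_of_tangent:
  assumes "smooth_atlas A" "c \<in> A" "x \<in> fst c"
  shows "tvec_of A c x v \<in> tangent_space A x"
proof (rule tangent_spaceI)
  show "tvec_of A c x v d = 0" if "\<not> (d \<in> A \<and> x \<in> fst d)" for d
    using that by (auto simp: tvec_of_def)
  show "tvec_of A c x v e = fd (transition d e) (snd d x) (tvec_of A c x v d)"
    if "d \<in> A" "x \<in> fst d" "e \<in> A" "x \<in> fst e" for d e
    using fd_transition_chain[OF assms that, of v] that by (simp add: tvec_of_def)
qed

lemma tangent_eq_tvec_of: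
  assumes "X \<in> tangent_space A x" "c \<in> A" "x \<in> fst c"
  shows "X = tvec_of A c x (X c)"
proof
  fix d show "X d = tvec_of A c x (X c) d"
    using tangent_space_transition[OF assms, of d] tangent_space_outside[OF assms(1), of d]
    by (cases "d \<in> A \<and> x \<in> fst d") (auto simp: tvec_of_def)
qed

lemma tangent_space_lincomb:
  assumes A: "smooth_atlas A" and X: "X \<in> tangent_space A x" and Y: "Y \<in> tangent_space A x"
  shows "(\<lambda>c. r *\<^sub>R X c + s *\<^sub>R Y c) \<in> tangent_space A x"
proof (rule tangent_spaceI)
  show "r *\<^sub>R X c + s *\<^sub>R Y c = 0" if "\<not> (c \<in> A \<and> x \<in> fst c)" for c
    using tangent_space_outside[OF X that] tangent_space_outside[OF Y that] by simp
  fix c d assume c: "c \<in> A" "x \<in> fst c" and d: "d \<in> A" "x \<in> fst d"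
  show "r *\<^sub>R X d + s *\<^sub>R Y d = fd (transition c d) (snd c x) (r *\<^sub>R X c + s *\<^sub>R Y c)"
    unfolding tangent_space_transition[OF X c d] tangent_space_transition[OF Y c d]
    using linear_fd[OF transition_differentiable[OF A c d]] by (simp add: linear_add linear_scale)
qed

lemma leaf_tangent_space_lincomb:
  assumes A: "smooth_atlas A" and "X \<in> leaf_tangent_space A x" "Y \<in> leaf_tangent_space A x"
  shows "(\<lambda>c. r *\<^sub>R X c + s *\<^sub>R Y c) \<in> leaf_tangent_space A x"
  using assms(2,3) tangent_space_lincomb[OF A] by (auto simp: leaf_tangent_space_def)

lemma tvec_of_lincomb:
  assumes A: "smooth_atlas A" "c \<in> A" "x \<in> fst c"
  shows "tvec_of A c x (r *\<^sub>R v + s *\<^sub>R w) = (\<lambda>d. r *\<^sub>R tvec_of A c x v d + s *\<^sub>R tvec_of A c x w d)"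
  using linear_fd[OF transition_differentiable[OF A]]
  by (auto simp: tvec_of_def linear_add linear_scale)

lemma differential_tangent:
  assumes A: "smooth_atlas A" "smooth_atlas A'" and f: "smooth_map A A' f"
    and X: "X \<in> tangent_space A x" and c: "c \<in> A" "x \<in> fst c" and d: "d \<in> A'" "f x \<in> fst d"
  shows "differential A A' f x X d = fd (coord_map c d f) (snd c x) (X c)"
proof -
  note c0 = chart_at[OF A(1), of x]
  have "X (chart_at A x) = fd (transition c (chart_at A x)) (snd c x) (X c)"
    using tangent_space_transition[OF X c c0] .
  then show ?thesis
    using coord_map_chain[OF A(1,1,2) smooth_map_id[OF A(1)] f c, of "chart_at A x" d "X c"] c0 d
    by (simp add: differential_def transition_eq_coord_map Let_def)
qed

lemma differential_eq_tvec_of: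
  assumes A: "smooth_atlas A" "smooth_atlas A'" and f: "smooth_map A A' f"
    and X: "X \<in> tangent_space A x" and c: "c \<in> A" "x \<in> fst c" and d: "d \<in> A'" "f x \<in> fst d"
  shows "differential A A' f x X = tvec_of A' d (f x) (fd (coord_map c d f) (snd c x) (X c))"
proof
  fix e
  show "differential A A' f x X e = tvec_of A' d (f x) (fd (coord_map c d f) (snd c x) (X c)) e"
  proof (cases "e \<in> A' \<and> f x \<in> fst e")
    case True
    then show ?thesis
      using differential_tangent[OF A f X c, of e] d
        coord_map_chain[OF A(1,2,2) f smooth_map_id[OF A(2)] c d, of e "X c"]
      by (simp add: tvec_of_def transition_eq_coord_map)
  qed (auto simp: differential_def tvec_of_def)
qed

lemma differential_in_tangent_space:
  assumes A: "smooth_atlas A" "smooth_atlas A'" and f: "smooth_map A A' f"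
    and X: "X \<in> tangent_space A x"
  shows "differential A A' f x X \<in> tangent_space A' (f x)"
proof -
  obtain c where c: "c \<in> A" "x \<in> fst c" using smooth_atlas_covers[OF A(1)] .
  obtain d where d: "d \<in> A'" "f x \<in> fst d" using smooth_atlas_covers[OF A(2)] .
  show ?thesis
    unfolding differential_eq_tvec_of[OF A f X c d] by (rule tvec_of_tangent[OF A(2) d])
qed

lemma differential_compose:
  assumes A: "smooth_atlas A" "smooth_atlas A'" "smooth_atlas A''"
    and f: "smooth_map A A' f" and g: "smooth_map A' A'' g" and gf: "smooth_map A A'' (g \<circ> f)"
    and X: "X \<in> tangent_space A x"
  shows "differential A A'' (g \<circ> f) x X = differential A' A'' g (f x) (differential A A' f x X)"
proof -
  obtain c where c: "c \<in> A" "x \<in> fst c" using smooth_atlas_covers[OF A(1)] .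
  obtain d where d: "d \<in> A'" "f x \<in> fst d" using smooth_atlas_covers[OF A(2)] .
  obtain e where e: "e \<in> A''" "(g \<circ> f) x \<in> fst e" using smooth_atlas_covers[OF A(3)] .
  have e': "g (f x) \<in> fst e" using e by simp
  note dX = differential_in_tangent_space[OF A(1,2) f X]
  show ?thesis
    unfolding differential_eq_tvec_of[OF A(1,3) gf X c e] differential_eq_tvec_of[OF A(2,3) g dX d e(1) e']
      differential_tangent[OF A(1,2) f X c d] coord_map_chain[OF A f g c d e(1) e'] by simp
qed

lemma differential_id:
  assumes A: "smooth_atlas A" and X: "X \<in> tangent_space A x"
  shows "differential A A id x X = X"
proof -
  obtain c where c: "c \<in> A" "x \<in> fst c" using smooth_atlas_covers[OF A] .
  then show ?thesis
    using differential_eq_tvec_of[OF A A smooth_map_id[OF A] X c, of c] tangent_eq_tvec_of[OF X c]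
      fd_transition_self[OF A c] by (simp add: transition_eq_coord_map)
qed

lemma differential_lincomb:
  assumes A: "smooth_atlas A" "smooth_atlas A'" and f: "smooth_map A A' f"
  shows "differential A A' f x (\<lambda>c. r *\<^sub>R X c + s *\<^sub>R Y c)
    = (\<lambda>d. r *\<^sub>R differential A A' f x X d + s *\<^sub>R differential A A' f x Y d)"
proof
  fix d
  show "differential A A' f x (\<lambda>c. r *\<^sub>R X c + s *\<^sub>R Y c) d
    = r *\<^sub>R differential A A' f x X d + s *\<^sub>R differential A A' f x Y d"
  proof (cases "d \<in> A' \<and> f x \<in> fst d")
    case True
    then have "linear (fd (coord_map (chart_at A x) d f) (snd (chart_at A x) x))"
      by (intro linear_fd coord_map_differentiable[OF A f] chart_at[OF A(1)]) auto
    with True show ?thesis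
      by (simp add: differential_def Let_def linear_add linear_scale)
  qed (auto simp: differential_def)
qed

subsection \<open>Vectors tangent to the leaves\<close>

lemma foliated_atlas_smooth: "foliated_atlas A \<Longrightarrow> smooth_atlas A"
  unfolding foliated_atlas_def by blast

lemma fd_zero_along:
  assumes "f differentiable (at u)" "\<forall>\<^sub>F s in nhds (0::real). f (u + s *\<^sub>R v) = a"
  shows "fd f u v = 0"
proof -
  have 1: "((\<lambda>s. f (u + s *\<^sub>R v)) has_vector_derivative fd f u v) (at 0)"
    using has_derivative_line[of f u 0 v] assms(1) by simp
  obtain S where S: "open S" "0 \<in> S" "\<And>s. s \<in> S \<Longrightarrow> f (u + s *\<^sub>R v) = a"
    using assms(2) unfolding eventually_nhds by blast
  have "((\<lambda>s. a) has_vector_derivative fd f u v) (at 0)"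
    by (rule has_vector_derivative_transform_within_open[OF 1 S(1,2)]) (use S(3) in auto)
  then show ?thesis using vector_derivative_unique_at has_vector_derivative_const by blast
qed

lemma eventually_line_mem:
  fixes v :: "'e::real_normed_vector"
  assumes "open V" "u \<in> V"
  shows "\<forall>\<^sub>F s in nhds (0::real). u + s *\<^sub>R v \<in> V"
proof -
  have "open ((\<lambda>s. u + s *\<^sub>R v) -` V)" by (intro open_vimage assms continuous_intros)
  then have "\<forall>\<^sub>F s in nhds 0. s \<in> (\<lambda>s. u + s *\<^sub>R v) -` V"
    by (rule eventually_nhds_in_open) (use assms in simp)
  then show ?thesis by simp
qed

text \<open>Near the point the transverse part of a transition is a function of the transverse
  coordinate alone, hence constant along a line in direction \<open>(v, 0)\<close>.\<close>

lemma snd_fd_transition: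
  assumes A: "foliated_atlas A" and c: "c \<in> A" "x \<in> fst c" and d: "d \<in> A" "x \<in> fst d"
  shows "snd (fd (transition c d) (snd c x) (v, 0)) = 0"
proof -
  note sm = foliated_atlas_smooth[OF A]
  have "snd c x \<in> overlap c d" using c d by (auto simp: overlap_def)
  then obtain V g where V: "open V" "snd c x \<in> V" "\<forall>w\<in>V. snd (transition c d w) = g (snd w)"
    using A c d unfolding foliated_atlas_def by blast
  note dt = transition_differentiable[OF sm c d]
  have "\<forall>\<^sub>F s in nhds 0. snd (transition c d (snd c x + s *\<^sub>R (v, 0))) = g (snd (snd c x))"
    using eventually_line_mem[OF V(1,2), of "(v, 0)"] by eventually_elim (use V(3) in simp)
  then have "fd (\<lambda>u. snd (transition c d u)) (snd c x) (v, 0) = 0"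
    by (rule fd_zero_along[rotated])
      (use bounded_linear.has_derivative[OF bounded_linear_snd has_derivative_fd[OF dt]] in \<open>auto simp: differentiable_def\<close>)
  then show ?thesis by (simp add: fd_bounded_linear_compose[OF bounded_linear_snd dt])
qed

lemma tvec_of_leaf_tangent:
  assumes A: "foliated_atlas A" and c: "c \<in> A" "x \<in> fst c"
  shows "tvec_of A c x (v, 0) \<in> leaf_tangent_space A x"
  using tvec_of_tangent[OF foliated_atlas_smooth[OF A] c] snd_fd_transition[OF A c]
  by (auto simp: leaf_tangent_space_def tvec_of_def)

lemma leaf_tangent_tangent: "X \<in> leaf_tangent_space A x \<Longrightarrow> X \<in> tangent_space A x"
  by (simp add: leaf_tangent_space_def)

lemma leaf_tangent_eq:
  assumes "X \<in> leaf_tangent_space A x" "c \<in> A" "x \<in> fst c"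
  shows "X c = (fst (X c), 0)" "X = tvec_of A c x (fst (X c), 0)"
proof -
  show 1: "X c = (fst (X c), 0)" using assms by (simp add: leaf_tangent_space_def prod_eq_iff)
  show "X = tvec_of A c x (fst (X c), 0)"
    using tangent_eq_tvec_of[OF leaf_tangent_tangent[OF assms(1)] assms(2,3)] 1 by simp
qed

text \<open>The infinitesimal counterpart of \<open>foliated_map\<close>, and exactly what the
  pullback of leafwise forms requires. For the inclusions of time slices it can be read off from
  coordinates, without any argument on leaves.\<close>

definition tangential ::
  "('a::topological_space, 'p::real_normed_vector \<times> 'q::real_normed_vector) chart set \<Rightarrow>
   ('b::topological_space, 'r::real_normed_vector \<times> 's::real_normed_vector) chart set \<Rightarrow>
   ('a \<Rightarrow> 'b) \<Rightarrow> bool" where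
  "tangential A A' f \<longleftrightarrow> smooth_map A A' f \<and>
     (\<forall>x. \<forall>X\<in>leaf_tangent_space A x. differential A A' f x X \<in> leaf_tangent_space A' (f x))"

lemma tangential_smooth: "tangential A A' f \<Longrightarrow> smooth_map A A' f"
  unfolding tangential_def by blast

lemma tangential_id: "foliated_atlas A \<Longrightarrow> tangential A A id"
  unfolding tangential_def
  using foliated_atlas_smooth[of A] smooth_map_id[of A] differential_id[of A] leaf_tangent_tangent
  by fastforce

lemma tangential_snd_zero:
  assumes A: "foliated_atlas A" "foliated_atlas A'" and f: "tangential A A' f"
    and c: "c \<in> A" "x \<in> fst c" and d: "d \<in> A'" "f x \<in> fst d"
  shows "snd (fd (coord_map c d f) (snd c x) (v, 0)) = 0"
proof -
  note sm = foliated_atlas_smooth[OF A(1)] foliated_atlas_smooth[OF A(2)]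
  note X = tvec_of_leaf_tangent[OF A(1) c, of v]
  have "differential A A' f x (tvec_of A c x (v, 0)) \<in> leaf_tangent_space A' (f x)"
    using f X unfolding tangential_def by blast
  then have "snd (differential A A' f x (tvec_of A c x (v, 0)) d) = 0"
    using d unfolding leaf_tangent_space_def by blast
  then show ?thesis
    using differential_tangent[OF sm tangential_smooth[OF f] leaf_tangent_tangent[OF X] c d]
    by (simp add: tvec_of_chart[OF sm(1) c])
qed

lemma differential_tvec_of:
  assumes A: "foliated_atlas A" "foliated_atlas A'" and f: "tangential A A' f"
    and c: "c \<in> A" "x \<in> fst c" and d: "d \<in> A'" "f x \<in> fst d"
  shows "differential A A' f x (tvec_of A c x (v, 0))
    = tvec_of A' d (f x) (fst (fd (coord_map c d f) (snd c x) (v, 0)), 0)"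
proof -
  note sm = foliated_atlas_smooth[OF A(1)] foliated_atlas_smooth[OF A(2)]
  have "fd (coord_map c d f) (snd c x) (v, 0) = (fst (fd (coord_map c d f) (snd c x) (v, 0)), 0)"
    using tangential_snd_zero[OF A f c d] by (simp add: prod_eq_iff)
  then show ?thesis
    using differential_eq_tvec_of[OF sm tangential_smooth[OF f] tvec_of_tangent[OF sm(1) c] c d]
    by (simp add: tvec_of_chart[OF sm(1) c])
qed

text \<open>One pair of charts at each point suffices: the image vector is determined by its
  coordinates in one chart, and transitions preserve vectors with vanishing transverse part.\<close>

lemma tangentialI:
  assumes A: "foliated_atlas A" "foliated_atlas A'" and f: "smooth_map A A' f"
    and 0: "\<And>x. \<exists>c\<in>A. \<exists>d\<in>A'. x \<in> fst c \<and> f x \<in> fst d \<and> (\<forall>v. snd (fd (coord_map c d f) (snd c x) (v, 0)) = 0)"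
  shows "tangential A A' f"
  unfolding tangential_def
proof (intro conjI allI ballI f)
  fix x X assume X: "X \<in> leaf_tangent_space A x"
  note sm = foliated_atlas_smooth[OF A(1)] foliated_atlas_smooth[OF A(2)]
  obtain c d where c: "c \<in> A" "x \<in> fst c" and d: "d \<in> A'" "f x \<in> fst d"
    and z: "\<And>v. snd (fd (coord_map c d f) (snd c x) (v, 0)) = 0" using 0 by blast
  have "snd (fd (coord_map c d f) (snd c x) (X c)) = 0"
    using z leaf_tangent_eq(1)[OF X c] by metis
  then have "fd (coord_map c d f) (snd c x) (X c) = (fst (fd (coord_map c d f) (snd c x) (X c)), 0)"
    by (simp add: prod_eq_iff)
  then show "differential A A' f x X \<in> leaf_tangent_space A' (f x)"
    using differential_eq_tvec_of[OF sm f leaf_tangent_tangent[OF X] c d] tvec_of_leaf_tangent[OF A(2) d]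
    by metis
qed

section \<open>Leafwise forms\<close>

lemma leaf_form_at_zero:
  "leaf_form_at A k x a \<Longrightarrow> \<not> (length Xs = k \<and> set Xs \<subseteq> leaf_tangent_space A x) \<Longrightarrow> a Xs = 0"
  unfolding leaf_form_at_def by blast

lemma leaf_form_at_linear:
  assumes "leaf_form_at A k x a" "length Xs = k" "set Xs \<subseteq> leaf_tangent_space A x"
    "i < k" "Y \<in> leaf_tangent_space A x" "Z \<in> leaf_tangent_space A x"
  shows "a (Xs[i := (\<lambda>c. r *\<^sub>R Y c + s *\<^sub>R Z c)]) = r * a (Xs[i := Y]) + s * a (Xs[i := Z])"
  using assms unfolding leaf_form_at_def by blast

lemma leaf_form_at_alternating:
  assumes "leaf_form_at A k x a" "length Xs = k" "set Xs \<subseteq> leaf_tangent_space A x"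
    "i < j" "j < k" "Xs ! i = Xs ! j"
  shows "a Xs = 0"
  using assms unfolding leaf_form_at_def by blast

lemma leaf_formsD:
  assumes "\<alpha> \<in> leaf_forms A k"
  shows "leaf_form_at A k x (\<alpha> x)"
    "c \<in> A \<Longrightarrow> length vs = k \<Longrightarrow> smooth_on (snd c ` fst c) (form_in_chart A \<alpha> c vs)"
  using assms unfolding leaf_forms_def by blast+

lemma leaf_forms_zero:
  assumes "\<alpha> \<in> leaf_forms A k" "\<not> (length Xs = k \<and> set Xs \<subseteq> leaf_tangent_space A x)"
  shows "\<alpha> x Xs = 0"
  using leaf_form_at_zero[OF leaf_formsD(1)[OF assms(1)] assms(2)] .

text \<open>Forms are normalized to vanish on such lists; thanks to this, smoothness in charts can
  be used for lists of any length.\<close>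

lemma form_in_chart_wrong_length:
  "\<alpha> \<in> leaf_forms A k \<Longrightarrow> length vs \<noteq> k \<Longrightarrow> form_in_chart A \<alpha> c vs = (\<lambda>u. 0)"
  unfolding form_in_chart_def by (intro ext leaf_forms_zero) auto

lemma form_in_chart_smooth:
  assumes "\<alpha> \<in> leaf_forms A k" "c \<in> A"
  shows "smooth_on (snd c ` fst c) (form_in_chart A \<alpha> c vs)"
  using leaf_formsD(2)[OF assms, of vs] form_in_chart_wrong_length[OF assms(1), of vs c]
  by (cases "length vs = k") (auto simp: smooth_on_const)

lemma form_in_chart_differentiable:
  assumes "smooth_atlas A" "\<alpha> \<in> leaf_forms A k" "c \<in> A" "x \<in> fst c"
  shows "form_in_chart A \<alpha> c vs differentiable (at (snd c x))"
  using smooth_on_differentiable[OF smooth_atlas_chart(2)[OF assms(1,3)] form_in_chart_smooth[OF assms(2,3)]]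
    assms(4) by blast

lemma form_in_chart_multilinear:
  fixes A :: "('a::{t2_space,second_countable_topology}, 'p::real_normed_vector \<times> 'q::real_normed_vector) chart set"
  assumes A: "foliated_atlas A" "c \<in> A" "u \<in> snd c ` fst c" and \<alpha>: "\<alpha> \<in> leaf_forms A k"
  shows "multilinear k (\<lambda>vs. form_in_chart A \<alpha> c vs u)" "alternating k (\<lambda>vs. form_in_chart A \<alpha> c vs u)"
proof -
  define x where "x = inv_chart c u"
  note sm = foliated_atlas_smooth[OF A(1)]
  have x: "x \<in> fst c" "snd c x = u" unfolding x_def using smooth_atlas_chart[OF sm A(2)] A(3) by auto
  define T where "T = (\<lambda>v. tvec_of A c x (v, 0))"
  have T: "T v \<in> leaf_tangent_space A x" for v
    unfolding T_def by (rule tvec_of_leaf_tangent[OF A(1,2) x(1)])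
  have T': "set (map T vs) \<subseteq> leaf_tangent_space A x" for vs using T by auto
  have lin: "T (r *\<^sub>R v + s *\<^sub>R w) = (\<lambda>d. r *\<^sub>R T v d + s *\<^sub>R T w d)" for r s v w
    unfolding T_def using tvec_of_lincomb[OF sm A(2) x(1), of r "(v, 0)" s "(w, 0)"] by simp
  have f: "form_in_chart A \<alpha> c vs u = \<alpha> x (map T vs)" for vs
    by (simp add: form_in_chart_def x_def T_def)
  note at = leaf_formsD(1)[OF \<alpha>, of x]
  show "multilinear k (\<lambda>vs. form_in_chart A \<alpha> c vs u)"
    unfolding multilinear_def f
  proof (intro allI impI)
    fix xs zs :: "'p list" assume l: "length xs + length zs + 1 = k"
    have *: "\<alpha> x (map T (xs @ (r *\<^sub>R v + s *\<^sub>R w) # zs))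
      = r * \<alpha> x (map T (xs @ v # zs)) + s * \<alpha> x (map T (xs @ w # zs))" for r s v w
      using leaf_form_at_linear[OF at _ T' _ T T, of "xs @ v # zs" "length xs" r v s w] l
      by (simp add: lin list_update_append)
    show "linear (\<lambda>y. \<alpha> x (map T (xs @ y # zs)))"
      using *[of 1 _ 1] *[of _ _ 0 0] by (intro linearI) auto
  qed
  show "alternating k (\<lambda>vs. form_in_chart A \<alpha> c vs u)"
    unfolding alternating_def f
  proof (intro allI impI)
    fix xs ys zs :: "'p list" and y assume l: "length xs + length ys + length zs + 2 = k"
    show "\<alpha> x (map T (xs @ y # ys @ y # zs)) = 0"
      by (rule leaf_form_at_alternating[OF at _ T', where i = "length xs" and j = "Suc (length xs + length ys)"])
        (use l in \<open>auto simp: nth_append\<close>)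
  qed
qed

lemma map_tvec_of:
  assumes "set Xs \<subseteq> leaf_tangent_space A x" "c \<in> A" "x \<in> fst c"
  shows "map (\<lambda>v. tvec_of A c x (v, 0)) (map (\<lambda>X. fst (X c)) Xs) = Xs"
  using assms by (induction Xs) (auto simp: leaf_tangent_eq(2)[symmetric])

lemma form_eq_form_in_chart:
  assumes "smooth_atlas A" "set Xs \<subseteq> leaf_tangent_space A x" "c \<in> A" "x \<in> fst c"
  shows "form_in_chart A \<alpha> c (map (\<lambda>X. fst (X c)) Xs) (snd c x) = \<alpha> x Xs"
  unfolding form_in_chart_def smooth_atlas_chart(5)[OF assms(1,3,4)] map_tvec_of[OF assms(2-4)] ..

subsection \<open>Pullback\<close>

text \<open>By tangency the image of a constant leafwise vector is determined by its first
  component. The resulting formula has the shape that \<open>coord_d_pullback\<close>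
  expects.\<close>

lemma pullback_in_chart:
  assumes A: "foliated_atlas A" "foliated_atlas A'" and f: "tangential A A' f"
    and c: "c \<in> A" and d: "d \<in> A'" and u: "u \<in> coord_dom c d f"
  shows "form_in_chart A (pullback A A' f \<alpha>) c vs u
    = form_in_chart A' \<alpha> d (map (\<lambda>v. fst (fd (coord_map c d f) u (v, 0))) vs) (coord_map c d f u)"
proof -
  note sm = foliated_atlas_smooth[OF A(1)] foliated_atlas_smooth[OF A(2)]
  define x where "x = inv_chart c u"
  have x: "x \<in> fst c" "f x \<in> fst d" "snd c x = u"
    using u smooth_atlas_chart(5)[OF sm(1) c] unfolding x_def by auto
  have 1: "inv_chart d (coord_map c d f u) = f x"
    using smooth_atlas_chart(5)[OF sm(2) d x(2)] by (simp add: x_def)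
  have 2: "set (map (\<lambda>v. tvec_of A c x (v, 0)) vs) \<subseteq> leaf_tangent_space A x"
    using tvec_of_leaf_tangent[OF A(1) c x(1)] by auto
  show ?thesis
    unfolding form_in_chart_def 1 x_def[symmetric]
    using 2 differential_tvec_of[OF A f c x(1) d x(2)]
    by (simp add: pullback_def o_def x(3))
qed

lemma pullback_leaf_forms:
  fixes A :: "('a::{t2_space,second_countable_topology}, 'p::real_normed_vector \<times> 'q::real_normed_vector) chart set"
  assumes A: "foliated_atlas A" "foliated_atlas A'" and f: "tangential A A' f"
    and \<alpha>: "\<alpha> \<in> leaf_forms A' k"
  shows "pullback A A' f \<alpha> \<in> leaf_forms A k"
  unfolding leaf_forms_def
proof (intro CollectI conjI allI ballI impI)
  note sm = foliated_atlas_smooth[OF A(1)] foliated_atlas_smooth[OF A(2)]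
  note fs = tangential_smooth[OF f]
  fix x
  note at = leaf_formsD(1)[OF \<alpha>, of "f x"]
  let ?D = "differential A A' f x"
  let ?T = "leaf_tangent_space A x"
  have D: "?D X \<in> leaf_tangent_space A' (f x)" if "X \<in> ?T" for X
    using f that unfolding tangential_def by blast
  have D': "set (map ?D Xs) \<subseteq> leaf_tangent_space A' (f x)" if "set Xs \<subseteq> ?T" for Xs
    using D that by auto
  have upd: "set (Xs[i := Y]) \<subseteq> ?T" if "set Xs \<subseteq> ?T" "Y \<in> ?T" for Xs i Y
    using set_update_subset_insert[of Xs i Y] that by blast
  show "leaf_form_at A k x (pullback A A' f \<alpha> x)"
    unfolding leaf_form_at_def
  proof (intro conjI allI impI ballI; (elim conjE)?)
    fix Xs assume "\<not> (length Xs = k \<and> set Xs \<subseteq> ?T)"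
    then show "pullback A A' f \<alpha> x Xs = 0"
      using leaf_form_at_zero[OF at, of "map ?D Xs"] by (auto simp: pullback_def)
  next
    fix Xs i Y Z and r s :: real
    assume X: "length Xs = k" "set Xs \<subseteq> ?T" "i < k" and Y: "Y \<in> ?T" and Z: "Z \<in> ?T"
    show "pullback A A' f \<alpha> x (Xs[i := \<lambda>c. r *\<^sub>R Y c + s *\<^sub>R Z c])
      = r * pullback A A' f \<alpha> x (Xs[i := Y]) + s * pullback A A' f \<alpha> x (Xs[i := Z])"
      using leaf_form_at_linear[OF at _ D'[OF X(2)] X(3) D[OF Y] D[OF Z], of r s] X
        upd[OF X(2) Y, of i] upd[OF X(2) Z, of i] upd[OF X(2) leaf_tangent_space_lincomb[OF sm(1) Y Z], of i r s]
      by (simp add: pullback_def map_update differential_lincomb[OF sm fs])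
  next
    fix Xs i j assume X: "length Xs = k" "set Xs \<subseteq> ?T" "j < k" "i < j" "Xs ! i = Xs ! j"
    then show "pullback A A' f \<alpha> x Xs = 0"
      using leaf_form_at_alternating[OF at _ D'[OF X(2)] X(4,3)] by (simp add: pullback_def)
  qed
next
  note sm = foliated_atlas_smooth[OF A(1)] foliated_atlas_smooth[OF A(2)]
  note fs = tangential_smooth[OF f]
  fix c and vs :: "'p list" assume c: "c \<in> A" and l: "length vs = k"
  show "smooth_on (snd c ` fst c) (form_in_chart A (pullback A A' f \<alpha>) c vs)"
  proof (rule smooth_on_local)
    fix u assume u: "u \<in> snd c ` fst c"
    obtain d where d: "d \<in> A'" "f (inv_chart c u) \<in> fst d" using smooth_atlas_covers[OF sm(2)] .
    let ?W = "coord_dom c d f"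
    note W = coord_dom_open[OF sm fs c d(1)]
    note \<phi> = coord_map_smooth[OF fs c d(1)]
    have uW: "u \<in> ?W" using chart_image_mem[OF sm(1) c] u d by auto
    have img: "coord_map c d f y \<in> snd d ` fst d" if "y \<in> ?W" for y
      using that chart_image_mem[OF sm(1) c] by auto
    \<comment> \<open>The images of constant fields vary with the point, so smoothness of
      \<open>\<alpha>\<close> on constant lists is not enough and
      \<open>smooth_on_multilinear\<close> is called for.\<close>
    let ?ws = "map (\<lambda>v y. fst (fd (coord_map c d f) y (v, 0))) vs"
    have "smooth_on ?W (\<lambda>y. form_in_chart A' \<alpha> d (map (\<lambda>w. w y) ?ws) (coord_map c d f y))"
    proof (rule smooth_on_multilinear[OF finite_dim_fst[OF smooth_atlas_finite_dim[OF sm(2)]] W,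
          where B = "\<lambda>vs y. form_in_chart A' \<alpha> d vs (coord_map c d f y)"])
      show "smooth_on ?W (\<lambda>y. form_in_chart A' \<alpha> d us (coord_map c d f y))" for us
        by (rule smooth_on_compose[OF smooth_atlas_finite_dim[OF sm(2)] W \<phi> img form_in_chart_smooth[OF \<alpha> d(1)]])
      show "multilinear (length ?ws) (\<lambda>vs. form_in_chart A' \<alpha> d vs (coord_map c d f y))" if "y \<in> ?W" for y
        using form_in_chart_multilinear(1)[OF A(2) d(1) img[OF that] \<alpha>] l by simp
      show "smooth_on ?W w" if "w \<in> set ?ws" for w
        using that W \<phi> by (auto intro!: smooth_on_fst smooth_on_fd)
    qed
    then have "smooth_on ?W (form_in_chart A (pullback A A' f \<alpha>) c vs)"
      by (rule smooth_on_cong) (simp add: pullback_in_chart[OF A f c d(1)] o_def)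
    then have "smooth_on (snd c ` fst c \<inter> ?W) (form_in_chart A (pullback A A' f \<alpha>) c vs)"
      by (rule smooth_on_subset) auto
    then show "\<exists>W. open W \<and> u \<in> W \<and> smooth_on (snd c ` fst c \<inter> W) (form_in_chart A (pullback A A' f \<alpha>) c vs)"
      using W uW by blast
  qed
qed

lemma coord_d_wrong_length:
  assumes "\<alpha> \<in> leaf_forms A k" "length vs \<noteq> Suc k"
  shows "coord_d (form_in_chart A \<alpha> c) vs u = 0"
  unfolding coord_d_def
proof (intro sum.neutral ballI)
  fix i assume "i \<in> {..<length vs}"
  then have "length (del_nth i vs) \<noteq> k" using assms(2) by (simp add: length_del_nth)
  then show "(-1) ^ i * fd (form_in_chart A \<alpha> c (del_nth i vs)) u (vs ! i, 0) = 0"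
    using form_in_chart_wrong_length[OF assms(1)] by simp
qed

lemma coord_d_pullback_form:
  assumes A: "foliated_atlas A" "foliated_atlas A'" and f: "tangential A A' f"
    and \<alpha>: "\<alpha> \<in> leaf_forms A' k"
    and c: "c \<in> A" "x \<in> fst c" and d: "d \<in> A'" "f x \<in> fst d"
  shows "coord_d (form_in_chart A (pullback A A' f \<alpha>) c) vs (snd c x)
    = coord_d (form_in_chart A' \<alpha> d) (map (\<lambda>v. fst (fd (coord_map c d f) (snd c x) (v, 0))) vs) (snd d (f x))"
proof (cases "length vs = Suc k")
  case True
  note sm = foliated_atlas_smooth[OF A(1)] foliated_atlas_smooth[OF A(2)]
  note fs = tangential_smooth[OF f]
  let ?W = "coord_dom c d f"
  have img: "coord_map c d f y \<in> snd d ` fst d" if "y \<in> ?W" for y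
    using that chart_image_mem[OF sm(1) c(1)] by auto
  have x: "snd c x \<in> ?W" "coord_map c d f (snd c x) = snd d (f x)"
    using coord_dom_mem[where f = f, OF sm(1) c d(2)] by blast+
  have "coord_d (form_in_chart A (pullback A A' f \<alpha>) c) vs (snd c x)
    = coord_d (form_in_chart A' \<alpha> d) (map (\<lambda>v. fst (fd (coord_map c d f) (snd c x) (v, 0))) vs)
        (coord_map c d f (snd c x))"
  proof (rule coord_d_pullback[OF smooth_atlas_finite_dim[OF sm(2)] coord_dom_open[OF sm fs c(1) d(1)] x(1)
        coord_map_smooth[OF fs c(1) d(1)] img smooth_atlas_chart(2)[OF sm(2) d(1)] _ _ _ _ True])
    show "smooth_on (snd d ` fst d) (form_in_chart A' \<alpha> d vs)" for vs
      by (rule form_in_chart_smooth[OF \<alpha> d(1)])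
    show "multilinear k (\<lambda>vs. form_in_chart A' \<alpha> d vs y)" if "y \<in> snd d ` fst d" for y
      by (rule form_in_chart_multilinear(1)[OF A(2) d(1) that \<alpha>])
    show "alternating k (\<lambda>vs. form_in_chart A' \<alpha> d vs (coord_map c d f (snd c x)))"
      by (rule form_in_chart_multilinear(2)[OF A(2) d(1) img[OF x(1)] \<alpha>])
    show "snd (fd (coord_map c d f) (snd c x) (v, 0)) = 0" for v
      by (rule tangential_snd_zero[OF A f c d])
    show "form_in_chart A (pullback A A' f \<alpha>) c vs y
      = form_in_chart A' \<alpha> d (map (\<lambda>v. fst (fd (coord_map c d f) y (v, 0))) vs) (coord_map c d f y)"
      if "y \<in> ?W" for y vs by (rule pullback_in_chart[OF A f c(1) d(1) that])
  qed
  then show ?thesis using x(2) by simp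
next
  case False
  then show ?thesis
    using coord_d_wrong_length[OF pullback_leaf_forms[OF A f \<alpha>]] coord_d_wrong_length[OF \<alpha>] by simp
qed

lemma pullback_id:
  assumes A: "foliated_atlas A" and \<alpha>: "\<alpha> \<in> leaf_forms A k"
  shows "pullback A A id \<alpha> = \<alpha>"
proof (intro ext)
  fix x Xs
  show "pullback A A id \<alpha> x Xs = \<alpha> x Xs"
  proof (cases "set Xs \<subseteq> leaf_tangent_space A x")
    case True
    then have "map (differential A A id x) Xs = Xs"
      using differential_id[OF foliated_atlas_smooth[OF A] leaf_tangent_tangent]
      by (intro map_idI) auto
    with True show ?thesis by (simp add: pullback_def)
  next
    case False
    then show ?thesis using leaf_forms_zero[OF \<alpha>] by (auto simp: pullback_def)
  qed
qed

lemma leaf_d_eq: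
  "leaf_d A \<alpha> x Xs = (if set Xs \<subseteq> leaf_tangent_space A x
    then coord_d (form_in_chart A \<alpha> (chart_at A x)) (map (\<lambda>X. fst (X (chart_at A x))) Xs) (snd (chart_at A x) x)
    else 0)"
  by (simp add: leaf_d_def coord_d_def Let_def)

text \<open>Independence of the chart is naturality under the identity map, read in two charts of
  the same atlas: its coordinate expression is the transition.\<close>

lemma leaf_d_in_chart:
  assumes A: "foliated_atlas A" and \<alpha>: "\<alpha> \<in> leaf_forms A k"
    and X: "set Xs \<subseteq> leaf_tangent_space A x" and c: "c \<in> A" "x \<in> fst c"
  shows "leaf_d A \<alpha> x Xs = coord_d (form_in_chart A \<alpha> c) (map (\<lambda>X. fst (X c)) Xs) (snd c x)"
proof -
  note sm = foliated_atlas_smooth[OF A]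
  note c0 = chart_at[OF sm, of x]
  let ?c = "chart_at A x"
  have *: "map (\<lambda>v. fst (fd (coord_map ?c c id) (snd ?c x) (v, 0))) (map (\<lambda>X. fst (X ?c)) Xs)
    = map (\<lambda>X. fst (X c)) Xs"
  proof -
    have "fst (fd (coord_map ?c c id) (snd ?c x) (fst (X ?c), 0)) = fst (X c)" if "X \<in> set Xs" for X
    proof -
      have X': "X \<in> leaf_tangent_space A x" using that X by blast
      show ?thesis
        unfolding leaf_tangent_eq(1)[OF X' c0, symmetric] transition_eq_coord_map[symmetric]
          tangent_space_transition[OF leaf_tangent_tangent[OF X'] c0 c, symmetric] ..
    qed
    then show ?thesis by simp
  qed
  have "id x \<in> fst c" using c by simp
  from coord_d_pullback_form[OF A A tangential_id[OF A] \<alpha> c0 c(1) this, of "map (\<lambda>X. fst (X ?c)) Xs",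
      unfolded * pullback_id[OF A \<alpha>] id_apply[of x]] X
  show ?thesis by (simp only: leaf_d_eq if_True)
qed

lemma leaf_d_pullback:
  assumes A: "foliated_atlas A" "foliated_atlas A'" and f: "tangential A A' f"
    and \<alpha>: "\<alpha> \<in> leaf_forms A' k"
  shows "leaf_d A (pullback A A' f \<alpha>) = pullback A A' f (leaf_d A' \<alpha>)"
proof (intro ext)
  fix x Xs
  note sm = foliated_atlas_smooth[OF A(1)] foliated_atlas_smooth[OF A(2)]
  note fs = tangential_smooth[OF f]
  show "leaf_d A (pullback A A' f \<alpha>) x Xs = pullback A A' f (leaf_d A' \<alpha>) x Xs"
  proof (cases "set Xs \<subseteq> leaf_tangent_space A x")
    case True
    obtain c where c: "c \<in> A" "x \<in> fst c" using smooth_atlas_covers[OF sm(1)] .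
    obtain d where d: "d \<in> A'" "f x \<in> fst d" using smooth_atlas_covers[OF sm(2)] .
    have D: "set (map (differential A A' f x) Xs) \<subseteq> leaf_tangent_space A' (f x)"
      using f True unfolding tangential_def by auto
    have *: "map (\<lambda>v. fst (fd (coord_map c d f) (snd c x) (v, 0))) (map (\<lambda>X. fst (X c)) Xs)
      = map (\<lambda>X. fst (X d)) (map (differential A A' f x) Xs)"
    proof -
      have "fst (fd (coord_map c d f) (snd c x) (fst (X c), 0)) = fst (differential A A' f x X d)"
        if "X \<in> set Xs" for X
      proof -
        have X: "X \<in> leaf_tangent_space A x" using that True by blast
        show ?thesis
          unfolding differential_tangent[OF sm fs leaf_tangent_tangent[OF X] c d]
            leaf_tangent_eq(1)[OF X c, symmetric] ..
      qed
      then show ?thesis by simp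
    qed
    have "pullback A A' f (leaf_d A' \<alpha>) x Xs = leaf_d A' \<alpha> (f x) (map (differential A A' f x) Xs)"
      using True by (simp add: pullback_def)
    then show ?thesis
      unfolding leaf_d_in_chart[OF A(1) pullback_leaf_forms[OF A f \<alpha>] True c]
        leaf_d_in_chart[OF A(2) \<alpha> D d] coord_d_pullback_form[OF A f \<alpha> c d] * by simp
  qed (simp add: leaf_d_eq pullback_def)
qed

lemma nth_mem_del_nth:
  assumes "j < length xs" "i \<noteq> j" "i < length xs"
  shows "xs ! j \<in> set (del_nth i xs)"
proof -
  have "xs ! j = del_nth i xs ! (if j < i then j else j - 1)"
    using assms by (auto simp: nth_del_nth)
  moreover have "(if j < i then j else j - 1) < length (del_nth i xs)"
    using assms by (auto simp: length_del_nth)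
  ultimately show ?thesis using nth_mem by metis
qed

text \<open>An entry outside \<open>T\<close> is either the one inserted into
  \<open>\<omega>\<close> or survives in the list inserted into \<open>\<alpha>\<close>, so every
  summand has a vanishing factor.\<close>

lemma wedge1_not_leafwise:
  assumes "\<And>Y. Y \<notin> T \<Longrightarrow> \<omega> x [Y] = 0" "\<And>Ys. \<not> set Ys \<subseteq> T \<Longrightarrow> \<alpha> x Ys = 0" "\<not> set Xs \<subseteq> T"
  shows "wedge1 \<omega> \<alpha> x Xs = 0"
  unfolding wedge1_def
proof (intro sum.neutral ballI)
  fix i assume i: "i \<in> {..<length Xs}"
  obtain j where j: "j < length Xs" "Xs ! j \<notin> T" using assms(3) by (metis in_set_conv_nth subsetI)
  show "(-1) ^ i * \<omega> x [Xs ! i] * \<alpha> x (del_nth i Xs) = 0"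
  proof (cases "i = j")
    case False
    then have "\<not> set (del_nth i Xs) \<subseteq> T" using nth_mem_del_nth[of j Xs i] i j by auto
    then show ?thesis using assms(2) by simp
  qed (use assms(1) j in simp)
qed

lemma wedge1_pullback:
  "pullback A A' f (wedge1 \<omega> \<alpha>) = wedge1 (pullback A A' f \<omega>) (pullback A A' f \<alpha>)"
proof (intro ext)
  fix x Xs
  show "pullback A A' f (wedge1 \<omega> \<alpha>) x Xs = wedge1 (pullback A A' f \<omega>) (pullback A A' f \<alpha>) x Xs"
  proof (cases "set Xs \<subseteq> leaf_tangent_space A x")
    case True
    then have "set (del_nth i Xs) \<subseteq> leaf_tangent_space A x" for i using set_del_nth by fast
    moreover have "Xs ! i \<in> leaf_tangent_space A x" if "i < length Xs" for i
      using True that nth_mem by blast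
    ultimately show ?thesis
      using True by (auto simp: pullback_def wedge1_def del_nth_map intro!: sum.cong)
  next
    case False
    then have "wedge1 (pullback A A' f \<omega>) (pullback A A' f \<alpha>) x Xs = 0"
      by (intro wedge1_not_leafwise[of "leaf_tangent_space A x"]) (auto simp: pullback_def)
    with False show ?thesis by (simp add: pullback_def)
  qed
qed

lemma lincomb_pullback:
  "pullback A A' f (lincomb r \<alpha> s \<beta>) = lincomb r (pullback A A' f \<alpha>) s (pullback A A' f \<beta>)"
  by (auto simp: pullback_def lincomb_def fun_eq_iff)

lemma zero_form_pullback: "pullback A A' f zero_form = zero_form"
  by (auto simp: pullback_def zero_form_def fun_eq_iff)

lemma twisted_d_pullback:
  assumes "foliated_atlas A" "foliated_atlas A'" "tangential A A' f" "\<alpha> \<in> leaf_forms A' k"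
  shows "pullback A A' f (twisted_d A' \<omega> \<alpha>) = twisted_d A (pullback A A' f \<omega>) (pullback A A' f \<alpha>)"
  by (simp add: twisted_d_def lincomb_pullback wedge1_pullback leaf_d_pullback[OF assms])

lemma pullback_compose:
  assumes A: "foliated_atlas A" "foliated_atlas A'" "foliated_atlas A''"
    and f: "tangential A A' f" and g: "tangential A' A'' g" and gf: "smooth_map A A'' (g \<circ> f)"
  shows "pullback A A'' (g \<circ> f) \<alpha> = pullback A A' f (pullback A' A'' g \<alpha>)"
proof (intro ext)
  fix x Xs
  note sm = A[THEN foliated_atlas_smooth]
  show "pullback A A'' (g \<circ> f) \<alpha> x Xs = pullback A A' f (pullback A' A'' g \<alpha>) x Xs"
  proof (cases "set Xs \<subseteq> leaf_tangent_space A x")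
    case True
    have "set (map (differential A A' f x) Xs) \<subseteq> leaf_tangent_space A' (f x)"
      using f True unfolding tangential_def by auto
    moreover have "map (differential A A'' (g \<circ> f) x) Xs
      = map (differential A' A'' g (f x)) (map (differential A A' f x) Xs)"
      using True differential_compose[OF sm tangential_smooth[OF f] tangential_smooth[OF g] gf leaf_tangent_tangent]
      by auto
    ultimately show ?thesis using True by (simp add: pullback_def del: map_map map_eq_conv)
  qed (simp add: pullback_def)
qed

subsection \<open>Linear combinations and multiplication by functions\<close>

definition smooth_fun :: "('a, 'e::real_normed_vector) chart set \<Rightarrow> ('a \<Rightarrow> real) \<Rightarrow> bool" where
  "smooth_fun A h \<longleftrightarrow> (\<forall>c\<in>A. smooth_on (snd c ` fst c) (\<lambda>u. h (inv_chart c u)))"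

definition fun_form :: "('a \<Rightarrow> real) \<Rightarrow> ('a, 'e) form" where
  "fun_form h = (\<lambda>x Xs. if Xs = [] then h x else 0)"

definition scale_form :: "('a \<Rightarrow> real) \<Rightarrow> ('a, 'e) form \<Rightarrow> ('a, 'e) form" where
  "scale_form h \<alpha> = (\<lambda>x Xs. h x * \<alpha> x Xs)"

lemma scale_form_apply: "scale_form h \<alpha> x Xs = h x * \<alpha> x Xs"
  by (simp add: scale_form_def)

lemma smooth_fun_exp:
  assumes A: "smooth_atlas A" and h: "smooth_fun A h"
  shows "smooth_fun A (\<lambda>x. exp (h x))"
  unfolding smooth_fun_def
proof
  fix c assume c: "c \<in> A"
  show "smooth_on (snd c ` fst c) (\<lambda>u. exp (h (inv_chart c u)))"
    by (rule smooth_on_compose[OF finite_dim_real smooth_atlas_chart(2)[OF A c] _ UNIV_I smooth_on_exp])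
      (use h c in \<open>auto simp: smooth_fun_def\<close>)
qed

lemma smooth_fun_minus:
  assumes A: "smooth_atlas A" and h: "smooth_fun A h"
  shows "smooth_fun A (\<lambda>x. - h x)"
  using h smooth_on_bounded_linear_compose[OF bounded_linear_minus[OF bounded_linear_ident] smooth_atlas_chart(2)[OF A]]
  unfolding smooth_fun_def by blast

lemma lincomb_leaf_forms:
  fixes A :: "('a::{t2_space,second_countable_topology}, 'p::real_normed_vector \<times> 'q::real_normed_vector) chart set"
  assumes A: "smooth_atlas A" and "\<alpha> \<in> leaf_forms A k" "\<beta> \<in> leaf_forms A k"
  shows "lincomb r \<alpha> s \<beta> \<in> leaf_forms A k"
  unfolding leaf_forms_def
proof (intro CollectI conjI allI ballI impI)
  fix x show "leaf_form_at A k x (lincomb r \<alpha> s \<beta> x)"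
    using leaf_formsD(1)[OF assms(2), of x] leaf_formsD(1)[OF assms(3), of x]
    unfolding leaf_form_at_def lincomb_def by (auto simp: algebra_simps)
next
  fix c and vs :: "'p list" assume c: "c \<in> A" "length vs = k"
  have "smooth_on (snd c ` fst c) (\<lambda>u. r * form_in_chart A \<alpha> c vs u + s * form_in_chart A \<beta> c vs u)"
    by (intro smooth_on_add smooth_on_mult smooth_on_const smooth_atlas_chart(2)[OF A c(1)]
        form_in_chart_smooth[OF assms(2) c(1)] form_in_chart_smooth[OF assms(3) c(1)])
  then show "smooth_on (snd c ` fst c) (form_in_chart A (lincomb r \<alpha> s \<beta>) c vs)"
    by (rule smooth_on_cong) (simp add: form_in_chart_def lincomb_def)
qed

lemma scale_leaf_forms:
  fixes A :: "('a::{t2_space,second_countable_topology}, 'p::real_normed_vector \<times> 'q::real_normed_vector) chart set"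
  assumes A: "smooth_atlas A" and h: "smooth_fun A h" and \<alpha>: "\<alpha> \<in> leaf_forms A k"
  shows "scale_form h \<alpha> \<in> leaf_forms A k"
  unfolding leaf_forms_def
proof (intro CollectI conjI allI ballI impI)
  fix x show "leaf_form_at A k x (scale_form h \<alpha> x)"
    using leaf_formsD(1)[OF \<alpha>, of x]
    unfolding leaf_form_at_def scale_form_def by (auto simp: algebra_simps)
next
  fix c and vs :: "'p list" assume c: "c \<in> A" "length vs = k"
  have "smooth_on (snd c ` fst c) (\<lambda>u. h (inv_chart c u) * form_in_chart A \<alpha> c vs u)"
    by (intro smooth_on_mult smooth_atlas_chart(2)[OF A c(1)] form_in_chart_smooth[OF \<alpha> c(1)])
      (use h c in \<open>auto simp: smooth_fun_def\<close>)
  then show "smooth_on (snd c ` fst c) (form_in_chart A (scale_form h \<alpha>) c vs)"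
    by (rule smooth_on_cong) (simp add: form_in_chart_def scale_form_def)
qed

lemma zero_leaf_forms: "zero_form \<in> leaf_forms A k"
  unfolding leaf_forms_def leaf_form_at_def zero_form_def form_in_chart_def
  by (auto simp: smooth_on_const)

lemma leaf_d_lincomb:
  assumes A: "smooth_atlas A" and \<alpha>: "\<alpha> \<in> leaf_forms A k" and \<beta>: "\<beta> \<in> leaf_forms A k"
  shows "leaf_d A (lincomb r \<alpha> s \<beta>) = lincomb r (leaf_d A \<alpha>) s (leaf_d A \<beta>)"
proof (intro ext)
  fix x Xs
  let ?c = "chart_at A x"
  note c = chart_at[OF A, of x]
  have "fd (form_in_chart A (lincomb r \<alpha> s \<beta>) ?c vs) (snd ?c x) v
    = r * fd (form_in_chart A \<alpha> ?c vs) (snd ?c x) v + s * fd (form_in_chart A \<beta> ?c vs) (snd ?c x) v" for vs v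
  proof -
    have "form_in_chart A (lincomb r \<alpha> s \<beta>) ?c vs
      = (\<lambda>u. r * form_in_chart A \<alpha> ?c vs u + s * form_in_chart A \<beta> ?c vs u)"
      by (auto simp: form_in_chart_def lincomb_def)
    moreover have "((\<lambda>u. r * form_in_chart A \<alpha> ?c vs u + s * form_in_chart A \<beta> ?c vs u) has_derivative
      (\<lambda>v. r * fd (form_in_chart A \<alpha> ?c vs) (snd ?c x) v + s * fd (form_in_chart A \<beta> ?c vs) (snd ?c x) v)) (at (snd ?c x))"
      by (intro has_derivative_add has_derivative_mult_right has_derivative_fd
          form_in_chart_differentiable[OF A \<alpha> c] form_in_chart_differentiable[OF A \<beta> c])
    ultimately show ?thesis by (simp add: fd_eq)
  qed
  then show "leaf_d A (lincomb r \<alpha> s \<beta>) x Xs = lincomb r (leaf_d A \<alpha>) s (leaf_d A \<beta>) x Xs"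
    by (auto simp: leaf_d_eq coord_d_def lincomb_def sum_distrib_left sum.distrib[symmetric] algebra_simps
        intro!: sum.cong)
qed

lemma twisted_d_lincomb:
  assumes A: "smooth_atlas A" and \<alpha>: "\<alpha> \<in> leaf_forms A k" and \<beta>: "\<beta> \<in> leaf_forms A k"
  shows "twisted_d A \<omega> (lincomb r \<alpha> s \<beta>) = lincomb r (twisted_d A \<omega> \<alpha>) s (twisted_d A \<omega> \<beta>)"
proof -
  have "wedge1 \<omega> (lincomb r \<alpha> s \<beta>) = lincomb r (wedge1 \<omega> \<alpha>) s (wedge1 \<omega> \<beta>)"
    by (auto simp: wedge1_def lincomb_def fun_eq_iff sum_distrib_left sum.distrib[symmetric] algebra_simps
        intro!: sum.cong)
  then show ?thesis
    unfolding twisted_d_def leaf_d_lincomb[OF assms] by (auto simp: lincomb_def fun_eq_iff algebra_simps)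
qed

lemma form_in_chart_fun_form:
  "form_in_chart A (fun_form h) c vs = (\<lambda>u. if vs = [] then h (inv_chart c u) else 0)"
  by (auto simp: form_in_chart_def fun_form_def)

lemma leaf_d_fun_form:
  fixes A :: "('a::{t2_space,second_countable_topology}, 'p::real_normed_vector \<times> 'q::real_normed_vector) chart set"
  shows "leaf_d A (fun_form h) x Xs = (if \<exists>X\<in>leaf_tangent_space A x. Xs = [X]
    then fd (\<lambda>u. h (inv_chart (chart_at A x) u)) (snd (chart_at A x) x) (fst (hd Xs (chart_at A x)), 0) else 0)"
proof (cases Xs)
  case (Cons X Ys)
  show ?thesis
  proof (cases Ys)
    case Nil
    then show ?thesis using Cons
      by (auto simp: leaf_d_eq coord_d_def form_in_chart_fun_form del_nth_def)
  next
    case C2: (Cons Y Zs)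
    have "coord_d (form_in_chart A (fun_form h) c) vs u = 0" if l: "length vs > 1"
      for c vs and u :: "'p \<times> 'q"
      unfolding coord_d_def
    proof (intro sum.neutral ballI)
      fix i assume "i \<in> {..<length vs}"
      then have "del_nth i vs \<noteq> []" using length_del_nth[of i vs] l by auto
      then show "(-1) ^ i * fd (form_in_chart A (fun_form h) c (del_nth i vs)) u (vs ! i, 0) = 0"
        by (simp add: form_in_chart_fun_form)
    qed
    then show ?thesis using Cons C2 by (simp add: leaf_d_eq)
  qed
qed (auto simp: leaf_d_eq coord_d_def)

lemma leaf_d_scale:
  assumes A: "smooth_atlas A" and h: "smooth_fun A h" and \<alpha>: "\<alpha> \<in> leaf_forms A k"
  shows "leaf_d A (scale_form h \<alpha>) = lincomb 1 (scale_form h (leaf_d A \<alpha>)) 1 (wedge1 (leaf_d A (fun_form h)) \<alpha>)"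
proof (intro ext)
  fix x Xs
  let ?c = "chart_at A x"
  note c = chart_at[OF A, of x]
  let ?h = "\<lambda>u. h (inv_chart ?c u)"
  have inv: "inv_chart ?c (snd ?c x) = x" using smooth_atlas_chart(5)[OF A c] .
  have dh: "?h differentiable (at (snd ?c x))"
    using smooth_on_differentiable[OF smooth_atlas_chart(2)[OF A c(1)]] h c unfolding smooth_fun_def by blast
  have fd: "fd (form_in_chart A (scale_form h \<alpha>) ?c vs) (snd ?c x) v
    = h x * fd (form_in_chart A \<alpha> ?c vs) (snd ?c x) v + fd ?h (snd ?c x) v * form_in_chart A \<alpha> ?c vs (snd ?c x)" for vs v
  proof -
    have "form_in_chart A (scale_form h \<alpha>) ?c vs = (\<lambda>u. ?h u * form_in_chart A \<alpha> ?c vs u)"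
      by (auto simp: form_in_chart_def scale_form_def)
    moreover have "((\<lambda>u. ?h u * form_in_chart A \<alpha> ?c vs u) has_derivative
      (\<lambda>v. ?h (snd ?c x) * fd (form_in_chart A \<alpha> ?c vs) (snd ?c x) v
        + fd ?h (snd ?c x) v * form_in_chart A \<alpha> ?c vs (snd ?c x))) (at (snd ?c x))"
      by (intro has_derivative_mult has_derivative_fd dh form_in_chart_differentiable[OF A \<alpha> c])
    ultimately show ?thesis by (simp add: fd_eq inv)
  qed
  show "leaf_d A (scale_form h \<alpha>) x Xs
    = lincomb 1 (scale_form h (leaf_d A \<alpha>)) 1 (wedge1 (leaf_d A (fun_form h)) \<alpha>) x Xs"
  proof (cases "set Xs \<subseteq> leaf_tangent_space A x")
    case True
    let ?vs = "map (\<lambda>X. fst (X ?c)) Xs"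
    have "wedge1 (leaf_d A (fun_form h)) \<alpha> x Xs
      = (\<Sum>i<length Xs. (-1) ^ i * fd ?h (snd ?c x) (?vs ! i, 0) * form_in_chart A \<alpha> ?c (del_nth i ?vs) (snd ?c x))"
      unfolding wedge1_def
    proof (rule sum.cong[OF refl])
      fix i assume i: "i \<in> {..<length Xs}"
      have "set (del_nth i Xs) \<subseteq> leaf_tangent_space A x" using True set_del_nth by fast
      then have "\<alpha> x (del_nth i Xs) = form_in_chart A \<alpha> ?c (del_nth i ?vs) (snd ?c x)"
        using form_eq_form_in_chart[OF A _ c] by (simp add: del_nth_map)
      moreover have "leaf_d A (fun_form h) x [Xs ! i] = fd ?h (snd ?c x) (?vs ! i, 0)"
        using i True by (auto simp: leaf_d_fun_form subset_eq)
      ultimately show "(-1) ^ i * leaf_d A (fun_form h) x [Xs ! i] * \<alpha> x (del_nth i Xs)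
        = (-1) ^ i * fd ?h (snd ?c x) (?vs ! i, 0) * form_in_chart A \<alpha> ?c (del_nth i ?vs) (snd ?c x)" by simp
    qed
    then show ?thesis
      using True by (auto simp: leaf_d_eq coord_d_def lincomb_def scale_form_apply fd sum_distrib_left
          sum.distrib[symmetric] algebra_simps intro!: sum.cong)
  next
    case False
    then have "wedge1 (leaf_d A (fun_form h)) \<alpha> x Xs = 0"
      using leaf_forms_zero[OF \<alpha>]
      by (intro wedge1_not_leafwise[of "leaf_tangent_space A x"]) (auto simp: leaf_d_eq)
    with False show ?thesis by (simp add: leaf_d_eq lincomb_def scale_form_def)
  qed
qed

lemma leaf_d_fun_form_exp:
  assumes A: "smooth_atlas A" and h: "smooth_fun A h"
  shows "leaf_d A (fun_form (\<lambda>x. exp (h x))) = scale_form (\<lambda>x. exp (h x)) (leaf_d A (fun_form h))"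
proof (intro ext)
  fix x Xs
  let ?c = "chart_at A x"
  note c = chart_at[OF A, of x]
  let ?h = "\<lambda>u. h (inv_chart ?c u)"
  have inv: "inv_chart ?c (snd ?c x) = x" using smooth_atlas_chart(5)[OF A c] .
  have "?h differentiable (at (snd ?c x))"
    using smooth_on_differentiable[OF smooth_atlas_chart(2)[OF A c(1)]] h c unfolding smooth_fun_def by blast
  from has_derivative_exp[OF has_derivative_fd[OF this]]
  have "fd (\<lambda>u. exp (?h u)) (snd ?c x) v = exp (h x) * fd ?h (snd ?c x) v" for v
    by (simp add: fd_eq inv)
  then show "leaf_d A (fun_form (\<lambda>x. exp (h x))) x Xs = scale_form (\<lambda>x. exp (h x)) (leaf_d A (fun_form h)) x Xs"
    by (simp add: leaf_d_fun_form scale_form_def)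
qed

text \<open>The Leibniz rule contributes the derivative of the exponential factor, which is that
  factor times \<open>dh\<close>; wedged with \<open>\<alpha>\<close> it is absorbed into the
  twist.\<close>

lemma twisted_d_scale_exp:
  assumes A: "smooth_atlas A" and h: "smooth_fun A h" and \<alpha>: "\<alpha> \<in> leaf_forms A k"
  shows "twisted_d A \<omega> (scale_form (\<lambda>x. exp (h x)) \<alpha>)
    = scale_form (\<lambda>x. exp (h x)) (twisted_d A (lincomb 1 \<omega> 1 (leaf_d A (fun_form h))) \<alpha>)"
proof (intro ext)
  fix x Xs
  show "twisted_d A \<omega> (scale_form (\<lambda>x. exp (h x)) \<alpha>) x Xs
    = scale_form (\<lambda>x. exp (h x)) (twisted_d A (lincomb 1 \<omega> 1 (leaf_d A (fun_form h))) \<alpha>) x Xs"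
    unfolding twisted_d_def leaf_d_scale[OF A smooth_fun_exp[OF A h] \<alpha>] leaf_d_fun_form_exp[OF A h]
    by (simp add: lincomb_def scale_form_def wedge1_def sum_distrib_left sum.distrib[symmetric] algebra_simps)
qed

section \<open>Leaves\<close>

lemma foliated_atlas_transverse:
  assumes A: "foliated_atlas A" and c: "c \<in> A" "x \<in> fst c" and d: "d \<in> A" "x \<in> fst d"
  obtains U g where "open U" "x \<in> U" "U \<subseteq> fst c" "U \<subseteq> fst d"
    "\<And>y. y \<in> U \<Longrightarrow> snd (snd d y) = g (snd (snd c y))"
proof -
  note sm = foliated_atlas_smooth[OF A]
  have "snd c x \<in> overlap c d" using c d by (auto simp: overlap_def)
  then obtain V g where V: "open V" "snd c x \<in> V" "\<forall>w\<in>V. snd (transition c d w) = g (snd w)"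
    using A c d unfolding foliated_atlas_def by blast
  define U where "U = (fst c \<inter> snd c -` V) \<inter> fst d"
  have "open (fst c \<inter> snd c -` V)"
    by (rule continuous_open_preimage[OF smooth_atlas_chart(3,1)[OF sm c(1)] V(1)])
  then have U: "open U" unfolding U_def using smooth_atlas_chart(1)[OF sm d(1)] by blast
  have "snd (snd d y) = g (snd (snd c y))" if "y \<in> U" for y
    using V(3) that smooth_atlas_chart(5)[OF sm c(1), of y] by (auto simp: U_def transition_def)
  then show ?thesis using that[OF U] c d V(2) by (auto simp: U_def)
qed

text \<open>By the Lindelof property countably many of the neighbourhoods on which \<open>f\<close>
  is constant cover \<open>S\<close>, and each contributes a single value.\<close>

lemma countable_image_locally_constant:
  fixes S :: "'a::second_countable_topology set"
  assumes "\<And>x. x \<in> S \<Longrightarrow> \<exists>U. open U \<and> x \<in> U \<and> (\<forall>y\<in>S \<inter> U. f y = f x)"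
  shows "countable (f ` S)"
proof -
  obtain U where U: "\<And>x. x \<in> S \<Longrightarrow> open (U x) \<and> x \<in> U x \<and> (\<forall>y\<in>S \<inter> U x. f y = f x)"
    using assms by metis
  obtain F where F: "F \<subseteq> U ` S" "countable F" "\<Union>F = \<Union>(U ` S)"
    using Lindelof[of "U ` S"] U by auto
  obtain C where C: "countable C" "C \<subseteq> S" "F = U ` C"
    using countable_subset_image[of F U S] F by blast
  have "f ` S \<subseteq> f ` C"
  proof
    fix z assume "z \<in> f ` S"
    then obtain x where x: "x \<in> S" "z = f x" by blast
    then have "x \<in> \<Union>F" using F(3) U by blast
    then obtain y where "y \<in> C" "x \<in> U y" using C(3) by blast
    then show "z \<in> f ` C" using U[of y] C(2) x by auto
  qed
  then show ?thesis using countable_image[OF C(1)] by (rule countable_subset)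
qed

text \<open>Whole slices instead of plaques: they may be disconnected, but a chart and a transverse
  value determine them, so that counting slices amounts to counting values.\<close>

definition slice :: "('a, 'p \<times> 'q) chart \<times> 'q \<Rightarrow> 'a set" where
  "slice t = {y \<in> fst (fst t). snd (snd (fst t) y) = snd t}"

lemma countable_slice_image:
  assumes A: "foliated_atlas A" and c: "fst t \<in> A" and d: "d \<in> A"
  shows "countable ((\<lambda>y. snd (snd d y)) ` (slice t \<inter> fst d))"
proof (rule countable_image_locally_constant)
  fix x assume x: "x \<in> slice t \<inter> fst d"
  then have "x \<in> fst (fst t)" "x \<in> fst d" by (auto simp: slice_def)
  then obtain U g where U: "open U" "x \<in> U" "U \<subseteq> fst (fst t)" "U \<subseteq> fst d"
    "\<And>y. y \<in> U \<Longrightarrow> snd (snd d y) = g (snd (snd (fst t) y))"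
    using foliated_atlas_transverse[OF A c _ d] by blast
  have "\<forall>y\<in>slice t \<inter> fst d \<inter> U. snd (snd d y) = snd (snd d x)"
    using U x by (auto simp: slice_def)
  then show "\<exists>U. open U \<and> x \<in> U \<and> (\<forall>y\<in>slice t \<inter> fst d \<inter> U. snd (snd d y) = snd (snd d x))"
    using U(1,2) by blast
qed

lemma countable_rtrancl_Image:
  assumes "\<And>t. countable (E `` {t})"
  shows "countable (E\<^sup>* `` {t})"
proof -
  have "countable ((E ^^ n) `` {t})" for n
  proof (induction n)
    case (Suc n)
    have "(E ^^ Suc n) `` {t} = (\<Union>s\<in>(E ^^ n) `` {t}. E `` {s})" by auto
    then show ?case using Suc assms by auto
  qed simp
  then have "countable (\<Union>n. (E ^^ n) `` {t})" by blast
  moreover have "E\<^sup>* `` {t} = (\<Union>n. (E ^^ n) `` {t})"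
    by (auto simp: rtrancl_is_UN_relpow)
  ultimately show ?thesis by simp
qed

text \<open>Countably many charts cover the manifold, and a slice of one of them meets only countably
  many slices of the others. A leaf is therefore contained in the countably many slices which
  can be reached from a given one by a chain of intersecting slices.\<close>

lemma countable_leaf_image:
  assumes A: "foliated_atlas A" and d: "d \<in> A"
  shows "countable ((\<lambda>y. snd (snd d y)) ` (leaf A x \<inter> fst d))"
proof -
  note sm = foliated_atlas_smooth[OF A]
  have "\<exists>C. countable C \<and> C \<subseteq> A \<and> (\<Union>c\<in>C. fst c) = UNIV"
  proof -
    have "open S" if "S \<in> fst ` A" for S using that smooth_atlas_chart(1)[OF sm] by blast
    then obtain F where F: "F \<subseteq> fst ` A" "countable F" "\<Union>F = \<Union>(fst ` A)"
      using Lindelof[of "fst ` A"] by blast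
    obtain C where "countable C" "C \<subseteq> A" "F = fst ` C"
      using countable_subset_image[of F fst A] F by blast
    then show ?thesis using F(3) sm unfolding smooth_atlas_def by auto
  qed
  then obtain C where C: "countable C" "C \<subseteq> A" "(\<Union>c\<in>C. fst c) = UNIV" by blast
  define E where "E = {(t, t'). fst t \<in> C \<and> fst t' \<in> C \<and> slice t \<inter> slice t' \<noteq> {}}"
  have E: "countable (E `` {t})" for t
  proof (cases "fst t \<in> C")
    case True
    have "E `` {t} \<subseteq> (\<Union>c\<in>C. Pair c ` (\<lambda>y. snd (snd c y)) ` (slice t \<inter> fst c))"
    proof
      fix t' assume "t' \<in> E `` {t}"
      then obtain y where t': "fst t' \<in> C" and y: "y \<in> slice t" "y \<in> slice t'"
        by (auto simp: E_def)
      have "y \<in> slice t \<inter> fst (fst t')" "t' = Pair (fst t') (snd (snd (fst t') y))"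
        using y by (auto simp: slice_def prod_eq_iff)
      then show "t' \<in> (\<Union>c\<in>C. Pair c ` (\<lambda>y. snd (snd c y)) ` (slice t \<inter> fst c))"
        using t' by blast
    qed
    moreover have "countable (\<Union>c\<in>C. Pair c ` (\<lambda>y. snd (snd c y)) ` (slice t \<inter> fst c))"
    proof (intro countable_UN C(1) countable_image[where f = "Pair c" for c])
      show "countable ((\<lambda>y. snd (snd c y)) ` (slice t \<inter> fst c))" if "c \<in> C" for c
        using countable_slice_image[OF A, of t c] True C(2) that by blast
    qed
    ultimately show ?thesis by (rule countable_subset)
  qed (simp add: E_def)
  obtain c0 where c0: "c0 \<in> C" "x \<in> fst c0" using C(3) by blast
  define t0 where "t0 = (c0, snd (snd c0 x))"
  define T where "T = E\<^sup>* `` {t0}"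
  have T: "countable T" unfolding T_def by (rule countable_rtrancl_Image[OF E])
  have TC: "fst t \<in> C" if "t \<in> T" for t
  proof -
    have "(t0, t) \<in> E\<^sup>*" using that by (simp add: T_def)
    then show ?thesis by (cases rule: rtranclE) (use c0 in \<open>auto simp: t0_def E_def\<close>)
  qed
  have step: "s \<in> T" if "t \<in> T" "fst s \<in> C" "slice t \<inter> slice s \<noteq> {}" for s t
  proof -
    have "(t, s) \<in> E" using that TC by (auto simp: E_def)
    then show ?thesis using that(1) unfolding T_def by (auto intro: rtrancl_into_rtrancl)
  qed
  let ?U = "\<Union>t\<in>T. slice t"
  \<comment> \<open>The chart of a plaque need not belong to the countable family \<open>C\<close>.
    Membership in the union is therefore followed along the connected plaque: near each of its
    points it lies in a single slice \<open>s\<close> of some chart in \<open>C\<close>, and there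
    membership is equivalent to \<open>s \<in> T\<close>.\<close>
  have plaque: "z \<in> ?U" if y: "y \<in> ?U" and yz: "same_plaque A y z" for y z
  proof -
    obtain c K where c: "c \<in> A" "y \<in> fst c" "z \<in> fst c" and K: "connected K"
      "K \<subseteq> {u \<in> snd c ` fst c. snd u = snd (snd c y)}" "snd c y \<in> K" "snd c z \<in> K"
      using yz unfolding same_plaque_def connected_component_def by blast
    have "(inv_chart c (snd c y) \<in> ?U) = (inv_chart c (snd c z) \<in> ?U)"
    proof (rule connected_local_const[OF K(1,3,4)], intro ballI)
      fix u assume u: "u \<in> K"
      define w where "w = inv_chart c u"
      have uc: "u \<in> snd c ` fst c" using u K(2) by blast
      have w: "w \<in> fst c" "snd c w = u" unfolding w_def using smooth_atlas_chart(6,7)[OF sm c(1) uc] by auto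
      obtain e where e: "e \<in> C" "w \<in> fst e" using C(3) by blast
      obtain U g where U: "open U" "w \<in> U" "U \<subseteq> fst c" "U \<subseteq> fst e"
        "\<And>y. y \<in> U \<Longrightarrow> snd (snd e y) = g (snd (snd c y))"
        using foliated_atlas_transverse[OF A c(1) w(1) _ e(2)] e(1) C(2) by blast
      define s where "s = (e, g (snd (snd c y)))"
      have N: "open (snd c ` (fst c \<inter> U))" "u \<in> snd c ` (fst c \<inter> U)"
        using chart_image_open[OF sm c(1) U(1)] chart_image_mem[OF sm c(1)] uc U(2) w_def by auto
      have s: "inv_chart c u' \<in> slice s" if "u' \<in> K" "u' \<in> snd c ` (fst c \<inter> U)" for u'
      proof -
        have "inv_chart c u' \<in> U" "snd c (inv_chart c u') = u'"
          using that(2) smooth_atlas_chart(5)[OF sm c(1)] by auto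
        moreover have "snd u' = snd (snd c y)" using that(1) K(2) by blast
        ultimately show ?thesis using U(4,5) by (auto simp: slice_def s_def)
      qed
      have iff: "inv_chart c u' \<in> ?U \<longleftrightarrow> s \<in> T" if u': "u' \<in> K" "u' \<in> snd c ` (fst c \<inter> U)" for u'
      proof
        assume "inv_chart c u' \<in> ?U"
        then obtain t where "t \<in> T" "inv_chart c u' \<in> slice t" by blast
        then show "s \<in> T" using step[of t s] s[OF u'] e(1) by (auto simp: s_def)
      qed (use s[OF u'] in blast)
      have "\<forall>\<^sub>F u' in at u within K. u' \<in> snd c ` (fst c \<inter> U)"
        using eventually_at_topological N by blast
      moreover have "\<forall>\<^sub>F u' in at u within K. u' \<in> K" by (simp add: eventually_at_filter)
      ultimately show "\<forall>\<^sub>F u' in at u within K. (inv_chart c u \<in> ?U) = (inv_chart c u' \<in> ?U)"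
        by eventually_elim (use iff iff[OF u N(2)] in blast)
    qed
    then show ?thesis using y smooth_atlas_chart(5)[OF sm c(1)] c by simp
  qed
  have leaf: "leaf A x \<subseteq> ?U"
  proof
    fix y assume "y \<in> leaf A x"
    then have "(same_plaque A)\<^sup>*\<^sup>* x y" by (simp add: leaf_def)
    then show "y \<in> ?U"
    proof (induction rule: rtranclp_induct)
      case base
      have "t0 \<in> T" by (simp add: T_def)
      moreover have "x \<in> slice t0" using c0 by (simp add: t0_def slice_def)
      ultimately show ?case by blast
    qed (rule plaque)
  qed
  have "(\<lambda>y. snd (snd d y)) ` (leaf A x \<inter> fst d)
    \<subseteq> (\<Union>t\<in>T. (\<lambda>y. snd (snd d y)) ` (slice t \<inter> fst d))"
    using leaf by blast
  moreover have "countable (\<Union>t\<in>T. (\<lambda>y. snd (snd d y)) ` (slice t \<inter> fst d))"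
    by (intro countable_UN T countable_slice_image[OF A _ d]) (use TC C(2) in blast)
  ultimately show ?thesis by (rule countable_subset)
qed

lemma leaf_trans: "y \<in> leaf A x \<Longrightarrow> z \<in> leaf A y \<Longrightarrow> z \<in> leaf A x"
  by (simp add: leaf_def)

lemma leaf_same_plaque: "same_plaque A x y \<Longrightarrow> y \<in> leaf A x"
  by (simp add: leaf_def r_into_rtranclp)

text \<open>The hypothesis concerns single plaques, so that it applies to a homotopy on the product
  as well, where plaques are understood through their projections.\<close>

lemma tangentialI_leaf:
  assumes A: "foliated_atlas A" "foliated_atlas A'" and f: "smooth_map A A' f"
    and leaf: "\<And>x y. same_plaque A x y \<Longrightarrow> f y \<in> leaf A' (f x)"
  shows "tangential A A' f"
proof (rule tangentialI[OF A f])
  fix x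
  note sm = foliated_atlas_smooth[OF A(1)] foliated_atlas_smooth[OF A(2)]
  obtain c where c: "c \<in> A" "x \<in> fst c" using smooth_atlas_covers[OF sm(1)] .
  obtain d where d: "d \<in> A'" "f x \<in> fst d" using smooth_atlas_covers[OF sm(2)] .
  let ?\<phi> = "coord_map c d f" and ?u = "snd c x"
  note diff = coord_map_differentiable[OF sm f c(1) d(1) c(2) d(2)]
  have "snd (fd ?\<phi> ?u (v, 0)) = 0" for v
  proof -
    let ?l = "\<lambda>s. ?u + s *\<^sub>R (v, 0)"
    have "open (?l -` coord_dom c d f)"
      by (intro open_vimage coord_dom_open[OF sm f c(1) d(1)] continuous_intros)
    moreover have l0: "?l 0 = ?u" by (simp only: scaleR_zero_left add_0_right)
    then have "0 \<in> ?l -` coord_dom c d f"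
      using coord_dom_mem(1)[where f = f, OF sm(1) c d(2)] by (simp only: vimage_def mem_Collect_eq)
    ultimately obtain e where e: "e > 0" "ball 0 e \<subseteq> ?l -` coord_dom c d f" by (rule openE)
    define \<gamma> where "\<gamma> = (\<lambda>s. f (inv_chart c (?l s)))"
    have dom: "?l s \<in> snd c ` fst c" "\<gamma> s \<in> fst d" if "s \<in> ball 0 e" for s
    proof -
      have "?l s \<in> coord_dom c d f"
        using subsetD[OF e(2) that] by (simp only: vimage_def mem_Collect_eq)
      note * = iffD1[OF chart_image_mem[OF sm(1) c(1)] this]
      show "?l s \<in> snd c ` fst c" "\<gamma> s \<in> fst d"
        using conjunct1[OF *] conjunct2[OF *] unfolding \<gamma>_def vimage_eq .
    qed
    \<comment> \<open>A segment in a leafwise coordinate direction is connected and has constant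
      transverse coordinate, hence lies in one plaque.\<close>
    have "same_plaque A x (inv_chart c (?l s))" if s: "s \<in> ball 0 e" for s
      unfolding same_plaque_def
    proof (intro bexI[OF _ c(1)] conjI c(2))
      show "inv_chart c (?l s) \<in> fst c" using smooth_atlas_chart(7)[OF sm(1) c(1) dom(1)[OF s]] .
      have "connected (?l ` ball 0 e)"
        by (intro connected_continuous_image continuous_intros) simp
      moreover have "?l ` ball 0 e \<subseteq> {u \<in> snd c ` fst c. snd u = snd ?u}"
        using dom(1) by auto
      moreover have "?u \<in> ?l ` ball 0 e" using e(1) l0 by (intro image_eqI[of _ _ 0]) simp_all
      moreover have "?l s \<in> ?l ` ball 0 e" using s by blast
      ultimately show "connected_component {u \<in> snd c ` fst c. snd u = snd ?u} ?u (snd c (inv_chart c (?l s)))"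
        unfolding smooth_atlas_chart(6)[OF sm(1) c(1) dom(1)[OF s]] connected_component_def by blast
    qed
    then have \<gamma>: "\<gamma> ` ball 0 e \<subseteq> leaf A' (f x) \<inter> fst d" using leaf dom(2) by (auto simp: \<gamma>_def)
    have 1: "continuous_on (ball 0 e) (\<lambda>s. inv_chart c (?l s))"
      by (rule continuous_on_compose2[OF smooth_atlas_chart(4)[OF sm(1) c(1)]])
        (use dom(1) in \<open>auto intro!: continuous_intros\<close>)
    have "continuous_on UNIV f" using f unfolding smooth_map_def by blast
    then have "continuous_on (ball 0 e) \<gamma>"
      unfolding \<gamma>_def by (rule continuous_on_compose2[OF _ 1 subset_UNIV])
    then have "continuous_on (ball 0 e) (\<lambda>s. snd d (\<gamma> s))"
      by (rule continuous_on_compose2[OF smooth_atlas_chart(3)[OF sm(2) d(1)]]) (use dom(2) in auto)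
    \<comment> \<open>A connected set with more than one point is uncountable; being countable as
      well, the set of transverse values along the curve is a single point.\<close>
    then have "connected ((\<lambda>s. snd (snd d (\<gamma> s))) ` ball 0 e)"
      by (intro connected_continuous_image continuous_on_snd) auto
    moreover have "countable ((\<lambda>s. snd (snd d (\<gamma> s))) ` ball 0 e)"
      by (rule countable_subset[OF _ countable_leaf_image[OF A(2) d(1), of "f x"]]) (use \<gamma> in auto)
    ultimately have const: "snd (snd d (\<gamma> s)) = snd (snd d (\<gamma> 0))" if "s \<in> ball 0 e" for s
      using connected_uncountable[of "(\<lambda>s. snd (snd d (\<gamma> s))) ` ball 0 e"] that e(1) by fastforce
    have "\<forall>\<^sub>F s in nhds 0. s \<in> ball (0::real) e"
      by (rule eventually_nhds_in_open) (use e(1) in auto)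
    then have "\<forall>\<^sub>F s in nhds 0. snd (?\<phi> (?l s)) = snd (snd d (\<gamma> 0))"
      by eventually_elim (use const in \<open>simp add: \<gamma>_def\<close>)
    then have "fd (\<lambda>u. snd (?\<phi> u)) ?u (v, 0) = 0"
      by (rule fd_zero_along[rotated])
        (use bounded_linear.has_derivative[OF bounded_linear_snd has_derivative_fd[OF diff]] in \<open>auto simp: differentiable_def\<close>)
    then show ?thesis by (simp only: fd_bounded_linear_compose[OF bounded_linear_snd diff])
  qed
  then show "\<exists>c\<in>A. \<exists>d\<in>A'. x \<in> fst c \<and> f x \<in> fst d \<and> (\<forall>v. snd (fd (coord_map c d f) (snd c x) (v, 0)) = 0)"
    using c d by blast
qed

lemma foliated_map_tangential:
  assumes "foliated_atlas A" "foliated_atlas A'" "foliated_map A A' f"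
  shows "tangential A A' f"
  using assms leaf_same_plaque[of A] unfolding foliated_map_def
  by (intro tangentialI_leaf) blast+

section \<open>The product of a foliation with the real line\<close>

text \<open>The factor \<open>\<real>\<close> is a leafwise direction, so its coordinate has to be moved from the
  end into the first component.\<close>

definition twist :: "('p \<times> 'q) \<times> 't \<Rightarrow> ('p \<times> 't) \<times> 'q" where
  "twist = (\<lambda>(u, t). ((fst u, t), snd u))"

definition untwist :: "('p \<times> 't) \<times> 'q \<Rightarrow> ('p \<times> 'q) \<times> 't" where
  "untwist = (\<lambda>(w, z). ((fst w, z), snd w))"

lemma twist_apply:
  "twist (u, t) = ((fst u, t), snd u)" "untwist (w, z) = ((fst w, z), snd w)"
  by (simp_all add: twist_def untwist_def)

lemma twist_simps [simp]:
  "untwist (twist p) = p" "twist (untwist q) = q"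
  "snd (twist p) = snd (fst p)" "snd (fst (untwist q)) = snd q"
  by (auto simp: twist_def untwist_def case_prod_beta)

lemma bounded_linear_twist:
  "bounded_linear (twist :: ('p::real_normed_vector \<times> 'q::real_normed_vector) \<times> 't::real_normed_vector \<Rightarrow> _)"
proof -
  have eq: "twist = (\<lambda>p::('p \<times> 'q) \<times> 't. ((fst (fst p), snd p), snd (fst p)))" by (auto simp: twist_def)
  show ?thesis unfolding eq
    by (intro bounded_linear_Pair bounded_linear_fst_comp bounded_linear_snd_comp
        bounded_linear_fst bounded_linear_snd)
qed

lemma bounded_linear_untwist:
  "bounded_linear (untwist :: ('p::real_normed_vector \<times> 't::real_normed_vector) \<times> 'q::real_normed_vector \<Rightarrow> _)"
proof -
  have eq: "untwist = (\<lambda>p::('p \<times> 't) \<times> 'q. ((fst (fst p), snd p), snd (fst p)))" by (auto simp: untwist_def)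
  show ?thesis unfolding eq
    by (intro bounded_linear_Pair bounded_linear_fst_comp bounded_linear_snd_comp
        bounded_linear_fst bounded_linear_snd)
qed

lemma continuous_on_untwist:
  fixes f :: "_ \<Rightarrow> ('p::real_normed_vector \<times> 't::real_normed_vector) \<times> 'q::real_normed_vector"
  shows "continuous_on S f \<Longrightarrow> continuous_on S (\<lambda>x. untwist (f x))"
  by (rule bounded_linear.continuous_on[OF bounded_linear_untwist])

lemma continuous_on_twist:
  fixes f :: "_ \<Rightarrow> ('p::real_normed_vector \<times> 'q::real_normed_vector) \<times> 't::real_normed_vector"
  shows "continuous_on S f \<Longrightarrow> continuous_on S (\<lambda>x. twist (f x))"
  by (rule bounded_linear.continuous_on[OF bounded_linear_twist])

lemma open_fst_untwist:
  fixes V :: "('p::real_normed_vector \<times> 'q::real_normed_vector) set"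
  assumes "open V"
  shows "open {w :: ('p \<times> 't::real_normed_vector) \<times> 'q. fst (untwist w) \<in> V}"
proof -
  have "continuous_on UNIV (\<lambda>w :: ('p \<times> 't) \<times> 'q. fst (untwist w))"
    by (intro continuous_on_fst continuous_on_untwist continuous_on_id)
  from open_vimage[OF assms this] show ?thesis unfolding vimage_def .
qed

definition line_chart :: "('a, 'p \<times> 'q) chart \<Rightarrow> ('a \<times> real, ('p \<times> real) \<times> 'q) chart" where
  "line_chart c = (fst c \<times> UNIV, \<lambda>(x, t). twist (snd c x, t))"

definition line_atlas :: "('a, 'p \<times> 'q) chart set \<Rightarrow> ('a \<times> real, ('p \<times> real) \<times> 'q) chart set" where
  "line_atlas A = line_chart ` A"

lemma line_chart_simps [simp]:
  "fst (line_chart c) = fst c \<times> UNIV" "snd (line_chart c) (x, t) = twist (snd c x, t)"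
  by (simp_all add: line_chart_def)

lemma line_chart_image:
  fixes c :: "('a, 'p \<times> 'q) chart"
  shows "snd (line_chart c) ` fst (line_chart c) = {w. fst (untwist w) \<in> snd c ` fst c}"
proof (intro set_eqI iffI)
  fix w :: "('p \<times> real) \<times> 'q" assume "w \<in> {w. fst (untwist w) \<in> snd c ` fst c}"
  then obtain x where x: "x \<in> fst c" "fst (untwist w) = snd c x" by blast
  then have "w = snd (line_chart c) (x, snd (untwist w))"
    by (simp only: line_chart_simps x(2)[symmetric] prod.collapse twist_simps)
  then show "w \<in> snd (line_chart c) ` fst (line_chart c)" by (rule image_eqI) (use x in simp)
qed (auto simp: line_chart_def)

lemma overlap_line:
  fixes c d :: "('a, 'p \<times> 'q) chart"
  shows "overlap (line_chart c) (line_chart d) = {w. fst (untwist w) \<in> overlap c d}"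
proof (intro set_eqI iffI)
  fix w :: "('p \<times> real) \<times> 'q" assume "w \<in> {w. fst (untwist w) \<in> overlap c d}"
  then obtain x where x: "x \<in> fst c" "x \<in> fst d" "fst (untwist w) = snd c x" by (auto simp: overlap_def)
  then have "w = snd (line_chart c) (x, snd (untwist w))"
    by (simp only: line_chart_simps x(3)[symmetric] prod.collapse twist_simps)
  then show "w \<in> overlap (line_chart c) (line_chart d)"
    unfolding overlap_def by (rule image_eqI) (use x in simp)
qed (auto simp: overlap_def)

context
  fixes A :: "('a::{t2_space,second_countable_topology}, 'p::real_normed_vector \<times> 'q::real_normed_vector) chart set"
  assumes A: "smooth_atlas A"
begin

lemma inv_line_chart:
  assumes c: "c \<in> A" and w: "fst (untwist w) \<in> snd c ` fst c"
  shows "inv_chart (line_chart c) w = (inv_chart c (fst (untwist w)), snd (untwist w))"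
proof -
  let ?p = "(inv_chart c (fst (untwist w)), snd (untwist w))"
  have inj: "inj_on (snd (line_chart c)) (fst (line_chart c))"
  proof (rule inj_onI)
    fix p q assume p: "p \<in> fst (line_chart c)" "q \<in> fst (line_chart c)"
      and eq: "snd (line_chart c) p = snd (line_chart c) q"
    obtain x t y s where pq: "p = (x, t)" "q = (y, s)" by fastforce
    have e: "snd c x = snd c y" "t = s" using arg_cong[OF eq, of untwist] unfolding pq by simp_all
    have xy: "x \<in> fst c" "y \<in> fst c" using p unfolding pq by simp_all
    have "x = y"
      using smooth_atlas_chart(5)[OF A c xy(1)] smooth_atlas_chart(5)[OF A c xy(2)] unfolding e(1) by (rule trans[OF sym])
    then show "p = q" using e(2) pq by simp
  qed
  have "snd (line_chart c) ?p = w"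
    by (simp only: line_chart_simps smooth_atlas_chart(6)[OF A c w] prod.collapse twist_simps)
  moreover have "?p \<in> fst (line_chart c)" using smooth_atlas_chart(7)[OF A c w] by simp
  ultimately show ?thesis unfolding inv_chart_def using inv_into_f_f[OF inj] by metis
qed

lemma inv_line_chart_twist:
  assumes "c \<in> A" "u \<in> snd c ` fst c"
  shows "inv_chart (line_chart c) (twist (u, t)) = (inv_chart c u, t)"
  using inv_line_chart[OF assms(1), of "twist (u, t)"] assms(2) by simp

lemma is_chart_line:
  assumes c: "c \<in> A"
  shows "is_chart (line_chart c)"
proof -
  let ?I = "{w :: ('p \<times> real) \<times> 'q. fst (untwist w) \<in> snd c ` fst c}"
  have I: "open ?I" by (rule open_fst_untwist[OF smooth_atlas_chart(2)[OF A c]])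
  have dom: "open (fst (line_chart c))" using smooth_atlas_chart(1)[OF A c] by (simp add: open_Times)
  have "continuous_on (fst c \<times> UNIV) (\<lambda>p. twist (snd c (fst p), snd p :: real))"
    by (intro continuous_on_twist continuous_on_Pair continuous_intros
        continuous_on_compose2[OF smooth_atlas_chart(3)[OF A c]]) auto
  then have 1: "continuous_on (fst (line_chart c)) (snd (line_chart c))"
    by (simp add: line_chart_def case_prod_beta)
  have "continuous_on ?I (\<lambda>w. (inv_chart c (fst (untwist w)), snd (untwist w)))"
    by (intro continuous_on_Pair continuous_on_snd continuous_on_untwist continuous_intros
        continuous_on_compose2[OF smooth_atlas_chart(4)[OF A c]]) auto
  then have 2: "continuous_on ?I (inv_chart (line_chart c))"
    by (rule continuous_on_eq) (simp add: inv_line_chart[OF c])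
  have 3: "inv_chart (line_chart c) (snd (line_chart c) p) = p" if "p \<in> fst (line_chart c)" for p
  proof -
    obtain x t where p: "p = (x, t)" by fastforce
    then have "x \<in> fst c" using that by simp
    then show ?thesis
      using inv_line_chart_twist[OF c, of "snd c x" t] smooth_atlas_chart(5)[OF A c]
      unfolding p line_chart_simps by simp
  qed
  have 4: "inv_chart (line_chart c) w \<in> fst (line_chart c) \<and> snd (line_chart c) (inv_chart (line_chart c) w) = w"
    if "w \<in> ?I" for w
    using that smooth_atlas_chart(6,7)[OF A c, of "fst (untwist w)"] inv_line_chart[OF c, of w]
    by simp
  show ?thesis
    unfolding is_chart_def
  proof (intro conjI dom)
    show "open (snd (line_chart c) ` fst (line_chart c))" unfolding line_chart_image by (rule I)
    show "homeomorphism (fst (line_chart c)) (snd (line_chart c) ` fst (line_chart c))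
      (snd (line_chart c)) (inv_chart (line_chart c))"
    proof (rule homeomorphismI[OF 1 _ subset_refl])
      show "continuous_on (snd (line_chart c) ` fst (line_chart c)) (inv_chart (line_chart c))"
        unfolding line_chart_image by (rule 2)
      show "inv_chart (line_chart c) ` snd (line_chart c) ` fst (line_chart c) \<subseteq> fst (line_chart c)"
        unfolding line_chart_image using 4 by blast
      show "snd (line_chart c) (inv_chart (line_chart c) w) = w"
        if "w \<in> snd (line_chart c) ` fst (line_chart c)" for w
        using 4 that unfolding line_chart_image by blast
    qed (rule 3)
  qed
qed

lemma transition_line:
  assumes "c \<in> A" "w \<in> overlap (line_chart c) (line_chart d)"
  shows "transition (line_chart c) (line_chart d) w = twist (transition c d (fst (untwist w)), snd (untwist w))"
proof -
  have "fst (untwist w) \<in> snd c ` fst c"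
    using assms overlap_line[of c d] by (auto simp: overlap_def)
  then show ?thesis
    unfolding transition_def using inv_line_chart[OF assms(1)] by simp
qed

lemma smooth_atlas_line: "smooth_atlas (line_atlas A)"
  unfolding smooth_atlas_def
proof (intro conjI ballI)
  have fin: "finite_dim TYPE('p \<times> 'q)" using smooth_atlas_finite_dim[OF A] .
  note fin1 = finite_dim_prod[OF finite_dim_prod[OF finite_dim_fst[OF fin] finite_dim_real] finite_dim_snd[OF fin]]
  show "finite_dim TYPE(('p \<times> real) \<times> 'q)" by (rule fin1)
  show "is_chart c" if "c \<in> line_atlas A" for c
    using that is_chart_line by (auto simp: line_atlas_def)
  show "(\<Union>c\<in>line_atlas A. fst c) = UNIV"
    using A unfolding smooth_atlas_def line_atlas_def by (auto simp: set_eq_iff)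
  fix c' d' assume "c' \<in> line_atlas A" "d' \<in> line_atlas A"
  then obtain c d where c: "c \<in> A" "c' = line_chart c" and d: "d \<in> A" "d' = line_chart d"
    by (auto simp: line_atlas_def)
  let ?W = "{w :: ('p \<times> real) \<times> 'q. fst (untwist w) \<in> overlap c d}"
  have "open (overlap c d)"
    unfolding overlap_def by (rule chart_image_open[OF A c(1) smooth_atlas_chart(1)[OF A d(1)]])
  then have W: "open ?W" by (rule open_fst_untwist)
  have tr: "smooth_on (overlap c d) (transition c d)"
    using A c(1) d(1) unfolding smooth_atlas_def by blast
  have u: "smooth_on ?W untwist" by (rule smooth_on_bounded_linear[OF bounded_linear_untwist])
  have "smooth_on ?W (\<lambda>w. twist (transition c d (fst (untwist w)), snd (untwist w)))"
    by (intro smooth_on_bounded_linear_compose[OF bounded_linear_twist W] smooth_on_Pair W smooth_on_snd u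
        smooth_on_compose[OF fin W smooth_on_fst[OF W u] _ tr]) simp
  then show "smooth_on (overlap c' d') (transition c' d')"
    unfolding c d overlap_line
    by (rule smooth_on_cong) (simp add: transition_line[OF c(1)] overlap_line)
qed

end

lemma foliated_atlas_line:
  fixes A :: "('a::{t2_space,second_countable_topology}, 'p::real_normed_vector \<times> 'q::real_normed_vector) chart set"
  assumes A: "foliated_atlas A"
  shows "foliated_atlas (line_atlas A)"
  unfolding foliated_atlas_def
proof (intro conjI ballI)
  note sm = foliated_atlas_smooth[OF A]
  show "smooth_atlas (line_atlas A)" by (rule smooth_atlas_line[OF sm])
  fix c' d' w assume "c' \<in> line_atlas A" "d' \<in> line_atlas A" and w: "w \<in> overlap c' d'"
  then obtain c d where c: "c \<in> A" "c' = line_chart c" and d: "d \<in> A" "d' = line_chart d"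
    by (auto simp: line_atlas_def)
  have "fst (untwist w) \<in> overlap c d" using w unfolding c(2) d(2) overlap_line by simp
  then obtain V g where V: "open V" "fst (untwist w) \<in> V" "V \<subseteq> overlap c d"
    "\<forall>w\<in>V. snd (transition c d w) = g (snd w)"
    using A c(1) d(1) unfolding foliated_atlas_def by meson
  let ?V = "{w :: ('p \<times> real) \<times> 'q. fst (untwist w) \<in> V}"
  have "open ?V" by (rule open_fst_untwist[OF V(1)])
  moreover have sub: "?V \<subseteq> overlap c' d'"
    unfolding c(2) d(2) overlap_line using V(3) by blast
  moreover have "\<forall>w\<in>?V. snd (transition c' d' w) = g (snd w)"
  proof
    fix w assume w: "w \<in> ?V"
    then have "snd (transition c' d' w) = snd (transition c d (fst (untwist w)))"
      using transition_line[OF sm c(1), of w d] sub unfolding c(2) d(2) by auto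
    then show "snd (transition c' d' w) = g (snd w)" using V(4) w by simp
  qed
  ultimately show "\<exists>V g. open V \<and> w \<in> V \<and> V \<subseteq> overlap c' d' \<and> (\<forall>w\<in>V. snd (transition c' d' w) = g (snd w))"
    using V(2) by blast
qed

text \<open>Transitions of the product act on the factor \<open>\<real>\<close> as the identity.
  Hence the unit time vectors of different charts define the same tangent vector.\<close>

lemma fd_transition_line_time:
  assumes A: "smooth_atlas A" and c: "c \<in> A" "x \<in> fst c" and d: "d \<in> A" "x \<in> fst d"
  shows "fd (transition (line_chart c) (line_chart d)) (snd (line_chart c) (x, t)) ((0, s), 0) = ((0, s), 0)"
proof -
  let ?w = "snd (line_chart c) (x, t)"
  let ?W = "overlap (line_chart c) (line_chart d)"
  have "open (overlap c d)"
    unfolding overlap_def by (rule chart_image_open[OF A c(1) smooth_atlas_chart(1)[OF A d(1)]])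
  then have W: "open ?W" unfolding overlap_line by (rule open_fst_untwist)
  have w: "?w \<in> ?W" unfolding overlap_line using c d by (auto simp: overlap_def)
  have "fd (transition (line_chart c) (line_chart d)) ?w
    = fd (\<lambda>w. twist (transition c d (fst (untwist w)), snd (untwist w))) ?w"
    by (rule fd_cong[OF W w]) (rule transition_line[OF A c(1)])
  also have "\<dots> = (\<lambda>h. twist (fd (transition c d) (snd c x) (fst (untwist h)), snd (untwist h)))"
  proof (rule fd_eq)
    have u: "(untwist has_derivative untwist) (at ?w)"
      by (rule bounded_linear.has_derivative[OF bounded_linear_untwist has_derivative_ident])
    have "fst (untwist ?w) = snd c x" by simp
    then have tr: "(transition c d has_derivative fd (transition c d) (snd c x)) (at (fst (untwist ?w)))"
      using has_derivative_fd[OF transition_differentiable[OF A c d]] by simp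
    show "((\<lambda>w. twist (transition c d (fst (untwist w)), snd (untwist w))) has_derivative
      (\<lambda>h. twist (fd (transition c d) (snd c x) (fst (untwist h)), snd (untwist h)))) (at ?w)"
      by (intro bounded_linear.has_derivative[OF bounded_linear_twist] has_derivative_Pair
          has_derivative_snd u has_derivative_compose[OF has_derivative_fst[OF u] tr])
  qed
  finally show ?thesis
    using linear_0[OF linear_fd[OF transition_differentiable[OF A c d]]]
    by (simp add: zero_prod_def twist_apply)
qed

section \<open>Inclusions of the time slices into the product\<close>

definition at_time :: "real \<Rightarrow> 'a \<Rightarrow> 'a \<times> real" where
  "at_time t = (\<lambda>x. (x, t))"

lemma coord_map_at_time: "coord_map c (line_chart d) (at_time t) u = twist (transition c d u, t)"
  by (simp add: at_time_def transition_def)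

lemma coord_dom_at_time: "coord_dom c (line_chart d) (at_time t) = overlap c d"
  by (auto simp: at_time_def overlap_def)

lemma smooth_map_at_time:
  assumes A: "smooth_atlas A"
  shows "smooth_map A (line_atlas A) (at_time t)"
  unfolding smooth_map_def
proof (intro conjI ballI)
  show "continuous_on UNIV (at_time t)" unfolding at_time_def by (intro continuous_intros)
  fix c d' assume c: "c \<in> A" and "d' \<in> line_atlas A"
  then obtain d where d: "d \<in> A" "d' = line_chart d" by (auto simp: line_atlas_def)
  have W: "open (overlap c d)"
    unfolding overlap_def by (rule chart_image_open[OF A c smooth_atlas_chart(1)[OF A d(1)]])
  have "smooth_on (overlap c d) (transition c d)"
    using A c d(1) unfolding smooth_atlas_def by blast
  then have "smooth_on (overlap c d) (\<lambda>u. twist (transition c d u, t))"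
    by (intro smooth_on_bounded_linear_compose[OF bounded_linear_twist W] smooth_on_Pair W smooth_on_const)
  then show "smooth_on (coord_dom c d' (at_time t)) (coord_map c d' (at_time t))"
    unfolding d coord_dom_at_time by (rule smooth_on_cong) (simp only: coord_map_at_time)
qed

lemma fd_at_time:
  assumes A: "smooth_atlas A" and c: "c \<in> A" "x \<in> fst c"
  shows "fd (coord_map c (line_chart c) (at_time t)) (snd c x) v = twist (v, 0)"
proof -
  have 1: "fd (\<lambda>u. twist (u, t)) (snd c x) v = twist (v, 0)"
  proof -
    have "((\<lambda>u. twist (u, t)) has_derivative (\<lambda>v. twist (v, 0))) (at (snd c x))"
      by (intro bounded_linear.has_derivative[OF bounded_linear_twist] has_derivative_Pair
          has_derivative_ident has_derivative_const)
    then show ?thesis by (simp only: fd_eq)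
  qed
  have "fd (coord_map c (line_chart c) (at_time t)) (snd c x) = fd (\<lambda>u. twist (u, t)) (snd c x)"
  proof (rule fd_cong[OF smooth_atlas_chart(2)[OF A c(1)]])
    show "snd c x \<in> snd c ` fst c" using c by blast
    show "coord_map c (line_chart c) (at_time t) u = twist (u, t)" if "u \<in> snd c ` fst c" for u
      using smooth_atlas_chart(6)[OF A c(1) that] by (simp add: at_time_def)
  qed
  then show ?thesis using 1 by simp
qed

lemma tangential_at_time:
  assumes A: "foliated_atlas A"
  shows "tangential A (line_atlas A) (at_time t)"
proof (rule tangentialI[OF A foliated_atlas_line[OF A] smooth_map_at_time[OF foliated_atlas_smooth[OF A]]])
  fix x
  note sm = foliated_atlas_smooth[OF A]
  obtain c where c: "c \<in> A" "x \<in> fst c" using smooth_atlas_covers[OF sm] .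
  have "at_time t x \<in> fst (line_chart c)" "line_chart c \<in> line_atlas A"
    using c by (auto simp: at_time_def line_atlas_def)
  moreover have "snd (fd (coord_map c (line_chart c) (at_time t)) (snd c x) (v, 0)) = 0" for v
    unfolding fd_at_time[OF sm c] by simp
  ultimately show "\<exists>c\<in>A. \<exists>d\<in>line_atlas A. x \<in> fst c \<and> at_time t x \<in> fst d \<and>
      (\<forall>v. snd (fd (coord_map c d (at_time t)) (snd c x) (v, 0)) = 0)"
    using c by blast
qed

lemma differential_at_time:
  assumes A: "foliated_atlas A" and c: "c \<in> A" "x \<in> fst c"
  shows "differential A (line_atlas A) (at_time t) x (tvec_of A c x (v, 0))
    = tvec_of (line_atlas A) (line_chart c) (x, t) ((v, 0), 0)"
proof -
  note sm = foliated_atlas_smooth[OF A]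
  have d: "line_chart c \<in> line_atlas A" "at_time t x \<in> fst (line_chart c)"
    using c by (auto simp: at_time_def line_atlas_def)
  show ?thesis
    unfolding differential_tvec_of[OF A foliated_atlas_line[OF A] tangential_at_time[OF A] c d]
      fd_at_time[OF sm c] by (simp add: at_time_def twist_apply)
qed

subsection \<open>Homotopies as maps of the product\<close>

text \<open>Projecting away the time keeps the connecting set connected and leaves its transverse
  coordinate unchanged.\<close>

lemma same_plaque_line:
  assumes "same_plaque (line_atlas A) (x, t) (y, s)"
  shows "same_plaque A x y"
proof -
  obtain c where c: "c \<in> A" "x \<in> fst c" "y \<in> fst c" and
    K: "connected_component {u \<in> snd (line_chart c) ` fst (line_chart c). snd u = snd (snd (line_chart c) (x, t))}
      (snd (line_chart c) (x, t)) (snd (line_chart c) (y, s))"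
    using assms unfolding same_plaque_def line_atlas_def by auto
  then obtain K where K: "connected K"
    "K \<subseteq> {u \<in> snd (line_chart c) ` fst (line_chart c). snd u = snd (snd (line_chart c) (x, t))}"
    "snd (line_chart c) (x, t) \<in> K" "snd (line_chart c) (y, s) \<in> K"
    unfolding connected_component_def by blast
  let ?\<pi> = "\<lambda>w. fst (untwist w)"
  have "connected (?\<pi> ` K)"
    by (intro connected_continuous_image K(1) continuous_on_fst continuous_on_untwist continuous_on_id)
  moreover have "?\<pi> ` K \<subseteq> {u \<in> snd c ` fst c. snd u = snd (snd c x)}"
  proof
    fix u assume "u \<in> ?\<pi> ` K"
    then obtain w where w: "w \<in> K" "u = ?\<pi> w" by blast
    then show "u \<in> {u \<in> snd c ` fst c. snd u = snd (snd c x)}"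
      using subsetD[OF K(2)[unfolded line_chart_image] w(1)] by simp
  qed
  moreover have "snd c x \<in> ?\<pi> ` K" "snd c y \<in> ?\<pi> ` K"
    using imageI[OF K(3), of ?\<pi>] imageI[OF K(4), of ?\<pi>] by simp_all
  ultimately show ?thesis
    using c unfolding same_plaque_def connected_component_def by blast
qed

text \<open>Reparametrizing the time by \<open>t \<mapsto> (1 + cos (\<pi> t)) / 2\<close> extends a homotopy over \<open>[0, 1]\<close>
  to all real times; it is run backwards.\<close>

lemma homotopy_on_line:
  fixes A :: "('a::{t2_space,second_countable_topology}, 'p::real_normed_vector \<times> 'q::real_normed_vector) chart set"
    and A' :: "('b::{t2_space,second_countable_topology}, 'r::real_normed_vector \<times> 's::real_normed_vector) chart set"
  assumes A: "foliated_atlas A" "foliated_atlas A'" and hom: "foliated_homotopic A A' f0 f1"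
  obtains F where "tangential (line_atlas A) A' F" "F \<circ> at_time 0 = f1" "F \<circ> at_time 1 = f0"
proof -
  note sm = foliated_atlas_smooth[OF A(1)] foliated_atlas_smooth[OF A(2)]
  obtain G :: "'a \<times> real \<Rightarrow> 'b" where G: "continuous_on (UNIV \<times> {0..1}) G"
    and 1: "\<forall>c\<in>A. \<forall>d\<in>A'. smooth_on
      {(u, t). u \<in> snd c ` fst c \<and> t \<in> {0..1} \<and> G (inv_chart c u, t) \<in> fst d}
      (\<lambda>(u, t). snd d (G (inv_chart c u, t)))"
    and 2: "\<forall>x. G (x, 0) = f0 x \<and> G (x, 1) = f1 x"
    and 3: "\<forall>t\<in>{0..1}. \<forall>x. (\<lambda>y. G (y, t)) ` leaf A x \<subseteq> leaf A' (G (x, t))"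
    and 4: "\<forall>x. \<forall>t1\<in>{0..1}. \<forall>t2\<in>{0..1}. G (x, t2) \<in> leaf A' (G (x, t1))"
    using hom unfolding foliated_homotopic_def by (elim conjE exE)
  note Gs = bspec[OF bspec[OF 1]]
  have G01: "G (x, 0) = f0 x" "G (x, 1) = f1 x" for x using 2 by simp_all
  have Gl: "G (y, t) \<in> leaf A' (G (x, t))" if "t \<in> {0..1}" "y \<in> leaf A x" for t x y
    using bspec[OF 3 that(1)] that(2) by blast
  have Gt: "G (x, t2) \<in> leaf A' (G (x, t1))" if "t1 \<in> {0..1}" "t2 \<in> {0..1}" for x t1 t2
    using 4 that by simp
  define \<sigma> :: "real \<Rightarrow> real" where "\<sigma> = (\<lambda>t. 1 / 2 + 1 / 2 * cos (pi * t))"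
  have \<sigma>: "\<sigma> t \<in> {0..1}" for t
    using cos_ge_minus_one[of "pi * t"] cos_le_one[of "pi * t"]
    unfolding \<sigma>_def atLeastAtMost_iff by (intro conjI; linarith)
  have \<sigma>c: "continuous_on S \<sigma>" for S unfolding \<sigma>_def by (intro continuous_intros)
  have \<sigma>s: "smooth_on UNIV \<sigma>"
    unfolding \<sigma>_def
    by (intro smooth_on_add smooth_on_mult smooth_on_const open_UNIV
        smooth_on_compose[OF finite_dim_real open_UNIV _ UNIV_I smooth_on_cos] smooth_on_ident)
  define F where "F = (\<lambda>(x, t). G (x, \<sigma> t))"
  have Fc: "continuous_on UNIV F"
  proof -
    have "continuous_on UNIV (\<lambda>p :: 'a \<times> real. (fst p, \<sigma> (snd p)))"
      by (intro continuous_on_Pair continuous_intros continuous_on_compose2[OF \<sigma>c[of UNIV]]) auto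
    then have "continuous_on UNIV (\<lambda>p. G (fst p, \<sigma> (snd p)))"
      by (rule continuous_on_compose2[OF G]) (use \<sigma> in auto)
    then show ?thesis by (simp add: F_def case_prod_beta)
  qed
  have Fs: "smooth_map (line_atlas A) A' F"
    unfolding smooth_map_def
  proof (intro conjI ballI Fc)
    fix c' d assume c': "c' \<in> line_atlas A" and d: "d \<in> A'"
    then obtain c where c: "c \<in> A" "c' = line_chart c" by (auto simp: line_atlas_def)
    let ?W = "coord_dom c' d F"
    let ?S = "{(u, t). u \<in> snd c ` fst c \<and> t \<in> {0..1} \<and> G (inv_chart c u, t) \<in> fst d}"
    let ?\<psi> = "\<lambda>w. (fst (untwist w), \<sigma> (snd (untwist w)))"
    have W: "open ?W"
      by (rule chart_image_open[OF smooth_atlas_line[OF sm(1)] c'])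
        (rule open_vimage[OF smooth_atlas_chart(1)[OF sm(2) d] Fc])
    have u: "smooth_on ?W untwist" by (rule smooth_on_bounded_linear[OF bounded_linear_untwist])
    have mem: "fst (untwist w) \<in> snd c ` fst c \<and> F (inv_chart c' w) \<in> fst d" if "w \<in> ?W" for w
    proof -
      note * = iffD1[OF chart_image_mem[OF smooth_atlas_line[OF sm(1)] c'] that]
      have "w \<in> {w. fst (untwist w) \<in> snd c ` fst c}"
        using conjunct1[OF *] unfolding c(2) line_chart_image .
      then show ?thesis using conjunct2[OF *] by simp
    qed
    have inv: "F (inv_chart c' w) = G (inv_chart c (fst (untwist w)), \<sigma> (snd (untwist w)))" if "w \<in> ?W" for w
      using inv_line_chart[OF sm(1) c(1)] mem[OF that] c(2) by (simp add: F_def)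
    have "smooth_on ?W (\<lambda>w. (\<lambda>(u, t). snd d (G (inv_chart c u, t))) (?\<psi> w))"
    proof (rule smooth_on_compose[OF finite_dim_prod[OF smooth_atlas_finite_dim[OF sm(1)] finite_dim_real] W _ _ Gs[OF c(1) d]])
      show "smooth_on ?W ?\<psi>"
        by (intro smooth_on_Pair W smooth_on_fst u
            smooth_on_compose[OF finite_dim_real W smooth_on_snd[OF W u] UNIV_I \<sigma>s])
      show "?\<psi> w \<in> ?S" if "w \<in> ?W" for w
        using mem[OF that] inv[OF that] \<sigma> by auto
    qed
    then show "smooth_on ?W (coord_map c' d F)"
      by (rule smooth_on_cong) (use inv in simp)
  qed
  have "tangential (line_atlas A) A' F"
  proof (rule tangentialI_leaf[OF foliated_atlas_line[OF A(1)] A(2) Fs])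
    fix p q assume pq: "same_plaque (line_atlas A) p q"
    obtain x t y s where p: "p = (x, t)" "q = (y, s)" by fastforce
    have "y \<in> leaf A x" by (rule leaf_same_plaque[OF same_plaque_line[OF pq[unfolded p]]])
    \<comment> \<open>From \<open>x\<close> to \<open>y\<close> at a fixed time the image stays in
      its leaf because the maps are foliated; then the time changes at the fixed point
      \<open>y\<close>, where the second condition on a leafwise homotopy applies.\<close>
    then have "G (y, \<sigma> s) \<in> leaf A' (G (x, \<sigma> t))"
      by (rule leaf_trans[OF Gl[OF \<sigma>] Gt[OF \<sigma> \<sigma>]])
    then show "F q \<in> leaf A' (F p)" unfolding p F_def by simp
  qed
  moreover have "F \<circ> at_time 0 = f1" "F \<circ> at_time 1 = f0"
    by (auto simp: F_def at_time_def \<sigma>_def G01)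
  ultimately show ?thesis by (rule that)
qed

section \<open>Integration along the real line\<close>

lemma has_derivative_time:
  assumes "a differentiable (at (u, t))"
  shows "((\<lambda>t. a (u, t)) has_vector_derivative fd a (u, t) (0, 1)) (at t)"
  using has_derivative_line[of a "(u, 0)" t "(0, 1)"] assms by simp

text \<open>The integrand of the primitive from 0 to \<open>t\<close> after the substitution
  \<open>r = t * s\<close>. The limits of integration become 0 and 1, so the results on parametric
  integrals apply jointly in \<open>u\<close> and \<open>t\<close>, for \<open>t\<close> of any
  sign.\<close>

lemma smooth_on_scaled_time:
  fixes a :: "'e::real_normed_vector \<times> real \<Rightarrow> real"
  assumes fin: "finite_dim TYPE('e)" and W: "open W" and a: "smooth_on (W \<times> UNIV) a"
  shows "smooth_on ((W \<times> UNIV) \<times> UNIV) (\<lambda>p. snd (fst p) * a (fst (fst p), snd (fst p) * snd p))"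
proof -
  let ?V = "(W \<times> (UNIV :: real set)) \<times> (UNIV :: real set)"
  have V: "open ?V" using W by (simp add: open_Times)
  show ?thesis
    by (intro smooth_on_mult V smooth_on_snd smooth_on_fst smooth_on_ident
        smooth_on_compose[OF finite_dim_prod[OF fin finite_dim_real] V _ _ a] smooth_on_Pair) auto
qed

text \<open>The radial primitive \<open>\<integral>\<^sub>0\<^sup>1 t a(u, t s) ds\<close>: both derivatives are computed under the integral
  sign, where the integrand turns into the \<open>s\<close>-derivative of \<open>s a(u, t s)\<close> and of
  \<open>b(u, t s)\<close>, respectively.\<close>

lemma time_primitive:
  fixes a b :: "'e::real_normed_vector \<times> real \<Rightarrow> real"
  assumes fin: "finite_dim TYPE('e)" and W: "open W" and a: "smooth_on (W \<times> UNIV) a"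
    and u: "u \<in> W"
  defines "h \<equiv> \<lambda>p. integral {0..1} (\<lambda>s. snd p * a (fst p, snd p * s))"
  shows "smooth_on (W \<times> UNIV) h"
    and "fd h (u, t) (0, 1) = a (u, t)"
    and "smooth_on (W \<times> UNIV) b \<Longrightarrow> (\<And>t. fd b (u, t) (0, 1) = fd a (u, t) (v, 0)) \<Longrightarrow>
      fd h (u, t) (v, 0) = b (u, t) - b (u, 0)"
proof -
  let ?k = "\<lambda>p. snd (fst p) * a (fst (fst p), snd (fst p) * snd p)"
  have fin': "finite_dim TYPE('e \<times> real)" by (rule finite_dim_prod[OF fin finite_dim_real])
  have WU: "open (W \<times> (UNIV :: real set))" using W by (simp add: open_Times)
  note k = smooth_on_scaled_time[OF fin W a]
  have h: "h = (\<lambda>p. integral {0..1} (\<lambda>s. ?k (p, s)))" by (simp add: h_def)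
  show "smooth_on (W \<times> UNIV) h"
    unfolding h by (rule smooth_on_parametric_integral[OF fin' WU k])
  have ad: "a differentiable (at (u, t))" for t
    using smooth_on_differentiable[OF WU a] u by blast
  have fdk: "fd ?k ((u, t), s) ((w, r), 0) = t * fd a (u, t * s) (w, r * s) + r * a (u, t * s)" for t s w r
  proof -
    have "((\<lambda>p. (fst (fst p), snd (fst p) * snd p)) has_derivative
      (\<lambda>q. (fst (fst q), snd (fst ((u, t), s)) * snd q + snd (fst q) * snd ((u, t), s)))) (at ((u, t), s))"
      by (intro has_derivative_Pair has_derivative_mult has_derivative_fst has_derivative_snd has_derivative_ident)
    from has_derivative_compose[OF this, of a "fd a (u, t * s)"]
    have "((\<lambda>p. a (fst (fst p), snd (fst p) * snd p)) has_derivative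
      (\<lambda>q. fd a (u, t * s) (fst (fst q), t * snd q + snd (fst q) * s))) (at ((u, t), s))"
      using has_derivative_fd[OF ad, of "t * s"] by simp
    then have "(?k has_derivative (\<lambda>q. snd (fst ((u, t), s)) * fd a (u, t * s) (fst (fst q), t * snd q + snd (fst q) * s)
        + snd (fst q) * a (fst (fst ((u, t), s)), snd (fst ((u, t), s)) * snd ((u, t), s)))) (at ((u, t), s))"
      by (intro has_derivative_mult has_derivative_fst has_derivative_snd has_derivative_ident)
    from fd_eq[OF this] show ?thesis by simp
  qed
  have "(u, t) \<in> W \<times> UNIV" for t :: real using u by simp
  note dh = fd_eq[OF has_derivative_parametric_integral[OF fin' WU k this]]
  have fdh: "fd h (u, t) (w, r) = integral {0..1} (\<lambda>s. t * fd a (u, t * s) (w, r * s) + r * a (u, t * s))" for t w r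
    unfolding h by (simp only: dh fdk)
  have ts: "((\<lambda>s. b (u, t * s)) has_vector_derivative t * fd b (u, t * s) (0, 1)) (at s)"
    if b: "\<And>t. b differentiable (at (u, t))" for b :: "'e \<times> real \<Rightarrow> real" and s t
  proof -
    have "((\<lambda>s. t * s) has_vector_derivative t) (at s)"
      by (auto intro!: derivative_eq_intros)
    from vector_diff_chain_at[OF this has_derivative_time[OF b]]
    show ?thesis by (simp add: o_def)
  qed
  show "fd h (u, t) (0, 1) = a (u, t)"
  proof -
    have "((\<lambda>s. t * fd a (u, t * s) (0, 1 * s) + 1 * a (u, t * s)) has_integral
      1 * a (u, t * 1) - 0 * a (u, t * 0)) {0..1}"
    proof (rule fundamental_theorem_of_calculus)
      fix s :: real
      have "((\<lambda>s. s * a (u, t * s)) has_vector_derivative s * (t * fd a (u, t * s) (0, 1)) + 1 * a (u, t * s)) (at s)"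
        by (intro has_vector_derivative_mult has_vector_derivative_id ts ad)
      moreover have "fd a (u, t * s) (0, 1 * s) = s * fd a (u, t * s) (0, 1)"
        using linear_scale[OF linear_fd[OF ad], of "t * s" s "(0, 1)"] by simp
      ultimately show "((\<lambda>s. s * a (u, t * s)) has_vector_derivative
          t * fd a (u, t * s) (0, 1 * s) + 1 * a (u, t * s)) (at s within {0..1})"
        by (auto intro: has_vector_derivative_at_within simp: algebra_simps)
    qed simp
    then show ?thesis unfolding fdh by (simp add: integral_unique)
  qed
  show "fd h (u, t) (v, 0) = b (u, t) - b (u, 0)"
    if b: "smooth_on (W \<times> UNIV) b" and ab: "\<And>t. fd b (u, t) (0, 1) = fd a (u, t) (v, 0)"
  proof -
    have bd: "b differentiable (at (u, t))" for t
      using smooth_on_differentiable[OF WU b] u by blast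
    have "((\<lambda>s. t * fd b (u, t * s) (0, 1)) has_integral b (u, t * 1) - b (u, t * 0)) {0..1}"
      by (rule fundamental_theorem_of_calculus) (auto intro!: has_vector_derivative_at_within ts bd)
    from integral_unique[OF this] show ?thesis unfolding fdh by (simp add: ab)
  qed
qed

text \<open>Used with the time vector as first argument: the remaining places shift by one, whence
  the minus sign. The next lemma is the same expansion for the wedge product.\<close>

lemma coord_d_Cons:
  "coord_d D (v # vs) w = fd (D vs) w (v, 0)
    - (\<Sum>i<length vs. (-1) ^ i * fd (D (v # del_nth i vs)) w (vs ! i, 0))"
  by (simp only: coord_d_def length_Cons sum.lessThan_Suc_shift del_nth_Cons_0 del_nth_Cons_Suc)
    (simp add: sum_negf)

lemma wedge1_Cons:
  "wedge1 \<omega> \<alpha> x (X # Xs) = \<omega> x [X] * \<alpha> x Xs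
    - (\<Sum>i<length Xs. (-1) ^ i * \<omega> x [Xs ! i] * \<alpha> x (X # del_nth i Xs))"
  by (simp only: wedge1_def length_Cons sum.lessThan_Suc_shift del_nth_Cons_0 del_nth_Cons_Suc)
    (simp add: sum_negf)

section \<open>Integration of forms along the fibre and Stokes' formula\<close>

definition time_vec :: "('a, 'p::real_normed_vector \<times> 'q::real_normed_vector) chart set \<Rightarrow> 'a \<Rightarrow> real \<Rightarrow>
    ('a \<times> real, ('p \<times> real) \<times> 'q) tvec" where
  "time_vec A x t = tvec_of (line_atlas A) (line_chart (chart_at A x)) (x, t) ((0, 1), 0)"

abbreviation lift where "lift A t x \<equiv> differential A (line_atlas A) (at_time t) x"

lemma line_chart_mem: "c \<in> A \<Longrightarrow> x \<in> fst c \<Longrightarrow> line_chart c \<in> line_atlas A \<and> (x, t) \<in> fst (line_chart c)"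
  by (simp add: line_atlas_def)

text \<open>Contraction with the time field, inserted in the first place, followed by integration
  over the unit interval. This place makes Stokes' formula come out without a sign depending on the
  degree.\<close>

definition fiber_integral :: "('a, 'p::real_normed_vector \<times> 'q::real_normed_vector) chart set \<Rightarrow>
    ('a \<times> real, ('p \<times> real) \<times> 'q) form \<Rightarrow> ('a, 'p \<times> 'q) form" where
  "fiber_integral A \<gamma> = (\<lambda>x Xs. if set Xs \<subseteq> leaf_tangent_space A x
    then integral {0..1} (\<lambda>t. \<gamma> (x, t) (time_vec A x t # map (lift A t x) Xs)) else 0)"

context
  fixes A :: "('a::{t2_space,second_countable_topology}, 'p::real_normed_vector \<times> 'q::real_normed_vector) chart set"
  assumes A: "foliated_atlas A"
begin

lemmas atlas_smooth = foliated_atlas_smooth[OF A]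
lemmas line_foliated = foliated_atlas_line[OF A]
lemmas line_smooth = foliated_atlas_smooth[OF foliated_atlas_line[OF A]]

lemma time_vec_eq:
  assumes c: "c \<in> A" "x \<in> fst c"
  shows "time_vec A x t = tvec_of (line_atlas A) (line_chart c) (x, t) ((0, 1), 0)"
proof -
  note c0 = chart_at[OF atlas_smooth, of x]
  have 0: "line_chart (chart_at A x) \<in> line_atlas A" "(x, t) \<in> fst (line_chart (chart_at A x))"
    using line_chart_mem[OF c0] by auto
  have 1: "line_chart c \<in> line_atlas A" "(x, t) \<in> fst (line_chart c)"
    using line_chart_mem[OF c] by auto
  have "time_vec A x t (line_chart c) = ((0, 1), 0)"
    using fd_transition_line_time[OF atlas_smooth c0 c] 1 by (simp add: time_vec_def tvec_of_def)
  then show ?thesis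
    using tangent_eq_tvec_of[OF tvec_of_tangent[OF line_smooth 0] 1, of "((0, 1), 0)"] by (simp add: time_vec_def)
qed

lemma time_vec_leaf_tangent: "time_vec A x t \<in> leaf_tangent_space (line_atlas A) (x, t)"
proof -
  note c0 = chart_at[OF atlas_smooth, of x]
  show ?thesis
    unfolding time_vec_def
    by (rule tvec_of_leaf_tangent[OF line_foliated]) (use line_chart_mem[OF c0] in auto)
qed

lemma lift_leaf_tangent:
  assumes "X \<in> leaf_tangent_space A x"
  shows "lift A t x X \<in> leaf_tangent_space (line_atlas A) (x, t)"
  using tangential_at_time[OF A, of t] assms unfolding tangential_def by (auto simp: at_time_def)

lemma lift_eq:
  assumes X: "X \<in> leaf_tangent_space A x" and c: "c \<in> A" "x \<in> fst c"
  shows "lift A t x X = tvec_of (line_atlas A) (line_chart c) (x, t) ((fst (X c), 0), 0)"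
  using differential_at_time[OF A c, of t "fst (X c)"] leaf_tangent_eq(2)[OF X c] by simp

lemma lift_chart:
  assumes c: "c \<in> A" "x \<in> fst c"
  shows "time_vec A x t (line_chart c) = ((0, 1), 0)"
    "X \<in> leaf_tangent_space A x \<Longrightarrow> lift A t x X (line_chart c) = ((fst (X c), 0), 0)"
  using lift_eq[OF _ c] time_vec_eq[OF c] line_chart_mem[OF c] by (simp_all add: tvec_of_chart[OF line_smooth])

lemma map_lift_eq:
  assumes X: "set Xs \<subseteq> leaf_tangent_space A x" and c: "c \<in> A" "x \<in> fst c"
  shows "map (lift A t x) Xs = map (\<lambda>w. tvec_of (line_atlas A) (line_chart c) (x, t) (w, 0))
    (map (\<lambda>X. (fst (X c), 0)) Xs)"
  using X lift_eq[OF _ c] by auto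

lemma line_form_in_chart:
  assumes c: "c \<in> A" "x \<in> fst c"
  shows "form_in_chart (line_atlas A) \<gamma> (line_chart c) ws (twist (snd c x, t))
    = \<gamma> (x, t) (map (\<lambda>w. tvec_of (line_atlas A) (line_chart c) (x, t) (w, 0)) ws)"
  using inv_line_chart_twist[OF atlas_smooth c(1), of "snd c x" t] c smooth_atlas_chart(5)[OF atlas_smooth c]
  by (simp add: form_in_chart_def)

text \<open>The time vector and the lifts are constant in a product chart. Values of forms on them
  become coordinate functions with constant arguments, which can be integrated in \<open>t\<close>
  and differentiated in \<open>u\<close>.\<close>

lemma line_form_lift:
  assumes X: "set Xs \<subseteq> leaf_tangent_space A x" and c: "c \<in> A" "x \<in> fst c"
  shows "\<gamma> (x, t) (map (lift A t x) Xs)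
      = form_in_chart (line_atlas A) \<gamma> (line_chart c) (map (\<lambda>X. (fst (X c), 0)) Xs) (twist (snd c x, t))"
    and "\<gamma> (x, t) (time_vec A x t # map (lift A t x) Xs)
      = form_in_chart (line_atlas A) \<gamma> (line_chart c) ((0, 1) # map (\<lambda>X. (fst (X c), 0)) Xs) (twist (snd c x, t))"
  unfolding line_form_in_chart[OF c] map_lift_eq[OF X c] time_vec_eq[OF c] by simp_all

lemma line_form_smooth:
  assumes \<gamma>: "\<gamma> \<in> leaf_forms (line_atlas A) k" and c: "c \<in> A"
  shows "smooth_on (snd c ` fst c \<times> UNIV) (\<lambda>p. form_in_chart (line_atlas A) \<gamma> (line_chart c) ws (twist p))"
proof (rule smooth_on_compose[OF smooth_atlas_finite_dim[OF line_smooth] _ smooth_on_bounded_linear[OF bounded_linear_twist]])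
  show "open (snd c ` fst c \<times> (UNIV :: real set))"
    using smooth_atlas_chart(2)[OF atlas_smooth c] by (simp add: open_Times)
  show "smooth_on (snd (line_chart c) ` fst (line_chart c)) (form_in_chart (line_atlas A) \<gamma> (line_chart c) ws)"
    by (rule form_in_chart_smooth[OF \<gamma>]) (use c in \<open>simp add: line_atlas_def\<close>)
  show "twist p \<in> snd (line_chart c) ` fst (line_chart c)" if "p \<in> snd c ` fst c \<times> UNIV" for p
    unfolding line_chart_image using that by auto
qed

lemma line_form_differentiable:
  assumes \<gamma>: "\<gamma> \<in> leaf_forms (line_atlas A) k" and c: "c \<in> A" "x \<in> fst c"
  shows "form_in_chart (line_atlas A) \<gamma> (line_chart c) ws differentiable (at (twist (snd c x, t)))"
  using form_in_chart_differentiable[OF line_smooth \<gamma>, of "line_chart c" "(x, t)"] line_chart_mem[OF c] by simp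

lemma fd_line_form:
  assumes \<gamma>: "\<gamma> \<in> leaf_forms (line_atlas A) k" and c: "c \<in> A" "x \<in> fst c"
  shows "fd (\<lambda>p. form_in_chart (line_atlas A) \<gamma> (line_chart c) ws (twist p)) (snd c x, t) q
    = fd (form_in_chart (line_atlas A) \<gamma> (line_chart c) ws) (twist (snd c x, t)) (twist q)"
proof -
  have tw: "(twist has_derivative twist) (at (snd c x, t))"
    by (rule bounded_linear.has_derivative[OF bounded_linear_twist has_derivative_ident])
  show ?thesis
    using fd_compose[OF differentiableI[OF tw] line_form_differentiable[OF \<gamma> c]] by (simp add: fd_eq[OF tw])
qed

text \<open>Presents the coefficients of the fibre integral as parametric integrals; their
  smoothness and derivatives are then known.\<close>

lemma fiber_integral_in_chart:
  assumes c: "c \<in> A" and u: "u \<in> snd c ` fst c"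
  shows "form_in_chart A (fiber_integral A \<gamma>) c vs u = integral {0..1}
    (\<lambda>t. form_in_chart (line_atlas A) \<gamma> (line_chart c) ((0, 1) # map (\<lambda>v. (v, 0)) vs) (twist (u, t)))"
proof -
  obtain x where x: "x \<in> fst c" "u = snd c x" using u by blast
  let ?Xs = "map (\<lambda>v. tvec_of A c x (v, 0)) vs"
  have X: "set ?Xs \<subseteq> leaf_tangent_space A x" using tvec_of_leaf_tangent[OF A c x(1)] by auto
  have "map (\<lambda>X. (fst (X c), 0 :: real)) ?Xs = map (\<lambda>v. (v, 0)) vs"
    by (simp add: tvec_of_chart[OF atlas_smooth c x(1)])
  then have "\<gamma> (x, t) (time_vec A x t # map (lift A t x) ?Xs)
    = form_in_chart (line_atlas A) \<gamma> (line_chart c) ((0, 1) # map (\<lambda>v. (v, 0)) vs) (twist (u, t))" for t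
    using line_form_lift(2)[OF X c x(1), of \<gamma> t] x(2) by (simp only:)
  moreover have "form_in_chart A (fiber_integral A \<gamma>) c vs u = fiber_integral A \<gamma> x ?Xs"
    unfolding form_in_chart_def x(2) smooth_atlas_chart(5)[OF atlas_smooth c x(1)] ..
  ultimately show ?thesis using X by (simp only: fiber_integral_def if_True)
qed

lemma fiber_integrable:
  assumes \<gamma>: "\<gamma> \<in> leaf_forms (line_atlas A) k" and X: "set Xs \<subseteq> leaf_tangent_space A x"
  shows "(\<lambda>t. \<gamma> (x, t) (time_vec A x t # map (lift A t x) Xs)) integrable_on {0..1}"
proof -
  obtain c where c: "c \<in> A" "x \<in> fst c" using smooth_atlas_covers[OF atlas_smooth] .
  show ?thesis
    unfolding line_form_lift(2)[OF X c]
    by (rule integrable_parameter[OF smooth_atlas_chart(2)[OF atlas_smooth c(1)] line_form_smooth[OF \<gamma> c(1)]])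
      (use c in blast)
qed

lemma fiber_integral_leaf_forms:
  assumes \<gamma>: "\<gamma> \<in> leaf_forms (line_atlas A) (Suc k)"
  shows "fiber_integral A \<gamma> \<in> leaf_forms A k"
  unfolding leaf_forms_def
proof (intro CollectI conjI allI ballI impI)
  fix x
  let ?T = "leaf_tangent_space A x"
  let ?g = "\<lambda>Xs t. \<gamma> (x, t) (time_vec A x t # map (lift A t x) Xs)"
  note at = leaf_formsD(1)[OF \<gamma>]
  have L: "set (time_vec A x t # map (lift A t x) Xs) \<subseteq> leaf_tangent_space (line_atlas A) (x, t)"
    if "set Xs \<subseteq> ?T" for Xs t
    using that time_vec_leaf_tangent lift_leaf_tangent by auto
  have upd: "set (Xs[i := Y]) \<subseteq> ?T" if "set Xs \<subseteq> ?T" "Y \<in> ?T" for Xs i Y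
    using set_update_subset_insert[of Xs i Y] that by blast
  show "leaf_form_at A k x (fiber_integral A \<gamma> x)"
    unfolding leaf_form_at_def
  proof (intro conjI allI impI ballI; (elim conjE)?)
    fix Xs assume "\<not> (length Xs = k \<and> set Xs \<subseteq> ?T)"
    then show "fiber_integral A \<gamma> x Xs = 0"
      using leaf_forms_zero[OF \<gamma>] by (auto simp: fiber_integral_def)
  next
    fix Xs i Y Z and r s :: real
    assume X: "length Xs = k" "set Xs \<subseteq> ?T" "i < k" and Y: "Y \<in> ?T" and Z: "Z \<in> ?T"
    \<comment> \<open>Linearity of \<open>\<gamma>\<close> is used in place \<open>Suc i\<close>,
      because the time vector occupies place 0.\<close>
    have "?g (Xs[i := \<lambda>c. r *\<^sub>R Y c + s *\<^sub>R Z c]) t = r * ?g (Xs[i := Y]) t + s * ?g (Xs[i := Z]) t" for t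
      using leaf_form_at_linear[OF at[of "(x, t)"] _ L[OF X(2), of t] _ lift_leaf_tangent[OF Y, of t]
          lift_leaf_tangent[OF Z, of t], of "Suc i" r s] X
      by (simp add: map_update differential_lincomb[OF atlas_smooth line_smooth smooth_map_at_time[OF atlas_smooth]])
    moreover have "((\<lambda>t. r * ?g (Xs[i := Y]) t + s * ?g (Xs[i := Z]) t) has_integral
      r * integral {0..1} (?g (Xs[i := Y])) + s * integral {0..1} (?g (Xs[i := Z]))) {0..1}"
      by (intro has_integral_add has_integral_mult_right integrable_integral fiber_integrable[OF \<gamma>] upd X Y Z)
    ultimately have "integral {0..1} (?g (Xs[i := \<lambda>c. r *\<^sub>R Y c + s *\<^sub>R Z c]))
      = r * integral {0..1} (?g (Xs[i := Y])) + s * integral {0..1} (?g (Xs[i := Z]))"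
      by (simp add: integral_unique)
    then show "fiber_integral A \<gamma> x (Xs[i := \<lambda>c. r *\<^sub>R Y c + s *\<^sub>R Z c])
      = r * fiber_integral A \<gamma> x (Xs[i := Y]) + s * fiber_integral A \<gamma> x (Xs[i := Z])"
      using upd[OF X(2) Y, of i] upd[OF X(2) Z, of i] upd[OF X(2) leaf_tangent_space_lincomb[OF atlas_smooth Y Z], of i r s]
      by (simp add: fiber_integral_def)
  next
    fix Xs i j assume X: "length Xs = k" "set Xs \<subseteq> ?T" "j < k" "i < j" "Xs ! i = Xs ! j"
    have "?g Xs t = 0" for t
      by (rule leaf_form_at_alternating[OF at[of "(x, t)"] _ L[OF X(2), of t], of "Suc i" "Suc j"]) (use X in auto)
    then show "fiber_integral A \<gamma> x Xs = 0" by (simp add: fiber_integral_def)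
  qed
next
  fix c and vs :: "'p list" assume c: "c \<in> A"
  have "smooth_on (snd c ` fst c) (\<lambda>u. integral {0..1}
    (\<lambda>t. form_in_chart (line_atlas A) \<gamma> (line_chart c) ((0, 1) # map (\<lambda>v. (v, 0)) vs) (twist (u, t))))"
    by (rule smooth_on_parametric_integral[OF smooth_atlas_finite_dim[OF atlas_smooth] smooth_atlas_chart(2)[OF atlas_smooth c] line_form_smooth[OF \<gamma> c]])
  then show "smooth_on (snd c ` fst c) (form_in_chart A (fiber_integral A \<gamma>) c vs)"
    by (rule smooth_on_cong) (simp only: fiber_integral_in_chart[OF c])
qed

text \<open>The cocycle equation for \<open>\<gamma>\<close> is evaluated on the time vector
  followed by lifts and integrated over the unit interval. The time derivative yields the difference
  of the two boundary values. The other terms form the twisted differential of the fibre integral,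
  since the twist has no time component and its values on lifts do not depend on \<open>t\<close>,
  hence leave the integral.\<close>

lemma fiber_stokes:
  assumes \<gamma>: "\<gamma> \<in> leaf_forms (line_atlas A) k" and d: "twisted_d (line_atlas A) \<omega>' \<gamma> = zero_form"
    and \<omega>0: "\<omega>0 \<in> leaf_forms A 1"
    and time: "\<And>x t. \<omega>' (x, t) [time_vec A x t] = 0"
    and space: "\<And>x t X. X \<in> leaf_tangent_space A x \<Longrightarrow> \<omega>' (x, t) [lift A t x X] = \<omega>0 x [X]"
  shows "lincomb 1 (pullback A (line_atlas A) (at_time 1) \<gamma>) (-1) (pullback A (line_atlas A) (at_time 0) \<gamma>)
    = twisted_d A \<omega>0 (fiber_integral A \<gamma>)"
proof (intro ext)
  fix x Xs
  show "lincomb 1 (pullback A (line_atlas A) (at_time 1) \<gamma>) (-1) (pullback A (line_atlas A) (at_time 0) \<gamma>) x Xs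
    = twisted_d A \<omega>0 (fiber_integral A \<gamma>) x Xs"
  proof (cases "set Xs \<subseteq> leaf_tangent_space A x")
    case False
    have "wedge1 \<omega>0 (fiber_integral A \<gamma>) x Xs = 0"
      by (rule wedge1_not_leafwise[OF _ _ False])
        (use leaf_forms_zero[OF \<omega>0] in \<open>auto simp: fiber_integral_def\<close>)
    with False show ?thesis by (simp add: lincomb_def pullback_def twisted_d_def leaf_d_eq)
  next
    case X: True
    let ?c = "chart_at A x"
    note c = chart_at[OF atlas_smooth, of x]
    define u where "u = snd ?c x"
    define vs where "vs = map (\<lambda>X. fst (X ?c)) Xs"
    define lvs where "lvs = map (\<lambda>v. (v, 0 :: real)) vs"
    define f where "f = form_in_chart (line_atlas A) \<gamma> (line_chart ?c)"
    have u: "u \<in> snd ?c ` fst ?c" unfolding u_def using c by blast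
    have Xi: "Xs ! i \<in> leaf_tangent_space A x" if "i < length Xs" for i using X that by auto
    have Xd: "set (del_nth i Xs) \<subseteq> leaf_tangent_space A x" for i using X set_del_nth by fast
    have lX: "map (\<lambda>X. (fst (X ?c), 0)) Xs = lvs" by (simp add: lvs_def vs_def)
    have lXd: "map (\<lambda>X. (fst (X ?c), 0)) (del_nth i Xs) = del_nth i lvs" for i
      unfolding lX[symmetric] by (rule del_nth_map[symmetric])
    \<comment> \<open>The cocycle equation solved for the time derivative; the wedge term with
      \<open>\<omega>'\<close> on the time vector has dropped out by \<open>time\<close>.\<close>
    have eq: "fd (f lvs) (twist (u, t)) ((0, 1), 0)
      = (\<Sum>i<length Xs. (-1) ^ i * (fd (f ((0, 1) # del_nth i lvs)) (twist (u, t)) ((vs ! i, 0), 0)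
          + \<omega>0 x [Xs ! i] * f ((0, 1) # del_nth i lvs) (twist (u, t))))" for t
    proof -
      let ?Y = "time_vec A x t # map (lift A t x) Xs"
      have Y: "set ?Y \<subseteq> leaf_tangent_space (line_atlas A) (x, t)"
        using X time_vec_leaf_tangent lift_leaf_tangent by auto
      have mY: "map (\<lambda>X. fst (X (line_chart ?c))) ?Y = (0, 1) # lvs"
        using X lift_chart[OF c] unfolding lX[symmetric] by auto
      have "leaf_d (line_atlas A) \<gamma> (x, t) ?Y = coord_d f ((0, 1) # lvs) (twist (u, t))"
        unfolding f_def u_def
        using leaf_d_in_chart[OF line_foliated \<gamma> Y, of "line_chart ?c", unfolded mY] line_chart_mem[OF c] by simp
      moreover have "wedge1 \<omega>' \<gamma> (x, t) ?Y
        = - (\<Sum>i<length Xs. (-1) ^ i * \<omega>0 x [Xs ! i] * f ((0, 1) # del_nth i lvs) (twist (u, t)))"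
      proof -
        have "\<gamma> (x, t) (time_vec A x t # del_nth i (map (lift A t x) Xs))
          = f ((0, 1) # del_nth i lvs) (twist (u, t))" for i
          unfolding del_nth_map line_form_lift(2)[OF Xd c] lXd f_def u_def ..
        then show ?thesis
          unfolding wedge1_Cons time by (simp add: space[OF Xi])
      qed
      moreover have "leaf_d (line_atlas A) \<gamma> (x, t) ?Y + wedge1 \<omega>' \<gamma> (x, t) ?Y = 0"
        using fun_cong[OF fun_cong[OF d, of "(x, t)"], of ?Y] by (simp add: twisted_d_def lincomb_def zero_form_def)
      ultimately show ?thesis
        unfolding coord_d_Cons
        by (simp add: lvs_def vs_def sum.distrib[symmetric] algebra_simps)
    qed
    have fdiff: "f ws differentiable (at (twist (u, t)))" for ws t
      unfolding f_def u_def by (rule line_form_differentiable[OF \<gamma> c])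
    have int1: "((\<lambda>t. fd (f lvs) (twist (u, t)) ((0, 1), 0)) has_integral f lvs (twist (u, 1)) - f lvs (twist (u, 0))) {0..1}"
    proof (rule fundamental_theorem_of_calculus)
      fix t :: real
      have tw: "twist (u, 0) + t *\<^sub>R ((0, 1), 0) = twist (u, t)" for t :: real by (simp add: twist_apply)
      have "((\<lambda>t. f lvs (twist (u, 0) + t *\<^sub>R ((0, 1), 0))) has_vector_derivative
        fd (f lvs) (twist (u, 0) + t *\<^sub>R ((0, 1), 0)) ((0, 1), 0)) (at t)"
        by (rule has_derivative_line) (simp only: tw fdiff)
      then show "((\<lambda>t. f lvs (twist (u, t))) has_vector_derivative fd (f lvs) (twist (u, t)) ((0, 1), 0)) (at t within {0..1})"
        unfolding tw by (rule has_vector_derivative_at_within)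
    qed simp
    have int2: "((\<lambda>t. f ((0, 1) # del_nth i lvs) (twist (u, t))) has_integral fiber_integral A \<gamma> x (del_nth i Xs)) {0..1}" for i
    proof -
      have "fiber_integral A \<gamma> x (del_nth i Xs) = integral {0..1} (\<lambda>t. \<gamma> (x, t) (time_vec A x t # map (lift A t x) (del_nth i Xs)))"
        using Xd by (simp add: fiber_integral_def)
      then show ?thesis
        using integrable_integral[OF fiber_integrable[OF \<gamma> Xd]]
        unfolding line_form_lift(2)[OF Xd c] lXd f_def u_def by simp
    qed
    \<comment> \<open>Differentiation under the integral sign: leafwise derivatives of the fibre
      integral are integrals of derivatives upstairs.\<close>
    have int3: "((\<lambda>t. fd (f ((0, 1) # del_nth i lvs)) (twist (u, t)) ((v, 0), 0)) has_integral
      fd (form_in_chart A (fiber_integral A \<gamma>) ?c (del_nth i vs)) u (v, 0)) {0..1}" for i v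
    proof -
      let ?g = "\<lambda>p. f ((0, 1) # del_nth i lvs) (twist p)"
      let ?W = "snd ?c ` fst ?c"
      note W = smooth_atlas_chart(2)[OF atlas_smooth c(1)]
      note fin = smooth_atlas_finite_dim[OF atlas_smooth]
      have g: "smooth_on (?W \<times> UNIV) ?g" unfolding f_def by (rule line_form_smooth[OF \<gamma> c(1)])
      have WU: "open (?W \<times> (UNIV :: real set))" using W by (simp add: open_Times)
      have 1: "fd (form_in_chart A (fiber_integral A \<gamma>) ?c (del_nth i vs)) u
        = fd (\<lambda>u. integral {0..1} (\<lambda>t. ?g (u, t))) u"
      proof (rule fd_cong[OF W u])
        fix y assume y: "y \<in> ?W"
        show "form_in_chart A (fiber_integral A \<gamma>) ?c (del_nth i vs) y = integral {0..1} (\<lambda>t. ?g (y, t))"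
          unfolding fiber_integral_in_chart[OF c(1) y] f_def lvs_def del_nth_map ..
      qed
      have 2: "fd ?g (u, t) ((v, 0), 0) = fd (f ((0, 1) # del_nth i lvs)) (twist (u, t)) ((v, 0), 0)" for t
        unfolding f_def u_def using fd_line_form[OF \<gamma> c, of _ t "((v, 0), 0)"] by (simp add: twist_apply)
      have "(\<lambda>t. fd ?g (u, t) ((v, 0), 0)) integrable_on {0..1}"
        by (rule integrable_parameter[OF W smooth_on_fd[OF WU g] u])
      from integrable_integral[OF this] show ?thesis
        unfolding 1 fd_eq[OF has_derivative_parametric_integral[OF fin W g u]] unfolding 2 .
    qed
    have "((\<lambda>t. fd (f lvs) (twist (u, t)) ((0, 1), 0)) has_integral
      (\<Sum>i<length Xs. (-1) ^ i * (fd (form_in_chart A (fiber_integral A \<gamma>) ?c (del_nth i vs)) u (vs ! i, 0)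
          + \<omega>0 x [Xs ! i] * fiber_integral A \<gamma> x (del_nth i Xs)))) {0..1}"
      unfolding eq
      by (intro has_integral_sum has_integral_mult_right has_integral_add int2 int3) simp
    then have "f lvs (twist (u, 1)) - f lvs (twist (u, 0))
      = (\<Sum>i<length Xs. (-1) ^ i * (fd (form_in_chart A (fiber_integral A \<gamma>) ?c (del_nth i vs)) u (vs ! i, 0)
          + \<omega>0 x [Xs ! i] * fiber_integral A \<gamma> x (del_nth i Xs)))"
      using int1 has_integral_unique by blast
    also have "\<dots> = twisted_d A \<omega>0 (fiber_integral A \<gamma>) x Xs"
      using X by (simp add: twisted_d_def lincomb_def leaf_d_eq coord_d_def wedge1_def vs_def u_def
          sum.distrib[symmetric] algebra_simps)
    finally show ?thesis
      using X line_form_lift(1)[OF X c, of \<gamma>, unfolded lX]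
      by (simp add: lincomb_def pullback_def at_time_def[THEN fun_cong] f_def u_def)
  qed
qed

end

section \<open>Removing the time component of a closed form on the product\<close>

lemma fun_form_leaf_forms:
  assumes "smooth_fun A h"
  shows "fun_form h \<in> leaf_forms A 0"
  using assms unfolding leaf_forms_def leaf_form_at_def smooth_fun_def
  by (auto simp: form_in_chart_fun_form) (auto simp: fun_form_def)

lemma smooth_fun_of_form:
  assumes "fun_form h \<in> leaf_forms A 0"
  shows "smooth_fun A h"
  unfolding smooth_fun_def
proof
  fix c assume "c \<in> A"
  from form_in_chart_smooth[OF assms this, of "[]"]
  show "smooth_on (snd c ` fst c) (\<lambda>u. h (inv_chart c u))" by (simp add: form_in_chart_fun_form)
qed

text \<open>The function \<open>H\<close> of the overview, with the interval of integration rescaled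
  to the unit interval as in \<open>time_primitive\<close>.\<close>

definition time_potential :: "('a, 'p::real_normed_vector \<times> 'q::real_normed_vector) chart set \<Rightarrow>
    ('a \<times> real, ('p \<times> real) \<times> 'q) form \<Rightarrow> 'a \<times> real \<Rightarrow> real" where
  "time_potential A \<Omega> = (\<lambda>(x, t). integral {0..1} (\<lambda>s. t * \<Omega> (x, t * s) [time_vec A x (t * s)]))"

context
  fixes A :: "('a::{t2_space,second_countable_topology}, 'p::real_normed_vector \<times> 'q::real_normed_vector) chart set"
    and \<Omega> :: "('a \<times> real, ('p \<times> real) \<times> 'q) form"
  assumes A: "foliated_atlas A" and \<Omega>: "\<Omega> \<in> leaf_forms (line_atlas A) 1"
begin

lemma time_potential_in_chart:
  assumes c: "c \<in> A" "x \<in> fst c"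
  shows "time_potential A \<Omega> (x, t) = integral {0..1} (\<lambda>s. t *
    form_in_chart (line_atlas A) \<Omega> (line_chart c) [(0, 1)] (twist (snd c x, t * s)))"
  using line_form_lift(2)[OF A _ c, of "[]" \<Omega>] by (simp add: time_potential_def)

lemma time_potential_inv_chart:
  assumes c: "c \<in> A" and w: "w \<in> snd (line_chart c) ` fst (line_chart c)"
  shows "time_potential A \<Omega> (inv_chart (line_chart c) w) = integral {0..1} (\<lambda>s. snd (untwist w) *
    form_in_chart (line_atlas A) \<Omega> (line_chart c) [(0, 1)] (twist (fst (untwist w), snd (untwist w) * s)))"
proof -
  note sm = foliated_atlas_smooth[OF A]
  have u: "fst (untwist w) \<in> snd c ` fst c" using w unfolding line_chart_image by simp
  show ?thesis
    unfolding inv_line_chart[OF sm c u] time_potential_in_chart[OF c smooth_atlas_chart(7)[OF sm c u]]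
      smooth_atlas_chart(6)[OF sm c u] ..
qed

lemma smooth_time_potential: "smooth_fun (line_atlas A) (time_potential A \<Omega>)"
  unfolding smooth_fun_def
proof
  note sm = foliated_atlas_smooth[OF A]
  fix c' assume "c' \<in> line_atlas A"
  then obtain c where c: "c \<in> A" "c' = line_chart c" by (auto simp: line_atlas_def)
  let ?W = "snd (line_chart c) ` fst (line_chart c)"
  let ?h = "\<lambda>p. integral {0..1} (\<lambda>s. snd p *
    form_in_chart (line_atlas A) \<Omega> (line_chart c) [(0, 1)] (twist (fst p, snd p * s)))"
  have W: "open ?W" unfolding line_chart_image by (rule open_fst_untwist[OF smooth_atlas_chart(2)[OF sm c(1)]])
  have h: "smooth_on (snd c ` fst c \<times> UNIV) ?h"
  proof (cases "fst c = {}")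
    \<comment> \<open>\<open>time_primitive\<close> is stated at a point of the domain, so an empty
      chart is treated apart.\<close>
    case True
    then show ?thesis by (simp add: smooth_on_def)
  next
    case False
    then obtain u where "u \<in> snd c ` fst c" by blast
    then show ?thesis
      by (rule time_primitive(1)[OF smooth_atlas_finite_dim[OF sm] smooth_atlas_chart(2)[OF sm c(1)] line_form_smooth[OF A \<Omega> c(1)]])
  qed
  have "smooth_on ?W (\<lambda>w. ?h (untwist w))"
  proof (rule smooth_on_compose[OF finite_dim_prod[OF smooth_atlas_finite_dim[OF sm] finite_dim_real] W
        smooth_on_bounded_linear[OF bounded_linear_untwist] _ h])
    show "untwist w \<in> snd c ` fst c \<times> UNIV" if "w \<in> ?W" for w
      using that unfolding line_chart_image by (metis UNIV_I mem_Collect_eq mem_Sigma_iff prod.collapse)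
  qed
  then show "smooth_on (snd c' ` fst c') (\<lambda>w. time_potential A \<Omega> (inv_chart c' w))"
    unfolding c(2) by (rule smooth_on_cong) (simp only: time_potential_inv_chart[OF c(1)])
qed

text \<open>The chain rule through \<open>untwist\<close> moves the derivative to the coordinates
  \<open>(u, t)\<close>, where \<open>time_primitive\<close> computes it both for the time vector
  and for lifts.\<close>

lemma leaf_d_time_potential:
  assumes c: "c \<in> A" "x \<in> fst c" and Y: "Y \<in> leaf_tangent_space (line_atlas A) (x, t)"
  shows "leaf_d (line_atlas A) (fun_form (time_potential A \<Omega>)) (x, t) [Y]
    = fd (\<lambda>p. integral {0..1} (\<lambda>s. snd p *
        form_in_chart (line_atlas A) \<Omega> (line_chart c) [(0, 1)] (twist (fst p, snd p * s))))
      (snd c x, t) (untwist (Y (line_chart c)))"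
proof -
  note sm = foliated_atlas_smooth[OF A]
  let ?h = "\<lambda>p. integral {0..1} (\<lambda>s. snd p *
    form_in_chart (line_atlas A) \<Omega> (line_chart c) [(0, 1)] (twist (fst p, snd p * s)))"
  let ?W = "snd (line_chart c) ` fst (line_chart c)" and ?w = "twist (snd c x, t)"
  have W: "open ?W" unfolding line_chart_image by (rule open_fst_untwist[OF smooth_atlas_chart(2)[OF sm c(1)]])
  have w: "?w \<in> ?W" unfolding line_chart_image using c by simp
  note c' = line_chart_mem[OF c, of t, THEN conjunct1] line_chart_mem[OF c, of t, THEN conjunct2]
  have u: "snd c x \<in> snd c ` fst c" using c by blast
  have h: "smooth_on (snd c ` fst c \<times> UNIV) ?h"
    by (rule time_primitive(1)[OF smooth_atlas_finite_dim[OF sm] smooth_atlas_chart(2)[OF sm c(1)]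
          line_form_smooth[OF A \<Omega> c(1)] u])
  have hd: "?h differentiable (at (untwist ?w))"
    by (rule smooth_on_differentiable[OF _ h]) (use u smooth_atlas_chart(2)[OF sm c(1)] in \<open>auto simp: open_Times\<close>)
  have ud: "(untwist has_derivative untwist) (at ?w)"
    by (rule bounded_linear.has_derivative[OF bounded_linear_untwist has_derivative_ident])
  have "fd (\<lambda>w. time_potential A \<Omega> (inv_chart (line_chart c) w)) ?w = fd (\<lambda>w. ?h (untwist w)) ?w"
    by (rule fd_cong[OF W w]) (rule time_potential_inv_chart[OF c(1)])
  moreover have "fd (\<lambda>w. ?h (untwist w)) ?w v = fd ?h (untwist ?w) (untwist v)" for v
    unfolding fd_compose[OF differentiableI[OF ud] hd] fd_eq[OF ud] ..
  moreover have "leaf_d (line_atlas A) (fun_form (time_potential A \<Omega>)) (x, t) [Y]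
    = fd (\<lambda>w. time_potential A \<Omega> (inv_chart (line_chart c) w)) ?w (fst (Y (line_chart c)), 0)"
    using leaf_d_in_chart[OF foliated_atlas_line[OF A] fun_form_leaf_forms[OF smooth_time_potential] _ c', of "[Y]"] Y
    by (simp add: coord_d_def del_nth_def form_in_chart_fun_form)
  ultimately show ?thesis
    using leaf_tangent_eq(1)[OF Y c'] by (simp only: twist_simps)
qed

lemma leaf_d_time_potential_time:
  "leaf_d (line_atlas A) (fun_form (time_potential A \<Omega>)) (x, t) [time_vec A x t] = \<Omega> (x, t) [time_vec A x t]"
proof -
  note sm = foliated_atlas_smooth[OF A]
  obtain c where c: "c \<in> A" "x \<in> fst c" using smooth_atlas_covers[OF sm] .
  have u: "snd c x \<in> snd c ` fst c" using c by blast
  have "untwist (time_vec A x t (line_chart c)) = (0, 1)"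
    using lift_chart(1)[OF A c] by (simp add: twist_apply zero_prod_def)
  then show ?thesis
    unfolding leaf_d_time_potential[OF c time_vec_leaf_tangent[OF A]]
    using time_primitive(2)[OF smooth_atlas_finite_dim[OF sm] smooth_atlas_chart(2)[OF sm c(1)] line_form_smooth[OF A \<Omega> c(1)] u]
      line_form_lift(2)[OF A _ c, of "[]" \<Omega> t] by simp
qed

text \<open>Closedness of \<open>\<Omega>\<close> on the pair of the time vector and the lift of
  \<open>X\<close> says that the time derivative of \<open>\<Omega>\<close> on the lift is the
  \<open>X\<close>-derivative of its time component. This is the compatibility between
  \<open>a\<close> and \<open>b\<close> in the third part of \<open>time_primitive\<close>.\<close>

lemma leaf_d_time_potential_lift:
  assumes d: "leaf_d (line_atlas A) \<Omega> = zero_form" and X: "X \<in> leaf_tangent_space A x"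
  shows "leaf_d (line_atlas A) (fun_form (time_potential A \<Omega>)) (x, t) [lift A t x X]
    = \<Omega> (x, t) [lift A t x X] - \<Omega> (x, 0) [lift A 0 x X]"
proof -
  note sm = foliated_atlas_smooth[OF A]
  obtain c where c: "c \<in> A" "x \<in> fst c" using smooth_atlas_covers[OF sm] .
  have u: "snd c x \<in> snd c ` fst c" using c by blast
  have W: "open (snd c ` fst c \<times> (UNIV :: real set))"
    using smooth_atlas_chart(2)[OF sm c(1)] by (simp add: open_Times)
  define f where "f = form_in_chart (line_atlas A) \<Omega> (line_chart c)"
  let ?v = "(fst (X c), 0 :: real)"
  have ut: "untwist (lift A t x X (line_chart c)) = ((fst (X c), 0), 0)"
    using lift_chart(2)[OF A c X] by (simp add: twist_apply)
  have *: "\<Omega> (x, t) [lift A t x X] = f [?v] (twist (snd c x, t))" for t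
    using line_form_lift(1)[OF A _ c, of "[X]" \<Omega> t] X by (simp add: f_def)
  have "fd (\<lambda>p. f [?v] (twist p)) (snd c x, t) (0, 1) = fd (\<lambda>p. f [(0, 1)] (twist p)) (snd c x, t) ((fst (X c), 0), 0)" for t
  proof -
    let ?Y = "[time_vec A x t, lift A t x X]"
    have Y: "set ?Y \<subseteq> leaf_tangent_space (line_atlas A) (x, t)"
      using time_vec_leaf_tangent[OF A] lift_leaf_tangent[OF A X] by auto
    have mY: "map (\<lambda>X. fst (X (line_chart c))) ?Y = [(0, 1), ?v]"
      using lift_chart[OF A c] X by simp
    have "leaf_d (line_atlas A) \<Omega> (x, t) ?Y = coord_d f [(0, 1), ?v] (twist (snd c x, t))"
      using leaf_d_in_chart[OF foliated_atlas_line[OF A] \<Omega> Y, of "line_chart c", unfolded mY] line_chart_mem[OF c]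
      by (simp add: f_def)
    then have "fd (f [?v]) (twist (snd c x, t)) ((0, 1), 0) = fd (f [(0, 1)]) (twist (snd c x, t)) (?v, 0)"
      unfolding d by (simp add: coord_d_Cons zero_form_def del_nth_def)
    moreover have "twist ((0, 1) :: ('p \<times> 'q) \<times> real) = ((0, 1), 0)" "twist ((fst (X c), 0 :: 'q), 0 :: real) = (?v, 0)"
      by (simp_all add: twist_apply)
    ultimately show ?thesis
      unfolding f_def fd_line_form[OF A \<Omega> c] by simp
  qed
  from time_primitive(3)[OF smooth_atlas_finite_dim[OF sm] smooth_atlas_chart(2)[OF sm c(1)] line_form_smooth[OF A \<Omega> c(1)] u
      line_form_smooth[OF A \<Omega> c(1)] this[unfolded f_def]]
  show ?thesis
    unfolding leaf_d_time_potential[OF c lift_leaf_tangent[OF A X]] ut * f_def by simp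
qed

lemma time_potential_0: "time_potential A \<Omega> (x, 0) = 0"
  by (simp add: time_potential_def)

lemma pullback_time_potential:
  "pullback A (line_atlas A) (at_time t) (fun_form (time_potential A \<Omega>)) = fun_form (\<lambda>x. time_potential A \<Omega> (x, t))"
  by (auto simp: pullback_def fun_form_def at_time_def fun_eq_iff)

text \<open>Restricting a function to a time slice is the pullback of a 0-form, which is known to
  preserve smoothness.\<close>

lemma smooth_time_potential_at: "smooth_fun A (\<lambda>x. time_potential A \<Omega> (x, t))"
  using pullback_leaf_forms[OF A foliated_atlas_line[OF A] tangential_at_time[OF A] fun_form_leaf_forms[OF smooth_time_potential], of t]
  unfolding pullback_time_potential by (rule smooth_fun_of_form)

text \<open>The change of \<open>\<Omega>\<close> from time 0 to time 1 is \<open>dH\<close> on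
  lifts at time 1; naturality of the leafwise derivative under \<open>at_time 1\<close> turns it
  into the differential of a function on the manifold.\<close>

lemma pullback_at_time_exact:
  assumes d: "leaf_d (line_atlas A) \<Omega> = zero_form"
  shows "pullback A (line_atlas A) (at_time 1) \<Omega>
    = lincomb 1 (pullback A (line_atlas A) (at_time 0) \<Omega>) 1 (leaf_d A (fun_form (\<lambda>x. time_potential A \<Omega> (x, 1))))"
proof (intro ext)
  fix x Xs
  note B = foliated_atlas_line[OF A]
  have dh: "leaf_d A (fun_form (\<lambda>x. time_potential A \<Omega> (x, 1)))
    = pullback A (line_atlas A) (at_time 1) (leaf_d (line_atlas A) (fun_form (time_potential A \<Omega>)))"
    unfolding pullback_time_potential[symmetric]
    by (rule leaf_d_pullback[OF A B tangential_at_time[OF A] fun_form_leaf_forms[OF smooth_time_potential]])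
  show "pullback A (line_atlas A) (at_time 1) \<Omega> x Xs
    = lincomb 1 (pullback A (line_atlas A) (at_time 0) \<Omega>) 1 (leaf_d A (fun_form (\<lambda>x. time_potential A \<Omega> (x, 1)))) x Xs"
  proof (cases "\<exists>X\<in>leaf_tangent_space A x. Xs = [X]")
    case True
    then show ?thesis
      unfolding dh by (auto simp: lincomb_def pullback_def at_time_def[THEN fun_cong] leaf_d_time_potential_lift[OF d])
  next
    case False
    then have "\<not> (length Xs = 1 \<and> set Xs \<subseteq> leaf_tangent_space A x)"
      by (auto simp: length_Suc_conv)
    then have "pullback A (line_atlas A) (at_time t) \<Omega> x Xs = 0" for t
      by (rule leaf_forms_zero[OF pullback_leaf_forms[OF A B tangential_at_time[OF A] \<Omega>]])
    then show ?thesis using False by (simp add: lincomb_def leaf_d_fun_form)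
  qed
qed

text \<open>Stokes' formula for \<open>\<gamma>\<close> with the twist \<open>\<Omega> - dH\<close>.
  As \<open>H\<close> vanishes at time 0, the exponential factor survives only in the boundary term
  at time 1, and the twist on the base is that of time 0.\<close>

lemma pullback_at_time_cohomologous:
  assumes d: "leaf_d (line_atlas A) \<Omega> = zero_form"
    and \<beta>: "\<beta> \<in> leaf_forms (line_atlas A) k" "twisted_d (line_atlas A) \<Omega> \<beta> = zero_form"
  defines "\<gamma> \<equiv> scale_form (\<lambda>p. exp (time_potential A \<Omega> p)) \<beta>"
  shows "lincomb 1 (scale_form (\<lambda>x. exp (time_potential A \<Omega> (x, 1))) (pullback A (line_atlas A) (at_time 1) \<beta>))
      (-1) (pullback A (line_atlas A) (at_time 0) \<beta>)
    = twisted_d A (pullback A (line_atlas A) (at_time 0) \<Omega>) (fiber_integral A \<gamma>)"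
    and "\<gamma> \<in> leaf_forms (line_atlas A) k"
proof -
  note B = foliated_atlas_line[OF A]
  note smB = foliated_atlas_smooth[OF B]
  let ?H = "time_potential A \<Omega>"
  define \<omega>' where "\<omega>' = lincomb 1 \<Omega> (-1) (leaf_d (line_atlas A) (fun_form ?H))"
  show \<gamma>: "\<gamma> \<in> leaf_forms (line_atlas A) k"
    unfolding \<gamma>_def by (rule scale_leaf_forms[OF smB smooth_fun_exp[OF smB smooth_time_potential] \<beta>(1)])
  have "lincomb 1 \<omega>' 1 (leaf_d (line_atlas A) (fun_form ?H)) = \<Omega>"
    by (simp add: \<omega>'_def lincomb_def)
  then have d\<gamma>: "twisted_d (line_atlas A) \<omega>' \<gamma> = zero_form"
    unfolding \<gamma>_def twisted_d_scale_exp[OF smB smooth_time_potential \<beta>(1)]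
    by (simp add: \<beta>(2) scale_form_def zero_form_def)
  have "lincomb 1 (pullback A (line_atlas A) (at_time 1) \<gamma>) (-1) (pullback A (line_atlas A) (at_time 0) \<gamma>)
    = twisted_d A (pullback A (line_atlas A) (at_time 0) \<Omega>) (fiber_integral A \<gamma>)"
  proof (rule fiber_stokes[OF A \<gamma> d\<gamma>])
    show "pullback A (line_atlas A) (at_time 0) \<Omega> \<in> leaf_forms A 1"
      by (rule pullback_leaf_forms[OF A B tangential_at_time[OF A] \<Omega>])
    show "\<omega>' (x, t) [time_vec A x t] = 0" for x t
      by (simp add: \<omega>'_def lincomb_def leaf_d_time_potential_time)
    show "\<omega>' (x, t) [lift A t x X] = pullback A (line_atlas A) (at_time 0) \<Omega> x [X]"
      if "X \<in> leaf_tangent_space A x" for x t X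
      using that by (simp add: \<omega>'_def lincomb_def leaf_d_time_potential_lift[OF d] pullback_def at_time_def[THEN fun_cong])
  qed
  moreover have "pullback A (line_atlas A) (at_time t) \<gamma>
    = scale_form (\<lambda>x. exp (?H (x, t))) (pullback A (line_atlas A) (at_time t) \<beta>)" for t
    by (auto simp: \<gamma>_def pullback_def scale_form_def at_time_def[THEN fun_cong] fun_eq_iff)
  moreover have "scale_form (\<lambda>x. exp (?H (x, 0))) \<alpha> = \<alpha>" for \<alpha> :: "('a, 'p \<times> 'q) form"
    by (simp add: time_potential_0 scale_form_def)
  ultimately show "lincomb 1 (scale_form (\<lambda>x. exp (?H (x, 1))) (pullback A (line_atlas A) (at_time 1) \<beta>))
      (-1) (pullback A (line_atlas A) (at_time 0) \<beta>)
    = twisted_d A (pullback A (line_atlas A) (at_time 0) \<Omega>) (fiber_integral A \<gamma>)"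
    by simp
qed

end

section \<open>Cohomology\<close>

lemma lincomb_simps:
  "lincomb 0 \<alpha> 0 \<beta> = zero_form" "lincomb 1 \<alpha> (-1) \<alpha> = zero_form" "lincomb r zero_form s zero_form = zero_form"
  by (simp_all add: lincomb_def zero_form_def)

lemma twisted_d_zero: "smooth_atlas A \<Longrightarrow> twisted_d A \<omega> zero_form = zero_form"
  using twisted_d_lincomb[OF _ zero_leaf_forms zero_leaf_forms, where A = A and \<omega> = \<omega> and r = 0 and s = 0]
  by (simp add: lincomb_simps)

lemma cocycles_lincomb:
  assumes "smooth_atlas A" "\<alpha> \<in> cocycles A \<omega> k" "\<beta> \<in> cocycles A \<omega> k"
  shows "lincomb r \<alpha> s \<beta> \<in> cocycles A \<omega> k"
proof -
  have "\<alpha> \<in> leaf_forms A k" "\<beta> \<in> leaf_forms A k"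
    "twisted_d A \<omega> \<alpha> = zero_form" "twisted_d A \<omega> \<beta> = zero_form"
    using assms(2,3) by (simp_all add: cocycles_def)
  then show ?thesis
    using lincomb_leaf_forms[OF assms(1), of \<alpha> k \<beta> r s] twisted_d_lincomb[OF assms(1), of \<alpha> k \<beta> \<omega> r s]
    by (simp add: cocycles_def lincomb_simps)
qed

lemma zero_coboundary:
  assumes "smooth_atlas A"
  shows "zero_form \<in> coboundaries A \<omega> k"
proof (cases k)
  case (Suc j)
  have "zero_form \<in> twisted_d A \<omega> ` leaf_forms A j"
    by (rule image_eqI[of _ _ zero_form]) (simp_all add: twisted_d_zero[OF assms] zero_leaf_forms)
  then show ?thesis by (simp add: coboundaries_def Suc)
qed (simp add: coboundaries_def)

lemma coboundaries_lincomb: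
  assumes A: "smooth_atlas A" and "\<alpha> \<in> coboundaries A \<omega> k" "\<beta> \<in> coboundaries A \<omega> k"
  shows "lincomb r \<alpha> s \<beta> \<in> coboundaries A \<omega> k"
proof (cases k)
  case (Suc j)
  then obtain \<alpha>' \<beta>' where "\<alpha>' \<in> leaf_forms A j" "\<beta>' \<in> leaf_forms A j"
    "\<alpha> = twisted_d A \<omega> \<alpha>'" "\<beta> = twisted_d A \<omega> \<beta>'"
    using assms(2,3) by (auto simp: coboundaries_def)
  then have "lincomb r \<alpha> s \<beta> = twisted_d A \<omega> (lincomb r \<alpha>' s \<beta>')" "lincomb r \<alpha>' s \<beta>' \<in> leaf_forms A j"
    using twisted_d_lincomb[OF A, of \<alpha>' j \<beta>' \<omega> r s] lincomb_leaf_forms[OF A, of \<alpha>' j \<beta>' r s] by simp_all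
  then show ?thesis by (simp add: coboundaries_def Suc)
qed (use assms in \<open>auto simp: coboundaries_def lincomb_simps\<close>)

lemma cohomologous_equiv:
  assumes A: "smooth_atlas A"
  shows "equiv (cocycles A \<omega> k) (cohomologous A \<omega> k)"
proof (rule equivI)
  show "cohomologous A \<omega> k \<subseteq> cocycles A \<omega> k \<times> cocycles A \<omega> k" by (auto simp: cohomologous_def)
  show "refl_on (cocycles A \<omega> k) (cohomologous A \<omega> k)"
    using zero_coboundary[OF A] by (auto simp: refl_on_def cohomologous_def lincomb_simps)
  show "sym (cohomologous A \<omega> k)"
  proof (rule symI)
    fix \<alpha> \<beta> assume "(\<alpha>, \<beta>) \<in> cohomologous A \<omega> k"
    moreover have "lincomb 1 \<beta> (-1) \<alpha> = lincomb (-1) (lincomb 1 \<alpha> (-1) \<beta>) 0 zero_form"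
      by (simp add: lincomb_def)
    ultimately show "(\<beta>, \<alpha>) \<in> cohomologous A \<omega> k"
      using coboundaries_lincomb[OF A _ zero_coboundary[OF A]] by (simp add: cohomologous_def)
  qed
  show "trans (cohomologous A \<omega> k)"
  proof (rule transI)
    fix \<alpha> \<beta> \<gamma> assume *: "(\<alpha>, \<beta>) \<in> cohomologous A \<omega> k" "(\<beta>, \<gamma>) \<in> cohomologous A \<omega> k"
    have "lincomb 1 \<alpha> (-1) \<gamma> = lincomb 1 (lincomb 1 \<alpha> (-1) \<beta>) 1 (lincomb 1 \<beta> (-1) \<gamma>)"
      by (simp add: lincomb_def)
    with * show "(\<alpha>, \<gamma>) \<in> cohomologous A \<omega> k"
      using coboundaries_lincomb[OF A] by (simp add: cohomologous_def)
  qed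
qed

text \<open>The operation is a union over all representatives of both classes. These yield one and
  the same class, and the union is not over empty sets because a class contains its
  representative.\<close>

lemma cohomology_comb:
  assumes A: "smooth_atlas A" and \<alpha>: "\<alpha> \<in> cocycles A \<omega> k" and \<beta>: "\<beta> \<in> cocycles A \<omega> k"
  shows "comb (cohomology A \<omega> k) r (cohomologous A \<omega> k `` {\<alpha>}) s (cohomologous A \<omega> k `` {\<beta>})
    = cohomologous A \<omega> k `` {lincomb r \<alpha> s \<beta>}"
proof -
  let ?R = "cohomologous A \<omega> k"
  note eq = cohomologous_equiv[OF A, of \<omega> k]
  have const: "?R `` {lincomb r \<alpha>' s \<beta>'} = ?R `` {lincomb r \<alpha> s \<beta>}"
    if "(\<alpha>, \<alpha>') \<in> ?R" "(\<beta>, \<beta>') \<in> ?R" for \<alpha>' \<beta>'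
  proof -
    have "lincomb 1 (lincomb r \<alpha> s \<beta>) (-1) (lincomb r \<alpha>' s \<beta>')
      = lincomb r (lincomb 1 \<alpha> (-1) \<alpha>') s (lincomb 1 \<beta> (-1) \<beta>')"
      by (simp add: lincomb_def algebra_simps)
    then have "(lincomb r \<alpha> s \<beta>, lincomb r \<alpha>' s \<beta>') \<in> ?R"
      using that coboundaries_lincomb[OF A] cocycles_lincomb[OF A] by (simp add: cohomologous_def)
    then show ?thesis using equiv_class_eq[OF eq] by blast
  qed
  have "comb (cohomology A \<omega> k) r (?R `` {\<alpha>}) s (?R `` {\<beta>})
    = (\<Union>\<alpha>'\<in>?R `` {\<alpha>}. \<Union>\<beta>'\<in>?R `` {\<beta>}. ?R `` {lincomb r \<alpha>' s \<beta>'})"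
    by (simp add: cohomology_def)
  also have "\<dots> = (\<Union>\<alpha>'\<in>?R `` {\<alpha>}. \<Union>\<beta>'\<in>?R `` {\<beta>}. ?R `` {lincomb r \<alpha> s \<beta>})"
    by (intro SUP_cong refl const) (simp_all only: Image_singleton_iff)
  also have "\<dots> = ?R `` {lincomb r \<alpha> s \<beta>}"
    using equiv_class_self[OF eq \<alpha>] equiv_class_self[OF eq \<beta>] by blast
  finally show ?thesis .
qed

text \<open>\<open>P\<close> is linear already on forms, so injectivity on classes reduces to the
  kernel: two cocycles are cohomologous exactly when their difference is mapped to a
  coboundary.\<close>

lemma isomorphic_cohomologyI:
  assumes A: "smooth_atlas A" and A': "smooth_atlas A'"
    and coc: "\<And>\<alpha>. \<alpha> \<in> cocycles A \<omega> k \<Longrightarrow> P \<alpha> \<in> cocycles A' \<omega>' k"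
    and lin: "\<And>\<alpha> \<beta> r s. P (lincomb r \<alpha> s \<beta>) = lincomb r (P \<alpha>) s (P \<beta>)"
    and cob: "\<And>\<alpha>. \<alpha> \<in> coboundaries A \<omega> k \<Longrightarrow> P \<alpha> \<in> coboundaries A' \<omega>' k"
    and inj: "\<And>\<alpha>. \<alpha> \<in> cocycles A \<omega> k \<Longrightarrow> P \<alpha> \<in> coboundaries A' \<omega>' k \<Longrightarrow> \<alpha> \<in> coboundaries A \<omega> k"
    and surj: "\<And>\<beta>. \<beta> \<in> cocycles A' \<omega>' k \<Longrightarrow>
      \<exists>\<alpha>\<in>cocycles A \<omega> k. lincomb 1 (P \<alpha>) (-1) \<beta> \<in> coboundaries A' \<omega>' k"
  shows "isomorphic (cohomology A \<omega> k) (cohomology A' \<omega>' k)"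
proof -
  let ?R = "cohomologous A \<omega> k" and ?R' = "cohomologous A' \<omega>' k"
  let ?Z = "cocycles A \<omega> k" and ?Z' = "cocycles A' \<omega>' k"
  note eq = cohomologous_equiv[OF A, of \<omega> k] and eq' = cohomologous_equiv[OF A', of \<omega>' k]
  have P: "(P \<alpha>, P \<beta>) \<in> ?R' \<longleftrightarrow> (\<alpha>, \<beta>) \<in> ?R" if "\<alpha> \<in> ?Z" "\<beta> \<in> ?Z" for \<alpha> \<beta>
    using that coc cob inj[OF cocycles_lincomb[OF A that]] by (auto simp: cohomologous_def lin[symmetric])
  \<comment> \<open>Collecting the classes of all images avoids the choice of a representative; on a
    class of cocycles they all coincide.\<close>
  define \<Phi> where "\<Phi> = (\<lambda>S. ?R' `` (P ` S))"
  have \<Phi>: "\<Phi> (?R `` {\<alpha>}) = ?R' `` {P \<alpha>}" if \<alpha>: "\<alpha> \<in> ?Z" for \<alpha>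
  proof -
    have "?R' `` {P \<beta>} = ?R' `` {P \<alpha>}" if "\<beta> \<in> ?R `` {\<alpha>}" for \<beta>
    proof -
      have "(\<alpha>, \<beta>) \<in> ?R" "\<beta> \<in> ?Z" using that by (auto simp: cohomologous_def)
      then show ?thesis using P[OF \<alpha>] equiv_class_eq[OF eq'] by blast
    qed
    moreover have "\<alpha> \<in> ?R `` {\<alpha>}" using equiv_class_self[OF eq \<alpha>] .
    ultimately show ?thesis unfolding \<Phi>_def by blast
  qed
  have V: "vectors (cohomology A \<omega> k) = ?Z // ?R" "vectors (cohomology A' \<omega>' k) = ?Z' // ?R'"
    by (simp_all add: cohomology_def)
  have "bij_betw \<Phi> (?Z // ?R) (?Z' // ?R')"
  proof (rule bij_betw_imageI)
    show "inj_on \<Phi> (?Z // ?R)"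
    proof (rule inj_onI)
      fix S T assume S: "S \<in> ?Z // ?R" and T: "T \<in> ?Z // ?R" and ST: "\<Phi> S = \<Phi> T"
      obtain \<alpha> where \<alpha>: "\<alpha> \<in> ?Z" "S = ?R `` {\<alpha>}" using S by (rule quotientE)
      obtain \<beta> where \<beta>: "\<beta> \<in> ?Z" "T = ?R `` {\<beta>}" using T by (rule quotientE)
      have "?R' `` {P \<alpha>} = ?R' `` {P \<beta>}" using ST \<Phi> \<alpha> \<beta> by simp
      then have "(P \<alpha>, P \<beta>) \<in> ?R'" using eq_equiv_class[OF _ eq' coc[OF \<beta>(1)]] by blast
      then show "S = T" using P[OF \<alpha>(1) \<beta>(1)] equiv_class_eq[OF eq] \<alpha>(2) \<beta>(2) by blast
    qed
    show "\<Phi> ` (?Z // ?R) = ?Z' // ?R'"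
    proof (intro equalityI subsetI)
      fix S' assume "S' \<in> \<Phi> ` (?Z // ?R)"
      then obtain S where S: "S \<in> ?Z // ?R" "S' = \<Phi> S" by blast
      obtain \<alpha> where \<alpha>: "\<alpha> \<in> ?Z" "S = ?R `` {\<alpha>}" using S(1) by (rule quotientE)
      show "S' \<in> ?Z' // ?R'" unfolding S(2) \<alpha>(2) \<Phi>[OF \<alpha>(1)] by (rule quotientI[OF coc[OF \<alpha>(1)]])
    next
      fix S' assume "S' \<in> ?Z' // ?R'"
      then obtain \<beta> where \<beta>: "\<beta> \<in> ?Z'" "S' = ?R' `` {\<beta>}" by (rule quotientE)
      obtain \<alpha> where \<alpha>: "\<alpha> \<in> ?Z" "lincomb 1 (P \<alpha>) (-1) \<beta> \<in> coboundaries A' \<omega>' k" using surj[OF \<beta>(1)] by blast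
      have "(P \<alpha>, \<beta>) \<in> ?R'" using \<alpha> \<beta>(1) coc by (simp add: cohomologous_def)
      then have "S' = \<Phi> (?R `` {\<alpha>})" unfolding \<Phi>[OF \<alpha>(1)] \<beta>(2) by (rule equiv_class_eq[OF eq', symmetric])
      then show "S' \<in> \<Phi> ` (?Z // ?R)" using quotientI[OF \<alpha>(1)] by blast
    qed
  qed
  moreover have "\<Phi> (comb (cohomology A \<omega> k) r S s T) = comb (cohomology A' \<omega>' k) r (\<Phi> S) s (\<Phi> T)"
    if S: "S \<in> ?Z // ?R" and T: "T \<in> ?Z // ?R" for S T r s
  proof -
    obtain \<alpha> where \<alpha>: "\<alpha> \<in> ?Z" "S = ?R `` {\<alpha>}" using S by (rule quotientE)
    obtain \<beta> where \<beta>: "\<beta> \<in> ?Z" "T = ?R `` {\<beta>}" using T by (rule quotientE)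
    show ?thesis
      unfolding \<alpha>(2) \<beta>(2) cohomology_comb[OF A \<alpha>(1) \<beta>(1)] \<Phi>[OF \<alpha>(1)] \<Phi>[OF \<beta>(1)]
        cohomology_comb[OF A' coc[OF \<alpha>(1)] coc[OF \<beta>(1)]] \<Phi>[OF cocycles_lincomb[OF A \<alpha>(1) \<beta>(1)]] lin ..
  qed
  ultimately show ?thesis unfolding isomorphic_def V by blast
qed

section \<open>Effect of pullbacks, exponential factors and homotopies on cohomology\<close>

lemma cocycles_pullback:
  assumes "foliated_atlas A" "foliated_atlas A'" "tangential A A' f" "\<alpha> \<in> cocycles A' \<omega> k"
  shows "pullback A A' f \<alpha> \<in> cocycles A (pullback A A' f \<omega>) k"
  using assms(4) pullback_leaf_forms[OF assms(1-3)] twisted_d_pullback[OF assms(1-3), of \<alpha> k \<omega>]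
  by (simp add: cocycles_def zero_form_pullback)

lemma coboundaries_pullback:
  assumes "foliated_atlas A" "foliated_atlas A'" "tangential A A' f" "\<alpha> \<in> coboundaries A' \<omega> k"
  shows "pullback A A' f \<alpha> \<in> coboundaries A (pullback A A' f \<omega>) k"
  using assms(4) pullback_leaf_forms[OF assms(1-3)] twisted_d_pullback[OF assms(1-3)]
  by (cases k) (auto simp: coboundaries_def zero_form_pullback)

lemma closed_pullback:
  assumes "foliated_atlas A" "foliated_atlas A'" "tangential A A' f" "leafwise_closed_1form A' \<omega>"
  shows "leafwise_closed_1form A (pullback A A' f \<omega>)"
  using assms(4) pullback_leaf_forms[OF assms(1-3)] leaf_d_pullback[OF assms(1-3), of \<omega> 1]
  by (simp add: leafwise_closed_1form_def zero_form_pullback)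

lemma scale_exp_cocycles:
  assumes A: "smooth_atlas A" and h: "smooth_fun A h"
    and \<alpha>: "\<alpha> \<in> cocycles A (lincomb 1 \<omega> 1 (leaf_d A (fun_form h))) k"
  shows "scale_form (\<lambda>x. exp (h x)) \<alpha> \<in> cocycles A \<omega> k"
  using \<alpha> scale_leaf_forms[OF A smooth_fun_exp[OF A h]] twisted_d_scale_exp[OF A h, of \<alpha> k \<omega>]
  by (simp add: cocycles_def) (simp add: scale_form_def zero_form_def)

lemma scale_exp_coboundaries:
  assumes A: "smooth_atlas A" and h: "smooth_fun A h"
    and \<alpha>: "\<alpha> \<in> coboundaries A (lincomb 1 \<omega> 1 (leaf_d A (fun_form h))) k"
  shows "scale_form (\<lambda>x. exp (h x)) \<alpha> \<in> coboundaries A \<omega> k"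
proof (cases k)
  case 0
  then show ?thesis using \<alpha> by (simp add: coboundaries_def scale_form_def zero_form_def)
next
  case (Suc j)
  then obtain \<beta> where \<beta>: "\<beta> \<in> leaf_forms A j" "\<alpha> = twisted_d A (lincomb 1 \<omega> 1 (leaf_d A (fun_form h))) \<beta>"
    using \<alpha> by (auto simp: coboundaries_def)
  have "scale_form (\<lambda>x. exp (h x)) \<alpha> = twisted_d A \<omega> (scale_form (\<lambda>x. exp (h x)) \<beta>)"
    unfolding \<beta>(2) twisted_d_scale_exp[OF A h \<beta>(1)] ..
  then show ?thesis
    using scale_leaf_forms[OF A smooth_fun_exp[OF A h] \<beta>(1)] by (simp add: coboundaries_def Suc)
qed

text \<open>The preceding lemma applied to \<open>- h\<close> and the twist
  \<open>\<omega> + dh\<close>: adding the differential of \<open>- h\<close> leads back to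
  \<open>\<omega>\<close>, and the two exponential factors cancel.\<close>

lemma scale_exp_coboundaries_rev:
  assumes A: "smooth_atlas A" and h: "smooth_fun A h"
    and \<alpha>: "scale_form (\<lambda>x. exp (h x)) \<alpha> \<in> coboundaries A \<omega> k"
  shows "\<alpha> \<in> coboundaries A (lincomb 1 \<omega> 1 (leaf_d A (fun_form h))) k"
proof -
  note ff = fun_form_leaf_forms[OF h]
  have "leaf_d A (fun_form (\<lambda>x. - h x)) = leaf_d A (lincomb (-1) (fun_form h) 0 (fun_form h))"
    by (rule arg_cong[where f = "leaf_d A"]) (auto simp: fun_form_def lincomb_def fun_eq_iff)
  also have "\<dots> = lincomb (-1) (leaf_d A (fun_form h)) 0 (leaf_d A (fun_form h))"
    by (rule leaf_d_lincomb[OF A ff ff])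
  finally have "lincomb 1 (lincomb 1 \<omega> 1 (leaf_d A (fun_form h))) 1 (leaf_d A (fun_form (\<lambda>x. - h x))) = \<omega>"
    by (simp add: lincomb_def)
  then have "scale_form (\<lambda>x. exp (- h x)) (scale_form (\<lambda>x. exp (h x)) \<alpha>)
    \<in> coboundaries A (lincomb 1 \<omega> 1 (leaf_d A (fun_form h))) k"
    using scale_exp_coboundaries[OF A smooth_fun_minus[OF A h]] \<alpha> by simp
  moreover have "scale_form (\<lambda>x. exp (- h x)) (scale_form (\<lambda>x. exp (h x)) \<alpha>) = \<alpha>"
    by (simp add: scale_form_def mult.assoc[symmetric] exp_add[symmetric])
  ultimately show ?thesis by simp
qed

text \<open>The results on time slices are applied to the pullbacks under the homotopy, arranged to
  be the identity at time 0 and \<open>f\<close> at time 1. The function \<open>h\<close> is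
  obtained from \<open>\<omega>\<close> and the homotopy before \<open>k\<close> and
  \<open>\<alpha>\<close> are introduced; the surjectivity argument depends on this order.\<close>

lemma homotopic_to_id:
  fixes A :: "('a::{t2_space,second_countable_topology}, 'p::real_normed_vector \<times> 'q::real_normed_vector) chart set"
  assumes A: "foliated_atlas A" and hom: "foliated_homotopic A A f id" and \<omega>: "leafwise_closed_1form A \<omega>"
  obtains h where "smooth_fun A h" "pullback A A f \<omega> = lincomb 1 \<omega> 1 (leaf_d A (fun_form h))"
    "\<And>k \<alpha>. \<alpha> \<in> cocycles A \<omega> k \<Longrightarrow>
      lincomb 1 (scale_form (\<lambda>x. exp (h x)) (pullback A A f \<alpha>)) (-1) \<alpha> \<in> coboundaries A \<omega> k"
proof -
  note sm = foliated_atlas_smooth[OF A]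
  note B = foliated_atlas_line[OF A]
  obtain F where F: "tangential (line_atlas A) A F" "F \<circ> at_time 0 = id" "F \<circ> at_time 1 = f"
    by (rule homotopy_on_line[OF A A hom])
  note at = tangential_at_time[OF A]
  have "smooth_map A A f" using hom unfolding foliated_homotopic_def foliated_map_def by blast
  then have p1: "pullback A (line_atlas A) (at_time 1) (pullback (line_atlas A) A F \<alpha>) = pullback A A f \<alpha>" for \<alpha>
    using pullback_compose[OF A B A at F(1), of 1 \<alpha>] F(3) by simp
  have p0: "pullback A (line_atlas A) (at_time 0) (pullback (line_atlas A) A F \<alpha>) = \<alpha>"
    if "\<alpha> \<in> leaf_forms A k" for \<alpha> k
    using pullback_compose[OF A B A at F(1), of 0 \<alpha>] F(2) smooth_map_id[OF sm] pullback_id[OF A that] by simp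
  let ?\<Omega> = "pullback (line_atlas A) A F \<omega>"
  have \<omega>1: "\<omega> \<in> leaf_forms A 1" using \<omega> by (simp add: leafwise_closed_1form_def)
  have \<Omega>: "?\<Omega> \<in> leaf_forms (line_atlas A) 1" "leaf_d (line_atlas A) ?\<Omega> = zero_form"
    using closed_pullback[OF B A F(1) \<omega>] by (simp_all add: leafwise_closed_1form_def)
  let ?h = "\<lambda>x. time_potential A ?\<Omega> (x, 1)"
  show ?thesis
  proof (rule that[of ?h])
    show "smooth_fun A ?h" by (rule smooth_time_potential_at[OF A \<Omega>(1)])
    show "pullback A A f \<omega> = lincomb 1 \<omega> 1 (leaf_d A (fun_form ?h))"
      using pullback_at_time_exact[OF A \<Omega>] unfolding p1 p0[OF \<omega>1] .
  next
    fix k \<alpha> assume \<alpha>: "\<alpha> \<in> cocycles A \<omega> k"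
    let ?\<beta> = "pullback (line_atlas A) A F \<alpha>"
    have \<alpha>k: "\<alpha> \<in> leaf_forms A k" using \<alpha> by (simp add: cocycles_def)
    have \<beta>: "?\<beta> \<in> leaf_forms (line_atlas A) k" "twisted_d (line_atlas A) ?\<Omega> ?\<beta> = zero_form"
      using cocycles_pullback[OF B A F(1) \<alpha>] by (simp_all add: cocycles_def)
    define \<gamma> where "\<gamma> = scale_form (\<lambda>p. exp (time_potential A ?\<Omega> p)) ?\<beta>"
    have eq: "lincomb 1 (scale_form (\<lambda>x. exp (?h x)) (pullback A A f \<alpha>)) (-1) \<alpha> = twisted_d A \<omega> (fiber_integral A \<gamma>)"
      using pullback_at_time_cohomologous(1)[OF A \<Omega> \<beta>] unfolding p1 p0[OF \<omega>1] p0[OF \<alpha>k] \<gamma>_def .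
    have \<gamma>: "\<gamma> \<in> leaf_forms (line_atlas A) k"
      unfolding \<gamma>_def by (rule pullback_at_time_cohomologous(2)[OF A \<Omega> \<beta>])
    show "lincomb 1 (scale_form (\<lambda>x. exp (?h x)) (pullback A A f \<alpha>)) (-1) \<alpha> \<in> coboundaries A \<omega> k"
    proof (cases k)
      case 0
      \<comment> \<open>In degree 0 the list always contains the time vector and is too long for
        \<open>\<gamma>\<close>. This matches the convention that only the zero form is a coboundary
        in degree 0.\<close>
      have "fiber_integral A \<gamma> = zero_form"
        using leaf_forms_zero[OF \<gamma>] 0 by (auto simp: fiber_integral_def zero_form_def fun_eq_iff)
      then show ?thesis unfolding eq using 0 twisted_d_zero[OF sm] by (simp add: coboundaries_def)
    next
      case (Suc j)
      then show ?thesis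
        unfolding eq using fiber_integral_leaf_forms[OF A \<gamma>[unfolded Suc]] by (simp add: coboundaries_def)
    qed
  qed
qed

text \<open>Injectivity in cohomology for a map with a one-sided homotopy inverse. In this
  generality it applies to \<open>f\<close>, and to \<open>g\<close> with the twist pulled back
  along \<open>f\<close>.\<close>

lemma pullback_reflects_coboundaries:
  fixes A :: "('a::{t2_space,second_countable_topology}, 'p::real_normed_vector \<times> 'q::real_normed_vector) chart set"
    and A' :: "('b::{t2_space,second_countable_topology}, 'r::real_normed_vector \<times> 's::real_normed_vector) chart set"
  assumes A: "foliated_atlas A" "foliated_atlas A'" and f: "tangential A A' f" and g: "tangential A' A g"
    and hom: "foliated_homotopic A' A' (f \<circ> g) id" and \<omega>: "leafwise_closed_1form A' \<omega>"
    and \<alpha>: "\<alpha> \<in> cocycles A' \<omega> k" and cob: "pullback A A' f \<alpha> \<in> coboundaries A (pullback A A' f \<omega>) k"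
  shows "\<alpha> \<in> coboundaries A' \<omega> k"
proof -
  note sm = foliated_atlas_smooth[OF A(2)]
  obtain h where h: "smooth_fun A' h" "pullback A' A' (f \<circ> g) \<omega> = lincomb 1 \<omega> 1 (leaf_d A' (fun_form h))"
    and hc: "lincomb 1 (scale_form (\<lambda>x. exp (h x)) (pullback A' A' (f \<circ> g) \<alpha>)) (-1) \<alpha> \<in> coboundaries A' \<omega> k"
    using homotopic_to_id[OF A(2) hom \<omega>] \<alpha> by metis
  have "smooth_map A' A' (f \<circ> g)" using hom unfolding foliated_homotopic_def foliated_map_def by blast
  note comp = pullback_compose[OF A(2,1,2) g f this]
  let ?\<beta> = "scale_form (\<lambda>x. exp (h x)) (pullback A' A' (f \<circ> g) \<alpha>)"
  have "?\<beta> \<in> coboundaries A' \<omega> k"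
    using scale_exp_coboundaries[OF sm h(1)] coboundaries_pullback[OF A(2,1) g cob] h(2) unfolding comp by simp
  moreover have "\<alpha> = lincomb 1 ?\<beta> (-1) (lincomb 1 ?\<beta> (-1) \<alpha>)" by (simp add: lincomb_def)
  ultimately show ?thesis using coboundaries_lincomb[OF sm _ hc] by metis
qed

theorem corollary3p8:
  fixes A0 Q0 :: "('a::{t2_space,second_countable_topology},
                   'p::real_normed_vector \<times> 'q::real_normed_vector) chart set"
    and A1 Q1 :: "('b::{t2_space,second_countable_topology},
                   'r::real_normed_vector \<times> 's::real_normed_vector) chart set"
    and f :: "'a \<Rightarrow> 'b"
    and \<omega> :: "('b, 'r \<times> 's) form"
  assumes "compact (UNIV :: 'a set)" and "orientation A0 Q0" and "riemannian_foliation A0"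
    and "compact (UNIV :: 'b set)" and "orientation A1 Q1" and "riemannian_foliation A1"
    and "foliated_homotopy_equivalence A0 A1 f"
    and "leafwise_closed_1form A1 \<omega>"
  shows "\<forall>k. isomorphic (cohomology A1 \<omega> k) (cohomology A0 (pullback A0 A1 f \<omega>) k)"
proof
  fix k
  have A: "foliated_atlas A0" "foliated_atlas A1"
    using assms(3,6) unfolding riemannian_foliation_def by blast+
  note sm = foliated_atlas_smooth[OF A(1)] foliated_atlas_smooth[OF A(2)]
  obtain g where fg: "foliated_map A0 A1 f" "foliated_map A1 A0 g"
    and hom: "foliated_homotopic A1 A1 (f \<circ> g) id" "foliated_homotopic A0 A0 (g \<circ> f) id"
    using assms(7) unfolding foliated_homotopy_equivalence_def by blast
  note f = foliated_map_tangential[OF A fg(1)]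
  note g = foliated_map_tangential[OF A(2,1) fg(2)]
  note \<omega> = assms(8)
  let ?f = "pullback A0 A1 f" and ?g = "pullback A1 A0 g"
  note f\<omega> = closed_pullback[OF A f \<omega>]
  show "isomorphic (cohomology A1 \<omega> k) (cohomology A0 (?f \<omega>) k)"
  proof (rule isomorphic_cohomologyI[OF sm(2,1), where P = ?f])
    show "?f \<alpha> \<in> cocycles A0 (?f \<omega>) k" if "\<alpha> \<in> cocycles A1 \<omega> k" for \<alpha>
      by (rule cocycles_pullback[OF A f that])
    show "?f (lincomb r \<alpha> s \<beta>) = lincomb r (?f \<alpha>) s (?f \<beta>)" for r \<alpha> s \<beta>
      by (rule lincomb_pullback)
    show "?f \<alpha> \<in> coboundaries A0 (?f \<omega>) k" if "\<alpha> \<in> coboundaries A1 \<omega> k" for \<alpha>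
      by (rule coboundaries_pullback[OF A f that])
    show "\<alpha> \<in> coboundaries A1 \<omega> k" if "\<alpha> \<in> cocycles A1 \<omega> k" "?f \<alpha> \<in> coboundaries A0 (?f \<omega>) k" for \<alpha>
      by (rule pullback_reflects_coboundaries[OF A f g hom(1) \<omega> that])
  next
    fix \<beta> assume \<beta>: "\<beta> \<in> cocycles A0 (?f \<omega>) k"
    obtain h where h: "smooth_fun A1 h" "pullback A1 A1 (f \<circ> g) \<omega> = lincomb 1 \<omega> 1 (leaf_d A1 (fun_form h))"
      and hc: "\<And>\<alpha>. \<alpha> \<in> cocycles A1 \<omega> k \<Longrightarrow>
        lincomb 1 (scale_form (\<lambda>x. exp (h x)) (pullback A1 A1 (f \<circ> g) \<alpha>)) (-1) \<alpha> \<in> coboundaries A1 \<omega> k"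
      using homotopic_to_id[OF A(2) hom(1) \<omega>] by metis
    have "smooth_map A1 A1 (f \<circ> g)" using hom(1) unfolding foliated_homotopic_def foliated_map_def by blast
    note comp = pullback_compose[OF A(2,1,2) g f this]
    let ?e = "scale_form (\<lambda>x. exp (h x))"
    \<comment> \<open>The pullback of \<open>\<beta>\<close> under \<open>g\<close> is a cocycle for
      the twist pulled back along \<open>f \<circ> g\<close>, that is \<open>\<omega> + dh\<close>;
      the exponential factor converts it to the twist \<open>\<omega>\<close>.\<close>
    define \<alpha> where "\<alpha> = ?e (?g \<beta>)"
    have \<alpha>: "\<alpha> \<in> cocycles A1 \<omega> k"
      unfolding \<alpha>_def using scale_exp_cocycles[OF sm(2) h(1)] cocycles_pullback[OF A(2,1) g \<beta>] h(2)
      unfolding comp by simp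
    let ?\<delta> = "lincomb 1 (?f \<alpha>) (-1) \<beta>"
    have \<delta>: "?\<delta> \<in> cocycles A0 (?f \<omega>) k"
      by (rule cocycles_lincomb[OF sm(1) cocycles_pullback[OF A f \<alpha>] \<beta>])
    \<comment> \<open>By the definition of \<open>\<alpha>\<close> the second term is
      \<open>\<alpha>\<close> itself, so this is the difference that \<open>hc\<close> declares a
      coboundary. Removing the exponential factor and then using injectivity of \<open>?g\<close>
      settles \<open>?\<delta>\<close>.\<close>
    have "?e (?g ?\<delta>) = lincomb 1 (?e (pullback A1 A1 (f \<circ> g) \<alpha>)) (-1) \<alpha>"
      unfolding comp lincomb_pullback by (simp add: \<alpha>_def lincomb_def scale_form_def algebra_simps)
    then have "?g ?\<delta> \<in> coboundaries A1 (?g (?f \<omega>)) k"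
      using scale_exp_coboundaries_rev[OF sm(2) h(1), of "?g ?\<delta>" \<omega> k] hc[OF \<alpha>] h(2) unfolding comp by simp
    then have "?\<delta> \<in> coboundaries A0 (?f \<omega>) k"
      by (rule pullback_reflects_coboundaries[OF A(2,1) g f hom(2) f\<omega> \<delta>])
    then show "\<exists>\<alpha>\<in>cocycles A1 \<omega> k. lincomb 1 (?f \<alpha>) (-1) \<beta> \<in> coboundaries A0 (?f \<omega>) k"
      using \<alpha> by blast
  qed
qed

end
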